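(* Let $y>0$, $n\ge1$ an integer, and $0<\varepsilon<\min\{y/(n+1),1\}$. Let $X$ be a Lévy process with triplet $(\sigma^2,b,\nu)$ such that $\nu$ has a density $s$ satisfying $\sup_{|x|>\delta}|s^{(k)}(x)|<\infty$ for every integer $0\le k\le 2n+1$ and every $\delta>0$. Then, for every $1\le k\le n$, $$\hat d_k(y):=\lim_{m\to\infty}(L^kf_m)(0)=\sum_{\mathbf k\in\mathcal K_k}\hat c_{\mathbf k}\binom{k}{\mathbf k}a_{\mathbf k},$$ where, for $\mathbf k=(k_0,\dots,k_4)$ and $\ell_{\mathbf k}:=k_1+2k_2+2k_4$, $$\hat c_{\mathbf k}:=b_0^{k_0}b_1^{k_1}b_2^{k_2}(-1)^{(k_1-1)\mathbf 1\{\ell_{\mathbf k}>0\}},$$ $$a_{\mathbf k}=a_{\mathbf k}(y):=\begin{cases}\displaystyle\int(\bar c_\varepsilon s)^{(\ell_{\mathbf k}-1)}\Big(y-\sum_{i=2}^{k_3}u_i-\sum_{j=1}^{k_4}\beta_jw_j\Big)\,d\tilde\pi_{\mathbf k},&k_3>0,\ \ell_{\mathbf k}>0,\\[2mm]\displaystyle\int\mathbf 1\Big\{\sum_{i=1}^{k_3}u_i\ge y\Big\}\,d\pi_{\mathbf k},&k_3>0,\ \ell_{\mathbf k}=0,\\[2mm]0,&\text{otherwise.}\end{cases}$$ In particular, the limit $$\mathcal R_n(t,y):=\lim_{m\to\infty}\int_0^1(1-\alpha)^n\,\mathbb{E}\big[(L^{n+1}f_m)(X_{\alpha t})\big]\,d\alpha$$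 exists, and moreover $$\mathbb{P}(X_t\ge y)=\sum_{k=1}^n\hat d_k(y)\frac{t^k}{k!}+\frac{t^{n+1}}{n!}\mathcal R_n(t,y).$$
   Context: A Lévy process $X=(X_t)_{t\ge0}$ ($t$ being the time variable) has triplet $(\sigma^2,b,\nu)$ if $X_t=bt+\sigma W_t+\int_0^t\int_{|x|\le1}x\,(\mu-\bar\mu)(dx,ds)+\int_0^t\int_{|x|>1}x\,\mu(dx,ds)$, where $W$ is a standard Brownian motion and $\mu$ is an independent Poisson random measure on $\mathbb{R}_+\times(\mathbb{R}\setminus\{0\})$ with mean measure $\bar\mu(dx,dt)=\nu(dx)\,dt$, $\nu$ being a Lévy measure. Its infinitesimal generator is $$(Lg)(x)=\frac{\sigma^2}{2}g''(x)+bg'(x)+\int\big(g(u+x)-g(x)-ug'(x)\mathbf 1_{\{|u|\le1\}}\big)\nu(du)$$ for $g\in C_b^2$, and $L^k$ is its $k$-th iterate. Mollified indicators: $\varphi\in C^\infty(\mathbb{R})$ is a symmetric nonnegative bump function with support in $[-1,1]$ and $\int\varphi=1$; $\varphi_m(x):=m\varphi(mx)$ and $f_m(x):=\int_{-\infty}^{x-y}\varphi_m(u)\,du$, i.e. $f_m=\mathbf 1_{[y,\infty)}*\varphi_m$. Fix a truncation function $c_\varepsilon\in C^\infty(\mathbb{R})$ with $\mathbf 1_{[-\varepsilon/2,\varepsilon/2]}\le c_\varepsilon\le\mathbf 1_{[-\varepsilon,\varepsilon]}$, $\bar c_\varepsilon:=1-c_\varepsilon$, and put $b_0:=-\int\bar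 c_\varepsilon(u)\,\nu(du)$, $b_1:=b-\int u\,(\mathbf 1_{\{|u|\le1\}}-c_\varepsilon(u))\,\nu(du)$, $b_2:=\sigma^2/2$. $\mathcal K_k$ is the set of $\mathbf k=(k_0,\dots,k_4)$ of nonnegative integers with $k_0+\dots+k_4=k$, and $\binom{k}{\mathbf k}=k!/(k_0!\cdots k_4!)$. For $\mathbf u=(u_1,\dots,u_{k_3})$, $\mathbf w=(w_1,\dots,w_{k_4})$, $\beta=(\beta_1,\dots,\beta_{k_4})$ define the finite measures $$d\pi_{\mathbf k}(\mathbf u,\mathbf w,\beta)=\prod_{i=1}^{k_3}\bar c_\varepsilon(u_i)\nu(du_i)\prod_{j=1}^{k_4}c_\varepsilon(w_j)w_j^2\nu(dw_j)\prod_{j=1}^{k_4}(1-\beta_j)d\beta_j$$ on $\mathbb{R}^{k_3+k_4}\times[0,1]^{k_4}$, and $$d\tilde\pi_{\mathbf k}(u_2,\dots,u_{k_3},\mathbf w,\beta)=\prod_{i=2}^{k_3}\bar c_\varepsilon(u_i)\nu(du_i)\prod_{j=1}^{k_4}c_\varepsilon(w_j)w_j^2\nu(dw_j)\prod_{j=1}^{k_4}(1-\beta_j)d\beta_j .$$ Conventions: $\int g\,d\pi_{\mathbf k}=g$ when $k_3=k_4=0$; $\int g\,d\tilde\pi_{\mathbf k}=g$ when $k_4=0$ and $k_3\in\{0,1\}$; empty sums are $0$.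
   Formalization: The final identity for P(X_t ≥ y) is claimed except when σ=0, ν(ℝ)<∞ and y=t(b−∫_{|u|≤1}u ν(du)); there X_t has an atom at y and, as f_m(y)=1/2, the identity fails (e.g. ν=0, σ=0, b=1, t=y gives 1 versus 1/2). *)

theory Defs
  imports "HOL-Probability.Probability"
begin

definition times_differentiable_on :: "nat \<Rightarrow> (real \<Rightarrow> real) \<Rightarrow> real set \<Rightarrow> bool" where
  "times_differentiable_on N f S \<longleftrightarrow>
     (\<forall>k<N. \<forall>x\<in>S. (deriv ^^ k) f field_differentiable (at x))"

definition smooth :: "(real \<Rightarrow> real) \<Rightarrow> bool" where
  "smooth f \<longleftrightarrow> (\<forall>N. times_differentiable_on N f UNIV)"

text \<open>Time runs over the nonnegative reals; processes are indexed by all reals, but their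
  values at negative times never matter.\<close>

definition indep_increments :: "'a measure \<Rightarrow> (real \<Rightarrow> 'a \<Rightarrow> real) \<Rightarrow> bool" where
  "indep_increments M X \<longleftrightarrow>
     (\<forall>\<tau> :: nat \<Rightarrow> real. 0 \<le> \<tau> 0 \<and> mono \<tau> \<longrightarrow>
        prob_space.indep_vars M (\<lambda>_. borel) (\<lambda>i \<omega>. X (\<tau> (Suc i)) \<omega> - X (\<tau> i) \<omega>) UNIV)"

definition levy_process :: "'a measure \<Rightarrow> (real \<Rightarrow> 'a \<Rightarrow> real) \<Rightarrow> bool" where
  "levy_process M X \<longleftrightarrow>
     prob_space M \<and>
     (\<forall>t\<ge>0. X t \<in> borel_measurable M) \<and>
     (AE \<omega> in M. X 0 \<omega> = 0) \<and>
     indep_increments M X \<and>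
     (\<forall>t\<ge>0. \<forall>h\<ge>0. distr M borel (\<lambda>\<omega>. X (t + h) \<omega> - X t \<omega>) = distr M borel (X h)) \<and>
     (AE \<omega> in M.
        (\<forall>t\<ge>0. continuous (at_right t) (\<lambda>r. X r \<omega>)) \<and>
        (\<forall>t>0. \<exists>l. ((\<lambda>r. X r \<omega>) \<longlongrightarrow> l) (at_left t)))"

definition brownian_motion :: "'a measure \<Rightarrow> (real \<Rightarrow> 'a \<Rightarrow> real) \<Rightarrow> bool" where
  "brownian_motion M W \<longleftrightarrow>
     prob_space M \<and>
     (\<forall>t\<ge>0. W t \<in> borel_measurable M) \<and>
     (AE \<omega> in M. W 0 \<omega> = 0) \<and>
     indep_increments M W \<and>
     (\<forall>r t. 0 \<le> r \<and> r < t \<longrightarrow>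
        distributed M lborel (\<lambda>\<omega>. W t \<omega> - W r \<omega>) (normal_density 0 (sqrt (t - r)))) \<and>
     (AE \<omega> in M. continuous_on {0..} (\<lambda>t. W t \<omega>))"

text \<open>A Poisson random measure \<open>\<mu>\<close> on the measurable space of \<open>m\<close> with mean measure \<open>m\<close>.
  The Poisson law is written out because \<open>poisson_pmf\<close> excludes the rate 0.\<close>

definition poisson_random_measure :: "'a measure \<Rightarrow> 'b measure \<Rightarrow> ('a \<Rightarrow> 'b measure) \<Rightarrow> bool" where
  "poisson_random_measure M m \<mu> \<longleftrightarrow>
     prob_space M \<and>
     (\<forall>\<omega>\<in>space M. sets (\<mu> \<omega>) = sets m) \<and>
     (\<forall>A\<in>sets m. (\<lambda>\<omega>. emeasure (\<mu> \<omega>) A) \<in> borel_measurable M) \<and>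
     (\<forall>A\<in>sets m. emeasure m A < \<infinity> \<longrightarrow>
        (\<forall>k::nat. measure M {\<omega> \<in> space M. emeasure (\<mu> \<omega>) A = of_nat k}
                  = measure m A ^ k / fact k * exp (- measure m A))) \<and>
     (\<forall>A\<in>sets m. emeasure m A = \<infinity> \<longrightarrow> (AE \<omega> in M. emeasure (\<mu> \<omega>) A = \<infinity>)) \<and>
     (\<forall>A :: nat \<Rightarrow> 'b set. range A \<subseteq> sets m \<and> disjoint_family A \<longrightarrow>
        prob_space.indep_vars M (\<lambda>_. borel) (\<lambda>i \<omega>. emeasure (\<mu> \<omega>) (A i)) UNIV)"

definition indep_process_random_measure ::
    "'a measure \<Rightarrow> (real \<Rightarrow> 'a \<Rightarrow> real) \<Rightarrow> 'b measure \<Rightarrow> ('a \<Rightarrow> 'b measure) \<Rightarrow> bool" where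
  "indep_process_random_measure M W m \<mu> \<longleftrightarrow>
     prob_space.indep_set M
       (sigma_sets (space M) {W t -` B \<inter> space M | t B. 0 \<le> t \<and> B \<in> sets borel})
       (sigma_sets (space M)
          {(\<lambda>\<omega>. emeasure (\<mu> \<omega>) A) -` B \<inter> space M | A B. A \<in> sets m \<and> B \<in> sets borel})"

definition levy_measure :: "real measure \<Rightarrow> bool" where
  "levy_measure \<nu> \<longleftrightarrow>
     sets \<nu> = sets borel \<and> emeasure \<nu> {0} = 0 \<and> (\<integral>\<^sup>+ x. ennreal (min 1 (x\<^sup>2)) \<partial>\<nu>) < \<infinity>"

text \<open>The mean measure \<open>\<nu>(dx) dt\<close> of the jump measure; points are pairs (time, jump size).\<close>

definition jump_intensity :: "real measure \<Rightarrow> (real \<times> real) measure" where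
  "jump_intensity \<nu> = restrict_space lborel {0..} \<Otimes>\<^sub>M restrict_space \<nu> (- {0})"

text \<open>The compensated integral of \<open>x\<close> over \<open>[0,t] \<times> {|x| \<le> 1}\<close> is not an absolutely convergent
  integral in general. It is the limit in \<open>L\<^sup>2\<close>, as \<open>\<delta> \<rightarrow> 0+\<close>, of the compensated integrals
  over \<open>[0,t] \<times> {\<delta> < |x| \<le> 1}\<close>, which are ordinary integrals.\<close>

definition compensated_jumps ::
    "('a \<Rightarrow> (real \<times> real) measure) \<Rightarrow> real measure \<Rightarrow> real \<Rightarrow> real \<Rightarrow> 'a \<Rightarrow> real" where
  "compensated_jumps \<mu> \<nu> t \<delta> \<omega> =
     (LINT p : {0..t} \<times> {x. \<delta> < \<bar>x\<bar> \<and> \<bar>x\<bar> \<le> 1} | \<mu> \<omega>. snd p)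
     - t * (LINT x : {x. \<delta> < \<bar>x\<bar> \<and> \<bar>x\<bar> \<le> 1} | \<nu>. x)"

definition is_compensated_small_jumps ::
    "'a measure \<Rightarrow> ('a \<Rightarrow> (real \<times> real) measure) \<Rightarrow> real measure \<Rightarrow> real \<Rightarrow> ('a \<Rightarrow> real) \<Rightarrow> bool" where
  "is_compensated_small_jumps M \<mu> \<nu> t J \<longleftrightarrow>
     J \<in> borel_measurable M \<and>
     ((\<lambda>\<delta>. \<integral>\<^sup>+ \<omega>. ennreal ((J \<omega> - compensated_jumps \<mu> \<nu> t \<delta> \<omega>)\<^sup>2) \<partial>M) \<longlongrightarrow> 0) (at_right 0)"

definition large_jumps :: "('a \<Rightarrow> (real \<times> real) measure) \<Rightarrow> real \<Rightarrow> 'a \<Rightarrow> real" where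
  "large_jumps \<mu> t \<omega> = (LINT p : {0..t} \<times> {x. \<bar>x\<bar> > 1} | \<mu> \<omega>. snd p)"

text \<open>The triplet is \<open>(\<sigma>\<^sup>2, b, \<nu>)\<close>; the sign of \<open>\<sigma>\<close> is immaterial. The representation holds
  almost surely for each \<open>t\<close>, so the choice of the \<open>L\<^sup>2\<close> limit \<open>J t\<close> is irrelevant.\<close>

definition levy_triplet ::
    "'a measure \<Rightarrow> (real \<Rightarrow> 'a \<Rightarrow> real) \<Rightarrow> real \<Rightarrow> real \<Rightarrow> real measure \<Rightarrow> bool" where
  "levy_triplet M X \<sigma> b \<nu> \<longleftrightarrow>
     levy_process M X \<and> levy_measure \<nu> \<and>
     (\<exists>W \<mu> J.
        brownian_motion M W \<and>
        poisson_random_measure M (jump_intensity \<nu>) \<mu> \<and>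
        indep_process_random_measure M W (jump_intensity \<nu>) \<mu> \<and>
        (\<forall>t\<ge>0. is_compensated_small_jumps M \<mu> \<nu> t (J t)) \<and>
        (\<forall>t\<ge>0. AE \<omega> in M. X t \<omega> = b * t + \<sigma> * W t \<omega> + J t \<omega> + large_jumps \<mu> t \<omega>))"

definition levy_gen ::
    "real \<Rightarrow> real \<Rightarrow> real measure \<Rightarrow> (real \<Rightarrow> real) \<Rightarrow> real \<Rightarrow> real" where
  "levy_gen \<sigma> b \<nu> g x =
     \<sigma>\<^sup>2 / 2 * (deriv ^^ 2) g x + b * deriv g x
     + (\<integral>u. (g (u + x) - g x - u * deriv g x * indicator {-1..1} u) \<partial>\<nu>)"

definition bump :: "(real \<Rightarrow> real) \<Rightarrow> bool" where
  "bump \<phi> \<longleftrightarrow>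
     smooth \<phi> \<and> (\<forall>x. \<phi> (- x) = \<phi> x) \<and> (\<forall>x. 0 \<le> \<phi> x) \<and> (\<forall>x. x \<notin> {-1..1} \<longrightarrow> \<phi> x = 0) \<and>
     (\<integral>x. \<phi> x \<partial>lborel) = 1"

definition mollifier :: "(real \<Rightarrow> real) \<Rightarrow> nat \<Rightarrow> real \<Rightarrow> real" where
  "mollifier \<phi> m x = real m * \<phi> (real m * x)"

definition moll_ind :: "(real \<Rightarrow> real) \<Rightarrow> real \<Rightarrow> nat \<Rightarrow> real \<Rightarrow> real" where
  "moll_ind \<phi> y m x = (LINT u : {..x - y} | lborel. mollifier \<phi> m u)"

definition truncation :: "real \<Rightarrow> (real \<Rightarrow> real) \<Rightarrow> bool" where
  "truncation \<epsilon> c \<longleftrightarrow>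
     smooth c \<and> (\<forall>x. indicator {-\<epsilon>/2..\<epsilon>/2} x \<le> c x \<and> c x \<le> indicator {-\<epsilon>..\<epsilon>} x)"

definition b0 :: "(real \<Rightarrow> real) \<Rightarrow> real measure \<Rightarrow> real" where
  "b0 c \<nu> = - (\<integral>u. (1 - c u) \<partial>\<nu>)"

definition b1 :: "(real \<Rightarrow> real) \<Rightarrow> real \<Rightarrow> real measure \<Rightarrow> real" where
  "b1 c b \<nu> = b - (\<integral>u. u * (indicator {-1..1} u - c u) \<partial>\<nu>)"

definition b2 :: "real \<Rightarrow> real" where
  "b2 \<sigma> = \<sigma>\<^sup>2 / 2"

type_synonym multi = "nat \<times> nat \<times> nat \<times> nat \<times> nat"

definition multis :: "nat \<Rightarrow> multi set" where
  "multis k = {(k0, k1, k2, k3, k4). k0 + k1 + k2 + k3 + k4 = k}"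

fun multinom :: "multi \<Rightarrow> real" where
  "multinom (k0, k1, k2, k3, k4) =
     fact (k0 + k1 + k2 + k3 + k4) / (fact k0 * fact k1 * fact k2 * fact k3 * fact k4)"

fun ell :: "multi \<Rightarrow> nat" where
  "ell (k0, k1, k2, k3, k4) = k1 + 2 * k2 + 2 * k4"

text \<open>The product measure with coordinates \<open>u i\<close> for \<open>i \<in> I\<close> and \<open>w j\<close>, \<open>\<beta> j\<close> for \<open>j \<in> J\<close>.
  A product over an empty index set is a unit point mass, which yields the conventions for
  absent variables.\<close>

definition coord_measure ::
    "(real \<Rightarrow> real) \<Rightarrow> real measure \<Rightarrow> nat set \<Rightarrow> nat set
      \<Rightarrow> ((nat \<Rightarrow> real) \<times> (nat \<Rightarrow> real) \<times> (nat \<Rightarrow> real)) measure" where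
  "coord_measure c \<nu> I J =
     (\<Pi>\<^sub>M i\<in>I. density \<nu> (\<lambda>u. ennreal (1 - c u))) \<Otimes>\<^sub>M
     ((\<Pi>\<^sub>M j\<in>J. density \<nu> (\<lambda>w. ennreal (c w * w\<^sup>2))) \<Otimes>\<^sub>M
      (\<Pi>\<^sub>M j\<in>J. density lborel (\<lambda>\<beta>. ennreal ((1 - \<beta>) * indicator {0..1} \<beta>))))"

fun pi_meas ::
    "(real \<Rightarrow> real) \<Rightarrow> real measure \<Rightarrow> multi
    \<Rightarrow> ((nat \<Rightarrow> real) \<times> (nat \<Rightarrow> real) \<times> (nat \<Rightarrow> real)) measure" where
  "pi_meas c \<nu> (k0, k1, k2, k3, k4) = coord_measure c \<nu> {1..k3} {1..k4}"

fun pi_tilde ::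
    "(real \<Rightarrow> real) \<Rightarrow> real measure \<Rightarrow> multi
    \<Rightarrow> ((nat \<Rightarrow> real) \<times> (nat \<Rightarrow> real) \<times> (nat \<Rightarrow> real)) measure" where
  "pi_tilde c \<nu> (k0, k1, k2, k3, k4) = coord_measure c \<nu> {2..k3} {1..k4}"

fun c_hat :: "(real \<Rightarrow> real) \<Rightarrow> real \<Rightarrow> real \<Rightarrow> real measure \<Rightarrow> multi \<Rightarrow> real" where
  "c_hat c \<sigma> b \<nu> (k0, k1, k2, k3, k4) =
     b0 c \<nu> ^ k0 * b1 c b \<nu> ^ k1 * b2 \<sigma> ^ k2
     * (-1) powi ((int k1 - 1) * of_bool (ell (k0, k1, k2, k3, k4) > 0))"

fun a_coeff ::
    "(real \<Rightarrow> real) \<Rightarrow> (real \<Rightarrow> real) \<Rightarrow> real measure \<Rightarrow> real \<Rightarrow> multi \<Rightarrow> real" where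
  "a_coeff c s \<nu> y (k0, k1, k2, k3, k4) =
     (let kk = (k0, k1, k2, k3, k4) in
      if k3 > 0 \<and> ell kk > 0 then
        (\<integral>(u, w, \<beta>). (deriv ^^ (ell kk - 1)) (\<lambda>x. (1 - c x) * s x)
             (y - (\<Sum>i=2..k3. u i) - (\<Sum>j=1..k4. \<beta> j * w j)) \<partial>(pi_tilde c \<nu> kk))
      else if k3 > 0 \<and> ell kk = 0 then
        (\<integral>(u, w, \<beta>). of_bool ((\<Sum>i=1..k3. u i) \<ge> y) \<partial>(pi_meas c \<nu> kk))
      else 0)"

definition gen_seq ::
    "(real \<Rightarrow> real) \<Rightarrow> real \<Rightarrow> real \<Rightarrow> real measure \<Rightarrow> nat \<Rightarrow> real \<Rightarrow> nat \<Rightarrow> real" where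
  "gen_seq \<phi> \<sigma> b \<nu> k y m = (levy_gen \<sigma> b \<nu> ^^ k) (moll_ind \<phi> y m) 0"

definition d_hat ::
    "(real \<Rightarrow> real) \<Rightarrow> real \<Rightarrow> real \<Rightarrow> real measure \<Rightarrow> nat \<Rightarrow> real \<Rightarrow> real" where
  "d_hat \<phi> \<sigma> b \<nu> k y = lim (gen_seq \<phi> \<sigma> b \<nu> k y)"

definition rem_seq ::
    "'a measure \<Rightarrow> (real \<Rightarrow> 'a \<Rightarrow> real) \<Rightarrow> (real \<Rightarrow> real) \<Rightarrow> real \<Rightarrow> real \<Rightarrow> real measure
      \<Rightarrow> nat \<Rightarrow> real \<Rightarrow> real \<Rightarrow> nat \<Rightarrow> real" where
  "rem_seq M X \<phi> \<sigma> b \<nu> n t y m =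
     (LINT \<alpha> : {0..1} | lborel. (1 - \<alpha>) ^ n *
        (\<integral>\<omega>. (levy_gen \<sigma> b \<nu> ^^ (n + 1)) (moll_ind \<phi> y m) (X (\<alpha> * t) \<omega>) \<partial>M))"

definition remainder ::
    "'a measure \<Rightarrow> (real \<Rightarrow> 'a \<Rightarrow> real) \<Rightarrow> (real \<Rightarrow> real) \<Rightarrow> real \<Rightarrow> real \<Rightarrow> real measure
      \<Rightarrow> nat \<Rightarrow> real \<Rightarrow> real \<Rightarrow> real" where
  "remainder M X \<phi> \<sigma> b \<nu> n t y = lim (rem_seq M X \<phi> \<sigma> b \<nu> n t y)"

text \<open>Pure-jump processes of finite activity have an atom: with positive probability there is
  no jump before \<open>t\<close>, and then \<open>X\<^sub>t\<close> equals \<open>t (b - \<integral>\<^bsub>|u| \<le> 1\<^esub> u \<nu>(du))\<close>. If this value is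
  \<open>y\<close>, then the symmetric mollifications, all equal to \<open>1/2\<close> at \<open>y\<close>, give
  \<open>P(X\<^sub>t > y) + P(X\<^sub>t = y) / 2\<close> in the limit rather than \<open>P(X\<^sub>t \<ge> y)\<close>. For \<open>t > 0\<close> and \<open>\<nu>\<close> with a
  Lebesgue density, this is the only way in which \<open>X\<^sub>t\<close> can have an atom at \<open>y\<close>.\<close>

definition drift_atom :: "real \<Rightarrow> real \<Rightarrow> real measure \<Rightarrow> real \<Rightarrow> real \<Rightarrow> bool" where
  "drift_atom \<sigma> b \<nu> t y \<longleftrightarrow>
     \<sigma> = 0 \<and> emeasure \<nu> UNIV < \<infinity> \<and> y = t * (b - (LINT u : {-1..1} | \<nu>. u))"

end

theory Submission
  imports Defs
begin

text \<open>The law of \<open>X\<^sub>t\<close> enters only through its characteristic function \<open>exp (t \<psi>)\<close>, which is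
  read off the Levy-Ito representation: for a simple integrand the Poisson integral is a finite sum
  of independent scaled Poisson variables, and the compensated small jumps are an \<open>L\<^sup>2\<close> limit.
  Therefore \<open>d/dt E g(X\<^sub>t) = E (L g)(X\<^sub>t)\<close> holds for \<open>g x = cos (\<xi> x + \<theta>)\<close>. It extends to every
  \<open>g\<close> with bounded derivatives, because such a \<open>g\<close> is a limit of trigonometric polynomials whose
  first two derivatives converge boundedly as well. Taylor's formula in \<open>t\<close>, applied to \<open>E f\<^sub>m(X\<^sub>t)\<close>,
  gives the expansion with remainder.

  On functions with bounded derivatives, \<open>L g = b\<^sub>0 g + b\<^sub>1 g' + b\<^sub>2 g'' + U g + V g''\<close>, where \<open>U\<close> and
  \<open>V\<close> average over shifts by finite measures. The five operators commute, so \<open>L\<^sup>k\<close> is given by the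
  multinomial theorem, and each of its terms at 0 integrates a derivative of \<open>f\<^sub>m\<close> against a
  convolution power of the two measures. Without a big jump the term vanishes for large \<open>m\<close>, since
  \<open>n + 1\<close> small jumps do not reach \<open>y\<close>; otherwise the derivatives are moved by parts to the density
  of one big jump. Because \<open>k = n + 1\<close> is covered too, the remainder also converges at \<open>t = 0\<close>.

  Finally \<open>E f\<^sub>m(X\<^sub>t)\<close> tends to \<open>P(X\<^sub>t \<ge> y)\<close> as soon as \<open>X\<^sub>t\<close> has no atom at \<open>y\<close>. The mass of an
  atom is bounded by the limit of the averages of \<open>exp (-i k \<eta> y) exp (t \<psi>(k \<eta>))\<close> over \<open>k\<close>, and this
  limit is 0 by the Riemann-Lebesgue lemma.\<close>

section \<open>Functions with bounded derivatives and averages over finite measures\<close>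

text \<open>No stochastic calculus enters: Dynkin's formula uses only the one-dimensional laws and
  the fact that the operator multiplies the wave of frequency \<xi> by \<psi> \<xi>. The function
  class asks for bounded derivatives of every order because each application of the generator costs
  two of them; it has to be stable under iterates, derivatives and averages, and it contains the
  mollified indicators, whose derivatives are scaled bumps. The density \<open>s\<close> may explode
  at 0, so only the measure of the big jumps can absorb derivatives. One big jump is enough: it
  takes one of at most n + 1 factors and leaves at most 2 n derivatives for the others. Since the
  averages commute, one big-jump average can act on the mollified indicator before all the rest.
  This yields bounds uniform in m, and the remaining averages are then handled by dominated
  convergence. For t > 0 the remainder is never estimated. The Taylor identity is solved for it, so
  it converges whether or not there is an atom at y; an atom affects only the identification of the
  limit of the expectations with the tail probability.\<close>

definition Cb :: "(real \<Rightarrow> real) \<Rightarrow> bool" where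
  "Cb g \<longleftrightarrow> (\<forall>k. (\<forall>x. (deriv ^^ k) g field_differentiable at x) \<and>
    (\<exists>B. \<forall>x. \<bar>(deriv ^^ k) g x\<bar> \<le> B))"

text \<open>The candidate derivatives are named in advance, so that membership and the iterates of
  \<open>deriv\<close> come out of a single induction; the closure rules below are
  instances.\<close>

lemma CbI:
  assumes 0: "G 0 = g" and D: "\<And>k x. (G k has_real_derivative G (Suc k) x) (at x)"
    and B: "\<And>k. \<exists>B. \<forall>x. \<bar>G k x\<bar> \<le> B"
  shows "Cb g" and "(deriv ^^ k) g = G k"
proof -
  have *: "(deriv ^^ k) g = G k" for k
  proof (induction k)
    case (Suc k)
    show ?case by (rule ext) (simp add: Suc DERIV_imp_deriv[OF D])
  qed (simp add: 0)
  then show "(deriv ^^ k) g = G k" .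
  show "Cb g" unfolding Cb_def *
    using D B field_differentiable_def by blast
qed

lemma Cb_DERIV: "Cb g \<Longrightarrow> ((deriv ^^ k) g has_real_derivative (deriv ^^ Suc k) g x) (at x)"
  unfolding Cb_def by (simp add: DERIV_deriv_iff_field_differentiable)

lemma Cb_DERIV0: "Cb g \<Longrightarrow> (g has_real_derivative deriv g x) (at x)"
  using Cb_DERIV[of g 0 x] by simp

lemma Cb_bound: assumes "Cb g" obtains B where "0 \<le> B" "\<And>x. \<bar>(deriv ^^ k) g x\<bar> \<le> B"
  using assms unfolding Cb_def by (meson abs_ge_zero order_trans)

lemma Cb_bound0: assumes "Cb g" obtains B where "0 \<le> B" "\<And>x. \<bar>g x\<bar> \<le> B"
  using Cb_bound[OF assms, where k=0] by auto

lemma Cb_deriv: assumes "Cb g" shows "Cb (deriv g)"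
  unfolding Cb_def
proof
  fix k show "(\<forall>x. (deriv ^^ k) (deriv g) field_differentiable at x) \<and> (\<exists>B. \<forall>x. \<bar>(deriv ^^ k) (deriv g) x\<bar> \<le> B)"
    using assms[unfolded Cb_def, THEN spec, of "Suc k"] by (simp add: funpow_Suc_right del: funpow.simps)
qed

lemma Cb_derivs: "Cb g \<Longrightarrow> Cb ((deriv ^^ k) g)"
  by (induction k) (auto intro: Cb_deriv)

lemma Cb_isCont: "Cb g \<Longrightarrow> isCont g x"
  using Cb_DERIV0 DERIV_isCont by blast

lemma Cb_measurable: "Cb g \<Longrightarrow> g \<in> borel_measurable borel"
  using Cb_isCont by (intro borel_measurable_continuous_onI continuous_at_imp_continuous_on) auto

text \<open>Scalar multiples and sums of two functions are read off with index sets of one and of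
  two points.\<close>

lemma Cb_sum:
  assumes "\<And>i. i \<in> A \<Longrightarrow> Cb (g i)"
  shows "Cb (\<lambda>x. \<Sum>i\<in>A. a i * g i x)"
    and "(deriv ^^ k) (\<lambda>x. \<Sum>i\<in>A. a i * g i x) = (\<lambda>x. \<Sum>i\<in>A. a i * (deriv ^^ k) (g i) x)"
proof -
  let ?G = "\<lambda>k x. \<Sum>i\<in>A. a i * (deriv ^^ k) (g i) x"
  have D: "(?G k has_real_derivative ?G (Suc k) x) (at x)" for k x
    by (intro DERIV_sum DERIV_cmult Cb_DERIV assms)
  have B: "\<exists>B. \<forall>x. \<bar>?G k x\<bar> \<le> B" for k
  proof -
    have "\<exists>b. \<forall>x. \<bar>(deriv ^^ k) (g i) x\<bar> \<le> b" if "i \<in> A" for i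
      using assms[OF that] by (auto simp: Cb_def)
    then obtain b where b: "\<And>i x. i \<in> A \<Longrightarrow> \<bar>(deriv ^^ k) (g i) x\<bar> \<le> b i" by metis
    have "\<bar>?G k x\<bar> \<le> (\<Sum>i\<in>A. \<bar>a i\<bar> * b i)" for x
      by (rule order_trans[OF sum_abs]) (auto simp: abs_mult intro!: sum_mono mult_left_mono b)
    then show ?thesis by blast
  qed
  show "Cb (\<lambda>x. \<Sum>i\<in>A. a i * g i x)" by (rule CbI(1)[of ?G]) (use D B in auto)
  show "(deriv ^^ k) (\<lambda>x. \<Sum>i\<in>A. a i * g i x) = ?G k" by (rule CbI(2)[of ?G]) (use D B in auto)
qed

lemma Cb_cmult:
  assumes "Cb g"
  shows "Cb (\<lambda>x. a * g x)" and "(deriv ^^ k) (\<lambda>x. a * g x) = (\<lambda>x. a * (deriv ^^ k) g x)"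
  using Cb_sum[where A="{()}" and g="\<lambda>_. g" and a="\<lambda>_. a"] assms by auto

lemma Cb_add:
  assumes "Cb f" "Cb g"
  shows "Cb (\<lambda>x. f x + g x)" and "(deriv ^^ k) (\<lambda>x. f x + g x) = (\<lambda>x. (deriv ^^ k) f x + (deriv ^^ k) g x)"
  using Cb_sum[where A="UNIV::bool set" and g="\<lambda>b. if b then f else g" and a="\<lambda>_. 1"] assms
  by (auto simp: UNIV_bool add.commute)

lemma Cb_shift:
  assumes "Cb g"
  shows "Cb (\<lambda>x. g (x + a))" and "(deriv ^^ k) (\<lambda>x. g (x + a)) = (\<lambda>x. (deriv ^^ k) g (x + a))"
proof -
  let ?G = "\<lambda>k x. (deriv ^^ k) g (x + a)"
  have D: "(?G k has_real_derivative ?G (Suc k) x) (at x)" for k x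
    using Cb_DERIV[OF assms, of k "x + a"] by (simp only: DERIV_shift)
  have B: "\<exists>B. \<forall>x. \<bar>?G k x\<bar> \<le> B" for k
    using assms unfolding Cb_def by metis
  show "Cb (\<lambda>x. g (x + a))" by (rule CbI(1)[of ?G]) (use D B in auto)
  show "(deriv ^^ k) (\<lambda>x. g (x + a)) = ?G k" by (rule CbI(2)[of ?G]) (use D B in auto)
qed

section \<open>Averages over shifts by a finite measure\<close>

definition fin_borel :: "real measure \<Rightarrow> bool" where
  "fin_borel \<kappa> \<longleftrightarrow> finite_measure \<kappa> \<and> sets \<kappa> = sets borel"

lemma fin_borelD: assumes "fin_borel \<kappa>"
  shows "finite_measure \<kappa>" "sets \<kappa> = sets borel" "space \<kappa> = UNIV"
    "f \<in> borel_measurable borel \<Longrightarrow> f \<in> borel_measurable \<kappa>"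
  using assms sets_eq_imp_space_eq[of \<kappa> borel] measurable_cong_sets[of \<kappa> borel borel borel]
  by (auto simp: fin_borel_def)

lemma fin_borel_integrable:
  fixes f :: "real \<Rightarrow> 'b::{banach, second_countable_topology}"
  assumes "fin_borel \<kappa>" "f \<in> borel_measurable borel" "\<And>x. norm (f x) \<le> B"
  shows "integrable \<kappa> f"
proof -
  interpret finite_measure \<kappa> using fin_borelD(1)[OF assms(1)] .
  have "f \<in> borel_measurable \<kappa>"
    using assms(2) fin_borelD(2)[OF assms(1)] measurable_cong_sets by blast
  then show ?thesis using assms(3) by (intro integrable_const_bound[of _ B]) auto
qed

text \<open>Up to normalisation, the transition operator of a random walk with step law
  \<kappa>.\<close>

definition avg :: "real measure \<Rightarrow> (real \<Rightarrow> real) \<Rightarrow> real \<Rightarrow> real" where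
  "avg \<kappa> g x = (\<integral>v. g (x + v) \<partial>\<kappa>)"

lemma avg_bound:
  assumes "fin_borel \<kappa>" "\<And>x. \<bar>g x\<bar> \<le> B" "g \<in> borel_measurable borel"
  shows "\<bar>avg \<kappa> g x\<bar> \<le> measure \<kappa> UNIV * B"
proof -
  interpret finite_measure \<kappa> using fin_borelD(1)[OF assms(1)] .
  have "norm (\<integral>v. g (x + v) \<partial>\<kappa>) \<le> (\<integral>v. B \<partial>\<kappa>)"
    by (rule Bochner_Integration.integral_norm_bound_integral; (rule fin_borel_integrable[OF assms(1), of _ B])?) (use assms in \<open>auto intro: order_trans[OF abs_ge_zero]\<close>)
  then show ?thesis using fin_borelD(3)[OF assms(1)] by (simp add: avg_def mult.commute)
qed

text \<open>The mean value inequality bounds the difference quotients by \<open>B'\<close>, so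
  dominated convergence along sequences differentiates under the integral.\<close>

lemma DERIV_avg:
  assumes \<kappa>: "fin_borel \<kappa>" and D: "\<And>x. (g has_real_derivative g' x) (at x)"
    and B: "\<And>x. \<bar>g x\<bar> \<le> B" "\<And>x. \<bar>g' x\<bar> \<le> B'"
  shows "(avg \<kappa> g has_real_derivative avg \<kappa> g' x) (at x)"
proof -
  interpret finite_measure \<kappa> using fin_borelD(1)[OF \<kappa>] .
  have gm[measurable]: "g \<in> borel_measurable borel"
    using D DERIV_isCont by (intro borel_measurable_continuous_onI continuous_at_imp_continuous_on) auto
  have int: "integrable \<kappa> (\<lambda>v. g (z + v))" for z
    using B by (intro fin_borel_integrable[OF \<kappa>, of _ B]) auto
  have "((\<lambda>y. (avg \<kappa> g y - avg \<kappa> g x) / (y - x)) \<longlongrightarrow> avg \<kappa> g' x) (at x)"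
    unfolding tendsto_at_iff_sequentially comp_def
  proof (intro allI impI)
    fix X assume X: "\<forall>i. X i \<in> UNIV - {x}" "X \<longlonglongrightarrow> x"
    have lim: "(\<lambda>i. (g (X i + v) - g (x + v)) / (X i - x)) \<longlonglongrightarrow> g' (x + v)" for v
    proof -
      have "((\<lambda>y. (g y - g (x+v)) / (y - (x+v))) \<longlongrightarrow> g' (x+v)) (at (x+v))"
        using D[of "x+v"] by (simp add: has_field_derivative_iff)
      then have *: "\<And>Y. \<forall>i. Y i \<in> UNIV - {x+v} \<Longrightarrow> Y \<longlonglongrightarrow> x+v \<Longrightarrow>
          ((\<lambda>y. (g y - g (x+v)) / (y - (x+v))) \<circ> Y) \<longlonglongrightarrow> g' (x+v)"
        unfolding tendsto_at_iff_sequentially by blast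
      have "(\<lambda>i. X i + v) \<longlonglongrightarrow> x + v" by (intro tendsto_add X tendsto_const)
      then have "((\<lambda>y. (g y - g (x+v)) / (y - (x+v))) \<circ> (\<lambda>i. X i + v)) \<longlonglongrightarrow> g' (x+v)"
        using X(1) by (intro *) auto
      then show ?thesis by (simp add: comp_def)
    qed
    have bd: "\<bar>(g (z + v) - g (x + v)) / (z - x)\<bar> \<le> B'" if "z \<noteq> x" for z v
    proof -
      have "\<bar>g (z+v) - g (x+v)\<bar> \<le> B' * \<bar>(z+v) - (x+v)\<bar>"
        using field_differentiable_bound[of UNIV g g' B' "z+v" "x+v"] D B
        by auto
      then show ?thesis using that by (simp add: abs_divide divide_le_eq)
    qed
    \<comment> \<open>As a pointwise limit of difference quotients \<open>g'\<close> is measurable,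
      without any appeal to continuity.\<close>
    have g'm: "(\<lambda>v. g' (x + v)) \<in> borel_measurable borel"
      by (rule borel_measurable_LIMSEQ_metric[OF _ lim]) auto
    have "(\<lambda>i. \<integral>v. (g (X i + v) - g (x + v)) / (X i - x) \<partial>\<kappa>) \<longlonglongrightarrow> avg \<kappa> g' x"
      unfolding avg_def
      using lim g'm bd X
      by (intro integral_dominated_convergence[where w="\<lambda>_. B'"]) (auto intro!: fin_borelD(4)[OF \<kappa>])
    moreover have "(\<integral>v. (g (X i + v) - g (x + v)) / (X i - x) \<partial>\<kappa>) = (avg \<kappa> g (X i) - avg \<kappa> g x) / (X i - x)" for i
      unfolding avg_def using Bochner_Integration.integral_diff[OF int[of "X i"] int[of x]] by simp
    ultimately show "(\<lambda>i. (avg \<kappa> g (X i) - avg \<kappa> g x) / (X i - x)) \<longlonglongrightarrow> avg \<kappa> g' x" by (simp only:)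
  qed
  then show ?thesis by (simp add: has_field_derivative_iff)
qed

lemma Cb_avg:
  assumes \<kappa>: "fin_borel \<kappa>" and g: "Cb g"
  shows "Cb (avg \<kappa> g)" and "(deriv ^^ k) (avg \<kappa> g) = avg \<kappa> ((deriv ^^ k) g)"
proof -
  let ?G = "\<lambda>k. avg \<kappa> ((deriv ^^ k) g)"
  have D: "(?G k has_real_derivative ?G (Suc k) x) (at x)" for k x
  proof -
    obtain B where "\<And>x. \<bar>(deriv ^^ k) g x\<bar> \<le> B" using Cb_bound[OF g, where k=k] by blast
    moreover obtain B' where "\<And>x. \<bar>(deriv ^^ Suc k) g x\<bar> \<le> B'" using Cb_bound[OF g, where k="Suc k"] by blast
    ultimately show ?thesis by (intro DERIV_avg[OF \<kappa> Cb_DERIV[OF g]])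
  qed
  have B: "\<exists>B. \<forall>x. \<bar>?G k x\<bar> \<le> B" for k
  proof -
    obtain B where "\<And>x. \<bar>(deriv ^^ k) g x\<bar> \<le> B" using Cb_bound[OF g, where k=k] by blast
    from avg_bound[OF \<kappa> this Cb_measurable[OF Cb_derivs[OF g]]] show ?thesis by blast
  qed
  show "Cb (avg \<kappa> g)" by (rule CbI(1)[of ?G]) (use D B in auto)
  show "(deriv ^^ k) (avg \<kappa> g) = ?G k" by (rule CbI(2)[of ?G]) (use D B in auto)
qed

section \<open>Convolution of finite measures\<close>

lemma fin_borel_convolution:
  assumes "fin_borel A" "fin_borel B" shows "fin_borel (A \<star> B)"
  using assms convolution_finite[of A B] by (auto simp: fin_borel_def convolution_def)

text \<open>By Fubini, composing two averages is averaging over the convolution. Commutation of the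
  operators thereby reduces to commutativity of the convolution.\<close>

lemma avg_convolution:
  assumes A: "fin_borel A" and B: "fin_borel B" and g: "g \<in> borel_measurable borel" "\<And>x. \<bar>g x\<bar> \<le> K"
  shows "avg (A \<star> B) g x = avg A (avg B g) x"
proof -
  interpret A: finite_measure A using fin_borelD(1)[OF A] .
  interpret B: finite_measure B using fin_borelD(1)[OF B] .
  interpret P: pair_sigma_finite A B ..
  interpret AB: finite_measure "A \<Otimes>\<^sub>M B" by (rule finite_measure_pair_measure) unfold_locales
  have [measurable_cong]: "sets A = sets borel" "sets B = sets borel"
    using fin_borelD(2) A B by auto
  note g(1)[measurable]
  have "avg (A \<star> B) g x = (\<integral>p. g (x + (fst p + snd p)) \<partial>(A \<Otimes>\<^sub>M B))"
    unfolding avg_def convolution_def by (subst integral_distr) (auto simp: case_prod_beta)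
  also have "\<dots> = (\<integral>a. \<integral>b. g (x + (a + b)) \<partial>B \<partial>A)"
    by (subst P.integral_fst'[symmetric]) (auto intro!: AB.integrable_const_bound[of _ K] g)
  finally show ?thesis by (simp add: avg_def add.assoc)
qed

primrec conv_pow :: "real measure \<Rightarrow> nat \<Rightarrow> real measure" where
  "conv_pow \<kappa> 0 = return borel 0"
| "conv_pow \<kappa> (Suc k) = (\<kappa> \<star> conv_pow \<kappa> k)"

lemma fin_borel_return: "fin_borel (return borel 0)"
  by (auto simp: fin_borel_def intro!: prob_space.finite_measure prob_space_return)

lemma fin_borel_conv_pow: "fin_borel \<kappa> \<Longrightarrow> fin_borel (conv_pow \<kappa> k)"
  by (induction k) (auto intro: fin_borel_return fin_borel_convolution)

lemma conv_commute: "fin_borel A \<Longrightarrow> fin_borel B \<Longrightarrow> (A \<star> B) = (B \<star> A)"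
  by (rule convolution_commutative) (auto simp: fin_borel_def)

lemma conv_assoc: "fin_borel A \<Longrightarrow> fin_borel B \<Longrightarrow> fin_borel C \<Longrightarrow> (A \<star> (B \<star> C)) = ((A \<star> B) \<star> C)"
  by (rule convolution_associative) (auto simp: fin_borel_def)

section \<open>Poisson random measures\<close>

text \<open>The Poisson weights sum to 1 by the exponential series, which makes the value
  \<infinity> a null event. The same series with \<open>r * iexp \<theta>\<close> in place of r
  gives the characteristic function.\<close>

lemma (in prob_space) poisson_variable:
  fixes N :: "'a \<Rightarrow> ennreal" and r :: real
  assumes [measurable]: "N \<in> borel_measurable M"
    and P: "\<And>k::nat. prob {\<omega> \<in> space M. N \<omega> = of_nat k} = r ^ k / fact k * exp (- r)"
  shows "AE \<omega> in M. \<exists>k. N \<omega> = of_nat k"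
    and "(\<integral>\<omega>. iexp (\<theta> * enn2real (N \<omega>)) \<partial>M) = exp (r * (iexp \<theta> - 1))"
proof -
  define E where "E k = {\<omega> \<in> space M. N \<omega> = of_nat k}" for k :: nat
  have [measurable]: "E k \<in> events" for k by (simp add: E_def)
  have disj: "disjoint_family E"
    by (auto simp: E_def disjoint_family_on_def)
  have "(\<lambda>k. prob (E k)) sums prob (\<Union>k. E k)"
    using disj by (intro finite_measure_UNION) auto
  moreover have "(\<lambda>k. prob (E k)) sums (exp r * exp (- r))"
    unfolding E_def P using sums_mult2[OF exp_converges[of r], of "exp (-r)"]
    by (simp add: divide_inverse mult_ac)
  ultimately have "prob (\<Union>k. E k) = 1"
    by (simp add: sums_unique2 exp_minus)
  then have "AE \<omega> in M. \<omega> \<in> (\<Union>k. E k)"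
    by (rule prob_eq_1[THEN iffD1, rotated]) auto
  then show AE: "AE \<omega> in M. \<exists>k. N \<omega> = of_nat k"
    by eventually_elim (auto simp: E_def)
  \<comment> \<open>The wave restricted to the event that N is less than n: a finite sum over
    indicators, bounded by 1, whose expectation is a partial sum of the exponential series.\<close>
  define s where "s n \<omega> = (\<Sum>k<n. indicat_real (E k) \<omega> *\<^sub>R iexp (\<theta> * k))" for n \<omega>
  have s_eq: "s n \<omega> = (if k < n then iexp (\<theta> * k) else 0)" if "N \<omega> = of_nat k" "\<omega> \<in> space M" for n \<omega> k
  proof -
    have "indicat_real (E j) \<omega> = (if j = k then 1 else 0)" for j
      using that by (auto simp: E_def)
    then show ?thesis unfolding s_def by (simp add: if_distrib[of "\<lambda>x. x *\<^sub>R _"] sum.delta' cong: if_cong)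
  qed
  have [measurable]: "s n \<in> borel_measurable M" for n unfolding s_def by measurable
  have lim1: "(\<lambda>n. integral\<^sup>L M (s n)) \<longlonglongrightarrow> (\<integral>\<omega>. iexp (\<theta> * enn2real (N \<omega>)) \<partial>M)"
  proof (rule integral_dominated_convergence[where w="\<lambda>_. 1"])
    show "AE \<omega> in M. (\<lambda>n. s n \<omega>) \<longlonglongrightarrow> iexp (\<theta> * enn2real (N \<omega>))"
      using AE AE_space
    proof eventually_elim
      case (elim \<omega>)
      then obtain k where k: "N \<omega> = of_nat k" by auto
      show ?case
        by (rule tendsto_eventually)
          (auto simp: s_eq[OF k elim(2)] k eventually_sequentially intro!: exI[of _ "Suc k"])
    qed
    show "AE \<omega> in M. norm (s n \<omega>) \<le> 1" for n
      using AE AE_space by eventually_elim (auto simp: s_eq)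
  qed simp_all
  have sn: "integral\<^sup>L M (s n) = (\<Sum>k<n. (r * iexp \<theta>) ^ k /\<^sub>R fact k * exp (- r))" for n
  proof -
    have "integral\<^sup>L M (s n) = (\<Sum>k<n. prob (E k) *\<^sub>R iexp (\<theta> * k))"
      unfolding s_def
      by (subst Bochner_Integration.integral_sum) (auto intro!: integrable_scaleR_left integrable_real_indicator simp: emeasure_eq_measure)
    also have "\<dots> = (\<Sum>k<n. (r * iexp \<theta>) ^ k /\<^sub>R fact k * exp (- r))"
    proof (rule sum.cong[OF refl])
      fix k
      have "iexp (\<theta> * k) = iexp \<theta> ^ k"
        by (simp add: exp_of_nat_mult[symmetric] mult_ac)
      then show "prob (E k) *\<^sub>R iexp (\<theta> * k) = (r * iexp \<theta>) ^ k /\<^sub>R fact k * exp (- r)"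
        unfolding E_def P by (simp add: power_mult_distrib scaleR_conv_of_real divide_inverse exp_of_real mult_ac)
    qed
    finally show ?thesis .
  qed
  have "(\<lambda>k. (r * iexp \<theta>) ^ k /\<^sub>R fact k * exp (- r)) sums (exp (r * iexp \<theta>) * exp (- r))"
    by (rule sums_mult2[OF exp_converges])
  then have "(\<lambda>n. integral\<^sup>L M (s n)) \<longlonglongrightarrow> exp (r * iexp \<theta>) * exp (- r)"
    unfolding sums_def sn .
  then have "(\<integral>\<omega>. iexp (\<theta> * enn2real (N \<omega>)) \<partial>M) = exp (r * iexp \<theta>) * exp (- r)"
    by (rule LIMSEQ_unique[OF lim1])
  then show "(\<integral>\<omega>. iexp (\<theta> * enn2real (N \<omega>)) \<partial>M) = exp (r * (iexp \<theta> - 1))"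
    by (simp add: exp_of_real[symmetric] exp_add[symmetric] right_diff_distrib)
qed

definition prm_sigma :: "'a measure \<Rightarrow> 'b measure \<Rightarrow> ('a \<Rightarrow> 'b measure) \<Rightarrow> 'a set set" where
  "prm_sigma M m \<mu> = sigma_sets (space M)
     {(\<lambda>\<omega>. emeasure (\<mu> \<omega>) A) -` B \<inter> space M | A B. A \<in> sets m \<and> B \<in> sets borel}"

lemma prmD:
  assumes "poisson_random_measure M m \<mu>"
  shows "prob_space M" "\<And>\<omega>. \<omega> \<in> space M \<Longrightarrow> sets (\<mu> \<omega>) = sets m"
    "\<And>A. A \<in> sets m \<Longrightarrow> (\<lambda>\<omega>. emeasure (\<mu> \<omega>) A) \<in> borel_measurable M"
    "\<And>A k. A \<in> sets m \<Longrightarrow> emeasure m A < \<infinity> \<Longrightarrow> measure M {\<omega> \<in> space M. emeasure (\<mu> \<omega>) A = of_nat k}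
                  = measure m A ^ k / fact k * exp (- measure m A)"
  using assms unfolding poisson_random_measure_def by (elim conjE; blast)+

text \<open>The law of the integral of a simple function that takes the value v on
  \<open>B v\<close>: the counts of disjoint sets are independent Poisson variables, so the factors
  multiply.\<close>

lemma prm_simple_char:
  fixes B :: "real \<Rightarrow> 'b set"
  assumes prm: "poisson_random_measure M m \<mu>" and V: "finite V"
    and B: "\<And>v. v \<in> V \<Longrightarrow> B v \<in> sets m" "\<And>v. v \<in> V \<Longrightarrow> emeasure m (B v) < \<infinity>" "disjoint_family_on B V"
  defines "Y \<equiv> \<lambda>\<omega>. \<Sum>v\<in>V. v * enn2real (emeasure (\<mu> \<omega>) (B v))"
  shows "char (distr M borel Y) \<xi> = exp (\<Sum>v\<in>V. measure m (B v) * (iexp (\<xi> * v) - 1))"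
proof -
  interpret prob_space M using prmD(1)[OF prm] .
  note meas = prmD(3)[OF prm]
  obtain h where h: "bij_betw h {0..<card V} V"
    using ex_bij_betw_nat_finite[OF V] by blast
  let ?n = "card V"
  \<comment> \<open>Independence is postulated for infinite sequences of disjoint sets, so the
    enumeration of V is continued by empty sets.\<close>
  define A where "A i = (if i < ?n then B (h i) else {})" for i
  have hV: "h i \<in> V" if "i < ?n" for i using h that by (auto simp: bij_betw_def)
  have A: "A i \<in> sets m" for i using B(1) hV by (auto simp: A_def)
  have "disjoint_family A"
    unfolding disjoint_family_on_def
  proof (intro ballI impI)
    fix i j :: nat assume ij: "i \<noteq> j"
    show "A i \<inter> A j = {}"
    proof (cases "i < ?n \<and> j < ?n")
      case True
      then have "h i \<noteq> h j" using h ij by (auto simp: bij_betw_def inj_on_def)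
      then show ?thesis using B(3) True hV by (auto simp: A_def disjoint_family_on_def)
    qed (auto simp: A_def)
  qed
  then have "indep_vars (\<lambda>_. borel) (\<lambda>i \<omega>. emeasure (\<mu> \<omega>) (A i)) UNIV"
    using prm A unfolding poisson_random_measure_def by (elim conjE) blast
  then have "indep_vars (\<lambda>_. borel) (\<lambda>i \<omega>. emeasure (\<mu> \<omega>) (A i)) {0..<?n}"
    by (rule indep_vars_subset) auto
  then have "indep_vars (\<lambda>_. borel) (\<lambda>i \<omega>. h i * enn2real (emeasure (\<mu> \<omega>) (A i))) {0..<?n}"
    by (rule indep_vars_compose2) auto
  then have "char (distr M borel (\<lambda>\<omega>. \<Sum>i\<in>{0..<?n}. h i * enn2real (emeasure (\<mu> \<omega>) (A i)))) \<xi>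
    = (\<Prod>i\<in>{0..<?n}. char (distr M borel (\<lambda>\<omega>. h i * enn2real (emeasure (\<mu> \<omega>) (A i)))) \<xi>)"
    by (rule char_distr_sum)
  also have "(\<lambda>\<omega>. \<Sum>i\<in>{0..<?n}. h i * enn2real (emeasure (\<mu> \<omega>) (A i))) = Y"
    unfolding Y_def
    by (rule ext, subst sum.reindex_bij_betw[OF h, symmetric]) (simp add: A_def)
  also have "(\<Prod>i\<in>{0..<?n}. char (distr M borel (\<lambda>\<omega>. h i * enn2real (emeasure (\<mu> \<omega>) (A i)))) \<xi>)
    = (\<Prod>i\<in>{0..<?n}. char (distr M borel (\<lambda>\<omega>. h i * enn2real (emeasure (\<mu> \<omega>) (B (h i))))) \<xi>)"
    by (rule prod.cong) (auto simp: A_def)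
  also have "\<dots> = (\<Prod>v\<in>V. char (distr M borel (\<lambda>\<omega>. v * enn2real (emeasure (\<mu> \<omega>) (B v)))) \<xi>)"
    by (rule prod.reindex_bij_betw[OF h, of "\<lambda>v. char (distr M borel (\<lambda>\<omega>. v * enn2real (emeasure (\<mu> \<omega>) (B v)))) \<xi>"])
  also have "\<dots> = (\<Prod>v\<in>V. exp (measure m (B v) * (iexp (\<xi> * v) - 1)))"
  proof (rule prod.cong[OF refl])
    fix v assume v: "v \<in> V"
    note [measurable] = meas[OF B(1)[OF v]]
    have "char (distr M borel (\<lambda>\<omega>. v * enn2real (emeasure (\<mu> \<omega>) (B v)))) \<xi>
      = (\<integral>\<omega>. iexp (\<xi> * (v * enn2real (emeasure (\<mu> \<omega>) (B v)))) \<partial>M)"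
      unfolding char_def by (subst integral_distr) auto
    also have "\<dots> = (\<integral>\<omega>. iexp ((\<xi> * v) * enn2real (emeasure (\<mu> \<omega>) (B v))) \<partial>M)"
      by (simp add: mult.assoc)
    also have "\<dots> = exp (measure m (B v) * (iexp (\<xi> * v) - 1))"
      by (rule poisson_variable(2)) (use prmD(4)[OF prm] B v in auto)
    finally show "char (distr M borel (\<lambda>\<omega>. v * enn2real (emeasure (\<mu> \<omega>) (B v)))) \<xi> = exp (measure m (B v) * (iexp (\<xi> * v) - 1))" .
  qed
  also have "\<dots> = exp (\<Sum>v\<in>V. measure m (B v) * (iexp (\<xi> * v) - 1))"
    by (simp add: exp_sum[OF V])
  finally show ?thesis .
qed

lemma prm_AE_finite:
  assumes prm: "poisson_random_measure M m \<mu>" and A: "A \<in> sets m" "emeasure m A < \<infinity>"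
  shows "AE \<omega> in M. emeasure (\<mu> \<omega>) A < \<infinity>"
proof -
  interpret prob_space M using prmD(1)[OF prm] .
  have "AE \<omega> in M. \<exists>k. emeasure (\<mu> \<omega>) A = of_nat k"
    by (rule poisson_variable(1)[OF prmD(3)[OF prm A(1)] prmD(4)[OF prm A]])
  then show ?thesis by eventually_elim (auto simp: of_nat_less_top)
qed

text \<open>The part of A where f exceeds K in absolute value has mean measure tending to 0, so with
  probability close to 1 it carries no point. Almost surely, therefore, f is essentially bounded by
  some K and lives on a set of finite mass.\<close>

lemma prm_AE_integrable:
  fixes f :: "'b \<Rightarrow> real"
  assumes prm: "poisson_random_measure M m \<mu>" and f[measurable]: "f \<in> borel_measurable m"
    and A[measurable]: "A \<in> sets m" and fin: "emeasure m A < \<infinity>" and supp: "\<And>p. p \<in> space m - A \<Longrightarrow> f p = 0"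
  shows "AE \<omega> in M. integrable (\<mu> \<omega>) f"
proof -
  interpret prob_space M using prmD(1)[OF prm] .
  define D where "D K = {p \<in> space m. p \<in> A \<and> \<bar>f p\<bar> > real K}" for K :: nat
  have Dm[measurable]: "D K \<in> sets m" for K unfolding D_def by measurable
  have Dfin: "emeasure m (D K) < \<infinity>" for K
    using emeasure_mono[of "D K" A m] fin by (auto simp: D_def intro: le_less_trans)
  have "(\<lambda>K. emeasure m (D K)) \<longlonglongrightarrow> emeasure m (\<Inter>K. D K)"
    using Dfin by (intro Lim_emeasure_decseq) (auto simp: D_def decseq_def less_top)
  moreover have "(\<Inter>K. D K) = {}"
  proof -
    have "p \<notin> (\<Inter>K. D K)" for p
    proof -
      obtain K :: nat where "\<bar>f p\<bar> < real K" using reals_Archimedean2 by blast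
      then have "p \<notin> D K" by (simp add: D_def)
      then show ?thesis by blast
    qed
    then show ?thesis by blast
  qed
  ultimately have "(\<lambda>K. emeasure m (D K)) \<longlonglongrightarrow> ennreal 0" by simp
  then have "(\<lambda>K. measure m (D K)) \<longlonglongrightarrow> 0"
    unfolding measure_def by (rule tendsto_enn2real) simp
  then have lim: "(\<lambda>K. 1 - exp (- measure m (D K))) \<longlonglongrightarrow> 1 - exp (- 0)"
    by (intro tendsto_intros)
  note [measurable] = prmD(3)[OF prm Dm]
  define Bad where "Bad = {\<omega> \<in> space M. \<forall>K. emeasure (\<mu> \<omega>) (D K) \<noteq> 0}"
  have Bad[measurable]: "Bad \<in> events" unfolding Bad_def by measurable
  have "prob Bad \<le> 1 - exp (- measure m (D K))" for K
  proof -
    let ?E = "{\<omega> \<in> space M. emeasure (\<mu> \<omega>) (D K) = of_nat 0}"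
    have "prob Bad \<le> prob (space M - ?E)"
      by (rule finite_measure_mono) (auto simp: Bad_def)
    also have "\<dots> = 1 - prob ?E" by (rule prob_compl) simp
    finally show ?thesis using prmD(4)[OF prm Dm Dfin, of K 0] by simp
  qed
  then have "prob Bad \<le> 0" using LIMSEQ_le_const[OF lim] by auto
  then have "AE \<omega> in M. \<omega> \<notin> Bad"
    using measure_le_0_iff prob_eq_0[of Bad] by auto
  moreover note prm_AE_finite[OF prm A fin] AE_space
  ultimately show ?thesis
  proof eventually_elim
    case (elim \<omega>)
    then obtain K where K: "emeasure (\<mu> \<omega>) (D K) = 0" by (auto simp: Bad_def)
    have sets: "sets (\<mu> \<omega>) = sets m" using prmD(2)[OF prm elim(3)] .
    have sp: "space (\<mu> \<omega>) = space m" using sets by (rule sets_eq_imp_space_eq)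
    have "D K \<in> null_sets (\<mu> \<omega>)" using K sets Dm by (auto simp: null_sets_def)
    then have "AE p in \<mu> \<omega>. p \<notin> D K" by (rule AE_not_in)
    then have ae: "AE p in \<mu> \<omega>. norm (f p) \<le> norm (real K * indicator A p)"
      using AE_space
    proof eventually_elim
      case (elim p) then show ?case using supp[of p] by (cases "p \<in> A") (auto simp: D_def sp)
    qed
    show ?case
    proof (rule Bochner_Integration.integrable_bound[OF _ _ ae])
      show "integrable (\<mu> \<omega>) (\<lambda>p. real K * indicator A p)"
        using sets A elim(2) by (intro integrable_mult_right integrable_real_indicator) auto
      show "f \<in> borel_measurable (\<mu> \<omega>)" using f sets measurable_cong_sets by blast
    qed
  qed
qed

text \<open>The measure \<open>m'\<close> is kept apart from m because the formula serves both a
  realisation of the random measure and the mean measure.\<close>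

lemma simple_integral_sum:
  fixes s :: "'b \<Rightarrow> real"
  assumes s: "simple_function m s" and sets: "sets m' = sets m"
    and fin: "\<And>v. v \<in> s ` space m - {0} \<Longrightarrow> emeasure m' (s -` {v} \<inter> space m) < \<infinity>"
  shows "(\<integral>p. s p \<partial>m') = (\<Sum>v\<in>s ` space m - {0}. v * measure m' (s -` {v} \<inter> space m))"
    and "(\<integral>p. (iexp (\<xi> * s p) - 1) \<partial>m') = (\<Sum>v\<in>s ` space m - {0}. measure m' (s -` {v} \<inter> space m) * (iexp (\<xi> * v) - 1))"
proof -
  let ?V = "s ` space m - {0}" let ?B = "\<lambda>v. s -` {v} \<inter> space m"
  have V: "finite ?V" using s by (auto simp: simple_function_def)
  have B: "?B v \<in> sets m'" for v using simple_functionD(2)[OF s, of "{v}"] sets by simp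
  have sp: "space m' = space m" using sets by (rule sets_eq_imp_space_eq)
  have delta: "indicat_real (?B v) p = (if v = s p then 1 else 0)" if "p \<in> space m" for v p
    using that by auto
  have "(\<integral>p. s p \<partial>m') = (\<integral>p. (\<Sum>v\<in>?V. v * indicat_real (?B v) p) \<partial>m')"
    by (rule Bochner_Integration.integral_cong[OF refl]) (use V in \<open>auto simp: sp delta if_distrib[of "\<lambda>x. _ * x"] sum.delta sum.delta' cong: if_cong\<close>)
  also have "\<dots> = (\<Sum>v\<in>?V. (\<integral>p. v * indicat_real (?B v) p \<partial>m'))"
    by (rule Bochner_Integration.integral_sum) (intro integrable_mult_right integrable_real_indicator B fin)
  also have "\<dots> = (\<Sum>v\<in>?V. v * measure m' (?B v))"
    using B fin by (intro sum.cong) (auto simp: sp[symmetric])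
  finally show "(\<integral>p. s p \<partial>m') = (\<Sum>v\<in>?V. v * measure m' (?B v))" .
  have "(\<integral>p. (iexp (\<xi> * s p) - 1) \<partial>m') = (\<integral>p. (\<Sum>v\<in>?V. indicat_real (?B v) p *\<^sub>R (iexp (\<xi> * v) - 1)) \<partial>m')"
  proof (rule Bochner_Integration.integral_cong[OF refl])
    fix p assume p: "p \<in> space m'"
    have "(\<Sum>v\<in>?V. indicat_real (?B v) p *\<^sub>R (iexp (\<xi> * v) - 1)) = (\<Sum>v\<in>?V. if v = s p then iexp (\<xi> * v) - 1 else 0)"
      using p by (intro sum.cong) (auto simp: sp)
    then show "iexp (\<xi> * s p) - 1 = (\<Sum>v\<in>?V. indicat_real (?B v) p *\<^sub>R (iexp (\<xi> * v) - 1))"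
      using V p by (auto simp: sp sum.delta)
  qed
  also have "\<dots> = (\<Sum>v\<in>?V. (\<integral>p. indicat_real (?B v) p *\<^sub>R (iexp (\<xi> * v) - 1) \<partial>m'))"
    by (rule Bochner_Integration.integral_sum) (intro integrable_scaleR_left integrable_real_indicator B fin)
  also have "\<dots> = (\<Sum>v\<in>?V. measure m' (?B v) * (iexp (\<xi> * v) - 1))"
  proof (rule sum.cong[OF refl])
    fix v assume v: "v \<in> ?V"
    have "(\<integral>p. indicat_real (?B v) p *\<^sub>R (iexp (\<xi> * v) - 1) \<partial>m') = (\<integral>p. indicat_real (?B v) p \<partial>m') *\<^sub>R (iexp (\<xi> * v) - 1)"
      by (rule integral_scaleR_left) (intro integrable_real_indicator B fin v)
    then show "(\<integral>p. indicat_real (?B v) p *\<^sub>R (iexp (\<xi> * v) - 1) \<partial>m') = measure m' (?B v) * (iexp (\<xi> * v) - 1)"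
      using B by (simp add: sp[symmetric] scaleR_conv_of_real)
  qed
  finally show "(\<integral>p. (iexp (\<xi> * s p) - 1) \<partial>m') = (\<Sum>v\<in>?V. measure m' (?B v) * (iexp (\<xi> * v) - 1))" .
qed

lemma sets_prm_sigma: "sets (sigma (space M)
     {(\<lambda>\<omega>. emeasure (\<mu> \<omega>) A) -` B \<inter> space M | A B. A \<in> sets m \<and> B \<in> sets borel}) = prm_sigma M m \<mu>"
  unfolding prm_sigma_def by (rule sets_measure_of) auto

text \<open>\<open>Y\<close> is a measurable version of the Poisson integral of \<open>f\<close>, which itself is only almost surely
  a limit of random variables.\<close>

lemma prm_joint_char:
  fixes f :: "'b \<Rightarrow> real"
  assumes prm: "poisson_random_measure M m \<mu>" and f[measurable]: "f \<in> borel_measurable m"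
    and A[measurable]: "A \<in> sets m" and fin: "emeasure m A < \<infinity>" and supp: "\<And>p. p \<in> space m - A \<Longrightarrow> f p = 0"
    and Z[measurable]: "Z \<in> borel_measurable M"
    and ind: "prob_space.indep_set M (sigma_sets (space M) {Z -` B \<inter> space M | B. B \<in> sets borel}) (prm_sigma M m \<mu>)"
  obtains Y where "Y \<in> borel_measurable M" "AE \<omega> in M. Y \<omega> = (\<integral>p. f p \<partial>\<mu> \<omega>)"
    "\<And>\<xi>. char (distr M borel (\<lambda>\<omega>. Z \<omega> + Y \<omega>)) \<xi> = char (distr M borel Z) \<xi> * exp (\<integral>p. (iexp (\<xi> * f p) - 1) \<partial>m)"
proof -
  interpret prob_space M using prmD(1)[OF prm] .
  \<comment> \<open>Domination by \<open>2 * \<bar>f p\<bar>\<close> makes every \<open>s i\<close>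
    vanish off A, which gives its nonzero level sets finite measure; it also provides the majorant
    for the integrals against \<open>\<mu> \<omega>\<close>.\<close>
  have "\<exists>s. (\<forall>i. simple_function m (s i)) \<and> (\<forall>p\<in>space m. (\<lambda>i. s i p) \<longlonglongrightarrow> f p) \<and>
      (\<forall>i. \<forall>p\<in>space m. \<bar>s i p\<bar> \<le> 2 * \<bar>f p\<bar>)"
    using borel_measurable_implies_sequence_metric[OF f, of 0] by (simp add: dist_real_def)
  then obtain s where
    s: "\<And>i. simple_function m (s i)" and
    slim: "\<And>p. p \<in> space m \<Longrightarrow> (\<lambda>i. s i p) \<longlonglongrightarrow> f p" and
    sbd: "\<And>i p. p \<in> space m \<Longrightarrow> \<bar>s i p\<bar> \<le> 2 * \<bar>f p\<bar>"
    by blast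
  have [measurable]: "s i \<in> borel_measurable m" for i
    using s by (rule borel_measurable_simple_function)
  have s0: "s i p = 0" if "p \<in> space m" "p \<notin> A" for i p
    using sbd[OF that(1), of i] supp[of p] that by auto
  define V where "V i = s i ` space m - {0}" for i
  define B where "B i v = s i -` {v} \<inter> space m" for i v
  have V: "finite (V i)" for i using s[of i] by (auto simp: V_def simple_function_def)
  have Bm: "B i v \<in> sets m" for i v unfolding B_def by measurable
  have BA: "B i v \<subseteq> A" if "v \<in> V i" for i v
    using that s0[of _ i] by (auto simp: B_def V_def)
  have Bfin: "emeasure m (B i v) < \<infinity>" if "v \<in> V i" for i v
    using emeasure_mono[OF BA[OF that] A] fin by (auto intro: le_less_trans)
  define Yi where "Yi i \<omega> = (\<Sum>v\<in>V i. v * enn2real (emeasure (\<mu> \<omega>) (B i v)))" for i \<omega>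
  note [measurable] = prmD(3)[OF prm Bm]
  have Yim[measurable]: "Yi i \<in> borel_measurable M" for i unfolding Yi_def by measurable
  have ch: "char (distr M borel (Yi i)) \<xi> = exp (\<Sum>v\<in>V i. measure m (B i v) * (iexp (\<xi> * v) - 1))" for i \<xi>
    unfolding Yi_def by (rule prm_simple_char[OF prm V Bm Bfin]) (auto simp: disjoint_family_on_def B_def)
  \<comment> \<open>Being a finite combination of counts, \<open>Yi i\<close> is measurable for the
    sigma-algebra generated by the counts, and Z is independent of that whole sigma-algebra.\<close>
  have iv: "indep_var borel Z borel (Yi i)" for i
  proof -
    let ?S = "sigma (space M) {(\<lambda>\<omega>. emeasure (\<mu> \<omega>) A) -` B \<inter> space M | A B. A \<in> sets m \<and> B \<in> sets borel}"
    have [measurable]: "(\<lambda>\<omega>. emeasure (\<mu> \<omega>) (B i v)) \<in> borel_measurable ?S" for v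
    proof (rule measurableI)
      fix C :: "ennreal set" assume "C \<in> sets borel"
      then show "(\<lambda>\<omega>. emeasure (\<mu> \<omega>) (B i v)) -` C \<inter> space ?S \<in> sets ?S"
        unfolding sets_prm_sigma prm_sigma_def using Bm by (intro sigma_sets.Basic) (auto simp: space_measure_of_conv)
    qed simp
    have "Yi i \<in> borel_measurable ?S" unfolding Yi_def by measurable
    then have "{Yi i -` C \<inter> space M | C. C \<in> sets borel} \<subseteq> prm_sigma M m \<mu>"
      using measurable_sets[of "Yi i" ?S borel] unfolding sets_prm_sigma by (auto simp: space_measure_of_conv)
    then have sub: "sigma_sets (space M) {Yi i -` C \<inter> space M | C. C \<in> sets borel} \<subseteq> prm_sigma M m \<mu>"
      unfolding prm_sigma_def by (rule sigma_sets_mono)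
    show ?thesis
      unfolding indep_var_eq indep_set_def
      by (intro conjI Z Yim indep_sets_mono_sets[OF ind[unfolded indep_set_def]])
        (use sub in \<open>auto split: bool.split\<close>)
  qed
  have AEint: "AE \<omega> in M. integrable (\<mu> \<omega>) f"
    by (rule prm_AE_integrable[OF prm f A fin]) (rule supp)
  have AEfin: "AE \<omega> in M. emeasure (\<mu> \<omega>) A < \<infinity> \<and> integrable (\<mu> \<omega>) f \<and> sets (\<mu> \<omega>) = sets m"
    using prm_AE_finite[OF prm A fin] AEint AE_space
    by eventually_elim (auto simp: prmD(2)[OF prm])
  have conv: "AE \<omega> in M. (\<lambda>i. Yi i \<omega>) \<longlonglongrightarrow> (\<integral>p. f p \<partial>\<mu> \<omega>)"
    using AEfin
  proof eventually_elim
    case (elim \<omega>)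
    then have sets: "sets (\<mu> \<omega>) = sets m" and fin': "emeasure (\<mu> \<omega>) A < \<infinity>" and int: "integrable (\<mu> \<omega>) f" by auto
    have sp: "space (\<mu> \<omega>) = space m" using sets by (rule sets_eq_imp_space_eq)
    note [measurable_cong] = sets
    have "Yi i \<omega> = (\<integral>p. s i p \<partial>\<mu> \<omega>)" for i
    proof -
      have "emeasure (\<mu> \<omega>) (B i v) < \<infinity>" if "v \<in> V i" for v
        using emeasure_mono[OF BA[OF that], of "\<mu> \<omega>"] A sets fin' by (auto intro: le_less_trans)
      then show ?thesis
        unfolding Yi_def measure_def[symmetric] unfolding V_def B_def
        by (intro simple_integral_sum(1)[OF s sets, symmetric]) auto
    qed
    moreover have "(\<lambda>i. \<integral>p. s i p \<partial>\<mu> \<omega>) \<longlonglongrightarrow> (\<integral>p. f p \<partial>\<mu> \<omega>)"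
      using int slim sbd
      by (intro integral_dominated_convergence[where w="\<lambda>p. 2 * \<bar>f p\<bar>"]) (auto simp: sp)
    ultimately show ?case by simp
  qed
  define Y where "Y \<omega> = lim (\<lambda>i. Yi i \<omega>)" for \<omega>
  have Ym[measurable]: "Y \<in> borel_measurable M" unfolding Y_def by measurable
  have YAE: "AE \<omega> in M. Y \<omega> = (\<integral>p. f p \<partial>\<mu> \<omega>)"
    using conv by eventually_elim (auto simp: Y_def limI)
  have "char (distr M borel (\<lambda>\<omega>. Z \<omega> + Y \<omega>)) \<xi> = char (distr M borel Z) \<xi> * exp (\<integral>p. (iexp (\<xi> * f p) - 1) \<partial>m)" for \<xi>
  proof -
    have lim1: "(\<lambda>i. char (distr M borel (\<lambda>\<omega>. Z \<omega> + Yi i \<omega>)) \<xi>) \<longlonglongrightarrow> char (distr M borel (\<lambda>\<omega>. Z \<omega> + Y \<omega>)) \<xi>"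
    proof -
      have "char (distr M borel (\<lambda>\<omega>. Z \<omega> + U \<omega>)) \<xi> = (\<integral>\<omega>. iexp (\<xi> * (Z \<omega> + U \<omega>)) \<partial>M)" if [measurable]: "U \<in> borel_measurable M" for U
        unfolding char_def by (subst integral_distr) auto
      moreover have "(\<lambda>i. \<integral>\<omega>. iexp (\<xi> * (Z \<omega> + Yi i \<omega>)) \<partial>M) \<longlonglongrightarrow> (\<integral>\<omega>. iexp (\<xi> * (Z \<omega> + Y \<omega>)) \<partial>M)"
      proof (rule integral_dominated_convergence[where w="\<lambda>_. 1"])
        show "AE \<omega> in M. (\<lambda>i. iexp (\<xi> * (Z \<omega> + Yi i \<omega>))) \<longlonglongrightarrow> iexp (\<xi> * (Z \<omega> + Y \<omega>))"
          using conv YAE by eventually_elim (intro tendsto_intros, simp)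
      qed auto
      ultimately show ?thesis by simp
    qed
    have "char (distr M borel (\<lambda>\<omega>. Z \<omega> + Yi i \<omega>)) \<xi> = char (distr M borel Z) \<xi> * exp (\<integral>p. (iexp (\<xi> * s i p) - 1) \<partial>m)" for i
    proof -
      have "(\<integral>p. (iexp (\<xi> * s i p) - 1) \<partial>m) = (\<Sum>v\<in>V i. measure m (B i v) * (iexp (\<xi> * v) - 1))"
        unfolding V_def B_def by (rule simple_integral_sum(2)[OF s refl]) (use Bfin[of _ i] in \<open>auto simp: V_def B_def\<close>)
      then show ?thesis using char_distr_add[OF iv] ch by simp
    qed
    moreover have "(\<lambda>i. \<integral>p. (iexp (\<xi> * s i p) - 1) \<partial>m) \<longlonglongrightarrow> (\<integral>p. (iexp (\<xi> * f p) - 1) \<partial>m)"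
    proof (rule integral_dominated_convergence[where w="\<lambda>p. 2 * indicator A p"])
      show "integrable m (\<lambda>p. 2 * indicator A p :: real)"
        using A fin by (intro integrable_mult_right integrable_real_indicator) auto
      show "AE p in m. (\<lambda>i. iexp (\<xi> * s i p) - 1) \<longlonglongrightarrow> iexp (\<xi> * f p) - 1"
        using AE_space by eventually_elim (intro tendsto_intros slim)
      show "AE p in m. cmod (iexp (\<xi> * s i p) - 1) \<le> 2 * indicator A p" for i
        using AE_space
      proof eventually_elim
        case (elim p)
        have "cmod (iexp (\<xi> * s i p) - 1) \<le> cmod (iexp (\<xi> * s i p)) + cmod 1" by (rule norm_triangle_ineq4)
        then show ?case using s0[OF elim, of i] by (auto simp: indicator_def)
      qed
    qed measurable
    ultimately have "(\<lambda>i. char (distr M borel (\<lambda>\<omega>. Z \<omega> + Yi i \<omega>)) \<xi>) \<longlonglongrightarrow> char (distr M borel Z) \<xi> * exp (\<integral>p. (iexp (\<xi> * f p) - 1) \<partial>m)"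
      by (auto intro!: tendsto_intros)
    then show ?thesis using lim1 LIMSEQ_unique by blast
  qed
  then show thesis using that Ym YAE by blast
qed

section \<open>The characteristic function of a Levy process\<close>

lemma norm_iexp_diff: "cmod (iexp a - iexp b) \<le> \<bar>a - b\<bar>"
proof -
  have "iexp a - iexp b = iexp b * (iexp (a - b) - 1)"
    by (simp add: algebra_simps exp_add[symmetric])
  then have "cmod (iexp a - iexp b) = cmod (iexp (a - b) - 1)" by (simp add: norm_mult)
  also have "\<dots> \<le> \<bar>a - b\<bar>" using iexp_approx1[of "a - b" 0] by simp
  finally show ?thesis .
qed

lemma levy_measureD:
  assumes "levy_measure \<nu>"
  shows "sets \<nu> = sets borel" "space \<nu> = UNIV" "integrable \<nu> (\<lambda>x. min 1 (x\<^sup>2))" "emeasure \<nu> {0} = 0"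
proof -
  show s: "sets \<nu> = sets borel" using assms by (simp add: levy_measure_def)
  then show "space \<nu> = UNIV" using sets_eq_imp_space_eq by fastforce
  note [measurable_cong] = s
  show "integrable \<nu> (\<lambda>x. min 1 (x\<^sup>2))"
    by (rule integrableI_nonneg) (use assms in \<open>auto simp: levy_measure_def\<close>)
  show "emeasure \<nu> {0} = 0" using assms by (simp add: levy_measure_def)
qed

lemma levy_measure_integrable:
  fixes f :: "real \<Rightarrow> 'b::{banach, second_countable_topology}"
  assumes \<nu>: "levy_measure \<nu>" and f: "f \<in> borel_measurable borel" and b: "\<And>x. norm (f x) \<le> K * min 1 (x\<^sup>2)"
  shows "integrable \<nu> f"
proof (rule Bochner_Integration.integrable_bound)
  show "integrable \<nu> (\<lambda>x. K * min 1 (x\<^sup>2))" by (intro integrable_mult_right levy_measureD(3) \<nu>)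
  show "f \<in> borel_measurable \<nu>" using f levy_measureD(1)[OF \<nu>] measurable_cong_sets by blast
  show "AE x in \<nu>. norm (f x) \<le> norm (K * min 1 (x\<^sup>2))" using b by (auto intro!: AE_I2 order_trans[OF b])
qed

lemma levy_measure_tail:
  assumes \<nu>: "levy_measure \<nu>" and "0 < \<delta>"
  shows "emeasure \<nu> {x. \<delta> < \<bar>x\<bar>} < \<infinity>"
proof -
  have "integrable \<nu> (indicat_real {x. \<delta> < \<bar>x\<bar>})"
  proof (rule levy_measure_integrable[OF \<nu>, where K="1 / min 1 (\<delta>\<^sup>2)"])
    fix x :: real
    have "min 1 (\<delta>\<^sup>2) \<le> min 1 (x\<^sup>2)" if "\<delta> < \<bar>x\<bar>"
      using that \<open>0 < \<delta>\<close> power_mono[of \<delta> "\<bar>x\<bar>" 2] by auto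
    then show "norm (indicat_real {x. \<delta> < \<bar>x\<bar>} x) \<le> 1 / min 1 (\<delta>\<^sup>2) * min 1 (x\<^sup>2)"
      using \<open>0 < \<delta>\<close> by (auto simp: indicator_def divide_simps)
  qed measurable
  then show ?thesis by (simp add: integrable_indicator_iff levy_measureD(2)[OF \<nu>])
qed

text \<open>The Levy-Khintchine integrand; \<open>psi\<close> below is the Levy-Khintchine
  exponent.\<close>

definition psi_fun :: "real \<Rightarrow> real \<Rightarrow> complex" where
  "psi_fun \<xi> u = iexp (\<xi> * u) - 1 - \<i> * (\<xi> * u * indicator {-1..1} u)"

lemma psi_fun_measurable[measurable]: "psi_fun \<xi> \<in> borel_measurable borel"
  unfolding psi_fun_def by measurable

text \<open>Second-order Taylor remainder of the exponential for jumps in [-1, 1], the trivial bound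
  2 for the others; the constant covers both cases.\<close>

lemma psi_fun_bound: "cmod (psi_fun \<xi> u) \<le> (2 + \<xi>\<^sup>2) * min 1 (u\<^sup>2)"
proof (cases "u \<in> {-1..1}")
  case True
  then have u: "u\<^sup>2 \<le> 1" by (auto simp: abs_square_le_1)
  have "cmod (psi_fun \<xi> u) \<le> (\<xi> * u)\<^sup>2 / 2"
    using iexp_approx1[of "\<xi> * u" 1] True by (simp add: psi_fun_def numeral_2_eq_2 diff_diff_eq)
  also have "\<dots> \<le> (2 + \<xi>\<^sup>2) * u\<^sup>2" by (simp add: power_mult_distrib algebra_simps)
  finally show ?thesis using u by simp
next
  case False
  then have "1 < \<bar>u\<bar>" by auto
  then have u: "1 \<le> u\<^sup>2" using power_mono[of 1 "\<bar>u\<bar>" 2] by simp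
  have "cmod (psi_fun \<xi> u) = cmod (iexp (\<xi> * u) - 1)" using False by (simp add: psi_fun_def)
  also have "\<dots> \<le> cmod (iexp (\<xi> * u)) + cmod 1" by (rule norm_triangle_ineq4)
  also have "\<dots> \<le> 2 + \<xi>\<^sup>2" by simp
  finally show ?thesis using u by simp
qed

definition psi :: "real \<Rightarrow> real \<Rightarrow> real measure \<Rightarrow> real \<Rightarrow> complex" where
  "psi \<sigma> b \<nu> \<xi> = - (\<sigma>\<^sup>2 * \<xi>\<^sup>2 / 2) + \<i> * (b * \<xi>) + (\<integral>u. psi_fun \<xi> u \<partial>\<nu>)"

text \<open>Normal laws are given for increments only, and \<open>W 0\<close> is 0 only almost
  surely, so \<open>W t\<close> is traded for the standardised increment from time 0 before the
  standard normal characteristic function is used.\<close>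

lemma char_brownian:
  assumes bm: "brownian_motion M W" and t: "0 < t"
  shows "char (distr M borel (\<lambda>\<omega>. \<sigma> * W t \<omega>)) \<xi> = exp (- (\<sigma>\<^sup>2 * \<xi>\<^sup>2 * t / 2))"
proof -
  interpret prob_space M using bm by (simp add: brownian_motion_def)
  have W[measurable]: "W t \<in> borel_measurable M" "W 0 \<in> borel_measurable M" using bm t by (auto simp: brownian_motion_def)
  have "distributed M lborel (\<lambda>\<omega>. W t \<omega> - W 0 \<omega>) (normal_density 0 (sqrt t))"
  proof -
    have "\<forall>r s. 0 \<le> r \<and> r < s \<longrightarrow>
        distributed M lborel (\<lambda>\<omega>. W s \<omega> - W r \<omega>) (normal_density 0 (sqrt (s - r)))"
      using bm by (simp add: brownian_motion_def)
    from this[rule_format, of 0 t] show ?thesis using t by simp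
  qed
  then have d: "distributed M lborel (\<lambda>\<omega>. (W t \<omega> - W 0 \<omega>) / sqrt t) std_normal_density"
    using normal_standard_normal_convert[of "sqrt t" _ 0] t by simp
  have ae: "AE \<omega> in M. W 0 \<omega> = 0" using bm by (simp add: brownian_motion_def)
  have "char (distr M borel (\<lambda>\<omega>. \<sigma> * W t \<omega>)) \<xi> = (\<integral>\<omega>. iexp (\<xi> * (\<sigma> * W t \<omega>)) \<partial>M)"
    unfolding char_def by (subst integral_distr) auto
  also have "\<dots> = (\<integral>\<omega>. iexp (\<xi> * \<sigma> * sqrt t * ((W t \<omega> - W 0 \<omega>) / sqrt t)) \<partial>M)"
    by (rule integral_cong_AE, measurable) (use ae in \<open>eventually_elim, use t in \<open>simp add: mult_ac\<close>\<close>)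
  also have "\<dots> = char (distr M lborel (\<lambda>\<omega>. (W t \<omega> - W 0 \<omega>) / sqrt t)) (\<xi> * \<sigma> * sqrt t)"
    unfolding char_def by (subst integral_distr) auto
  also have "distr M lborel (\<lambda>\<omega>. (W t \<omega> - W 0 \<omega>) / sqrt t) = std_normal_distribution"
    using d by (simp add: distributed_def)
  moreover have "(complex_of_real (sqrt t))\<^sup>2 = t" using t by (simp flip: of_real_power)
  ultimately show ?thesis by (simp add: char_std_normal_distribution power_mult_distrib mult_ac exp_of_real[symmetric])
qed

lemma jump_intensity_sigma_finite:
  assumes \<nu>: "levy_measure \<nu>" and sf: "sigma_finite_measure \<nu>"
  shows "sigma_finite_measure (restrict_space lborel {0::real..})" "sigma_finite_measure (restrict_space \<nu> (- {0}))"
  by (rule sigma_finite_measure_restrict_space;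
      auto intro: lborel.sigma_finite_measure_axioms sf simp: levy_measureD(1)[OF \<nu>])+

lemma jump_intensity_emeasure:
  assumes \<nu>: "levy_measure \<nu>" and sf: "sigma_finite_measure \<nu>" and t: "0 \<le> t"
    and A: "A \<in> sets borel" "0 \<notin> A"
  shows "{0..t} \<times> A \<in> sets (jump_intensity \<nu>)"
    and "emeasure (jump_intensity \<nu>) ({0..t} \<times> A) = ennreal t * emeasure \<nu> A"
proof -
  interpret N: sigma_finite_measure "restrict_space \<nu> (- {0})" by (rule jump_intensity_sigma_finite(2)[OF \<nu> sf])
  have S: "{0..t} \<in> sets (restrict_space lborel {0::real..})" "A \<in> sets (restrict_space \<nu> (- {0}))"
    using A by (auto simp: sets_restrict_space_iff levy_measureD(1)[OF \<nu>])
  have eT: "emeasure (restrict_space lborel {0::real..}) {0..t} = ennreal t"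
    using t by (subst emeasure_restrict_space) auto
  have eA: "emeasure (restrict_space \<nu> (- {0})) A = emeasure \<nu> A"
    using A by (subst emeasure_restrict_space) (auto simp: levy_measureD(1,2)[OF \<nu>])
  show "{0..t} \<times> A \<in> sets (jump_intensity \<nu>)"
    unfolding jump_intensity_def using S by (rule pair_measureI)
  show "emeasure (jump_intensity \<nu>) ({0..t} \<times> A) = ennreal t * emeasure \<nu> A"
    unfolding jump_intensity_def by (subst N.emeasure_pair_measure_Times[OF S]) (simp only: eT eA)
qed

lemma jump_intensity_integral:
  fixes h :: "real \<Rightarrow> complex"
  assumes \<nu>: "levy_measure \<nu>" and sf: "sigma_finite_measure \<nu>" and t: "0 \<le> t"
    and h: "h \<in> borel_measurable borel" and hi: "integrable \<nu> h" and h0: "h 0 = 0"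
  shows "(\<integral>p. indicat_real {0..t} (fst p) *\<^sub>R h (snd p) \<partial>jump_intensity \<nu>) = t * (\<integral>x. h x \<partial>\<nu>)"
proof -
  note sp = levy_measureD(2)[OF \<nu>]
  let ?T = "restrict_space lborel {0::real..}" and ?N = "restrict_space \<nu> (- {0})"
  interpret T: sigma_finite_measure ?T by (rule jump_intensity_sigma_finite(1)[OF \<nu> sf])
  interpret N: sigma_finite_measure ?N by (rule jump_intensity_sigma_finite(2)[OF \<nu> sf])
  interpret P: pair_sigma_finite ?T ?N ..
  have hN: "integrable ?N h"
    using hi by (subst integrable_restrict_space) (auto simp: sp levy_measureD(1)[OF \<nu>] intro!: integrable_mult_indicator)
  \<comment> \<open>The intensity lives on nonzero jump sizes; since \<open>h 0 = 0\<close>, leaving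
    out the origin does not change the integral.\<close>
  have hI: "(\<integral>x. h x \<partial>?N) = (\<integral>x. h x \<partial>\<nu>)"
    by (subst integral_restrict_space) (auto simp: sp levy_measureD(1)[OF \<nu>] indicator_def h0 intro!: Bochner_Integration.integral_cong)
  have eT: "emeasure ?T {0..t} = ennreal t" using t by (subst emeasure_restrict_space) auto
  have i1: "integrable ?T (indicat_real {0..t})"
    using eT by (intro integrable_real_indicator) (auto simp: sets_restrict_space_iff)
  have "{0..t} \<inter> {0..} = {0..t}" by auto
  then have i2: "(\<integral>r. indicat_real {0..t} r \<partial>?T) = t"
    using eT t by (simp add: measure_def space_restrict_space)
  have hm: "h \<in> borel_measurable ?N" using hN by auto
  have "integrable (?T \<Otimes>\<^sub>M ?N) (\<lambda>p. indicat_real {0..t} (fst p) *\<^sub>R h (snd p))"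
  proof (rule P.Fubini_integrable)
    show "(\<lambda>p. indicat_real {0..t} (fst p) *\<^sub>R h (snd p)) \<in> borel_measurable (?T \<Otimes>\<^sub>M ?N)"
      by (intro borel_measurable_scaleR measurable_compose[OF measurable_fst borel_measurable_integrable[OF i1]]
          measurable_compose[OF measurable_snd hm])
    show "integrable ?T (\<lambda>x. \<integral>y. norm (indicat_real {0..t} (fst (x, y)) *\<^sub>R h (snd (x, y))) \<partial>?N)"
      using integrable_mult_left[OF i1, of "\<integral>y. norm (h y) \<partial>?N"] by simp
    show "AE x in ?T. integrable ?N (\<lambda>y. indicat_real {0..t} (fst (x, y)) *\<^sub>R h (snd (x, y)))"
      using hN by simp
  qed
  from P.integral_fst'[OF this]
  have "(\<integral>p. indicat_real {0..t} (fst p) *\<^sub>R h (snd p) \<partial>(?T \<Otimes>\<^sub>M ?N)) =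
      (\<integral>r. \<integral>x. indicat_real {0..t} r *\<^sub>R h x \<partial>?N \<partial>?T)"
    by simp
  also have "\<dots> = (\<integral>r. indicat_real {0..t} r *\<^sub>R (\<integral>x. h x \<partial>\<nu>) \<partial>?T)" by (simp add: hI)
  also have "\<dots> = (\<integral>r. indicat_real {0..t} r \<partial>?T) *\<^sub>R (\<integral>x. h x \<partial>\<nu>)" by (rule integral_scaleR_left) (rule i1)
  also have "\<dots> = t * (\<integral>x. h x \<partial>\<nu>)" by (simp only: i2 scaleR_conv_of_real)
  finally show ?thesis by (simp add: jump_intensity_def)
qed

text \<open>The wave is Lipschitz, and on a probability space convergence in
  \<open>L\<^sup>2\<close> controls the mean distance, so characteristic functions converge.\<close>

lemma tendsto_iexp_L2:
  fixes X :: "nat \<Rightarrow> 'a \<Rightarrow> real" and X' :: "'a \<Rightarrow> real"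
  assumes "prob_space M" and [measurable]: "\<And>n. X n \<in> borel_measurable M" "X' \<in> borel_measurable M"
    and lim: "(\<lambda>n. \<integral>\<^sup>+ \<omega>. ennreal ((X' \<omega> - X n \<omega>)\<^sup>2) \<partial>M) \<longlonglongrightarrow> 0"
  shows "(\<lambda>n. \<integral>\<omega>. iexp (\<xi> * X n \<omega>) \<partial>M) \<longlonglongrightarrow> (\<integral>\<omega>. iexp (\<xi> * X' \<omega>) \<partial>M)"
proof (rule LIMSEQ_I)
  interpret prob_space M by fact
  fix e :: real assume "0 < e"
  \<comment> \<open>The final bound is 2 |\<xi>| \<eta>, which this choice keeps below e / 2; the
    summand 1 takes care of \<xi> = 0.\<close>
  define \<eta> where "\<eta> = e / (4 * (\<bar>\<xi>\<bar> + 1))"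
  have \<eta>: "0 < \<eta>" using \<open>0 < e\<close> by (simp add: \<eta>_def)
  have "eventually (\<lambda>n. (\<integral>\<^sup>+ \<omega>. ennreal ((X' \<omega> - X n \<omega>)\<^sup>2) \<partial>M) < ennreal (\<eta>\<^sup>2)) sequentially"
    using lim by (rule order_tendstoD) (use \<eta> in simp)
  then obtain N where N: "\<And>n. n \<ge> N \<Longrightarrow> (\<integral>\<^sup>+ \<omega>. ennreal ((X' \<omega> - X n \<omega>)\<^sup>2) \<partial>M) < ennreal (\<eta>\<^sup>2)"
    by (auto simp: eventually_sequentially)
  have "norm ((\<integral>\<omega>. iexp (\<xi> * X n \<omega>) \<partial>M) - (\<integral>\<omega>. iexp (\<xi> * X' \<omega>) \<partial>M)) < e" if "n \<ge> N" for n
  proof -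
    let ?D = "\<lambda>\<omega>. X' \<omega> - X n \<omega>"
    have i: "integrable M (\<lambda>\<omega>. (?D \<omega>)\<^sup>2)"
      using N[OF that] by (intro integrableI_nonneg) (auto intro: less_trans simp: less_top)
    have "ennreal (\<integral>\<omega>. (?D \<omega>)\<^sup>2 \<partial>M) < ennreal (\<eta>\<^sup>2)"
      using N[OF that] nn_integral_eq_integral[OF i] by simp
    then have sm: "(\<integral>\<omega>. (?D \<omega>)\<^sup>2 \<partial>M) < \<eta>\<^sup>2"
      by (subst (asm) ennreal_less_iff) (auto intro: integral_nonneg_AE)
    have ie: "complex_integrable M (\<lambda>\<omega>. iexp (\<xi> * U \<omega>))" if [measurable]: "U \<in> borel_measurable M" for U
      by (rule integrable_const_bound[of _ 1]) auto
    have "norm ((\<integral>\<omega>. iexp (\<xi> * X n \<omega>) \<partial>M) - (\<integral>\<omega>. iexp (\<xi> * X' \<omega>) \<partial>M))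
      = norm (\<integral>\<omega>. iexp (\<xi> * X n \<omega>) - iexp (\<xi> * X' \<omega>) \<partial>M)"
      by (subst Bochner_Integration.integral_diff[OF ie ie]) simp_all
    also have "\<dots> \<le> (\<integral>\<omega>. cmod (iexp (\<xi> * X n \<omega>) - iexp (\<xi> * X' \<omega>)) \<partial>M)"
      by (rule integral_norm_bound)
    also have "\<dots> \<le> (\<integral>\<omega>. \<bar>\<xi>\<bar> * (\<eta> + (?D \<omega>)\<^sup>2 / \<eta>) \<partial>M)"
    proof (rule integral_mono)
      fix \<omega>
      let ?d = "\<bar>?D \<omega>\<bar>"
      have "cmod (iexp (\<xi> * X n \<omega>) - iexp (\<xi> * X' \<omega>)) \<le> \<bar>\<xi> * X n \<omega> - \<xi> * X' \<omega>\<bar>" by (rule norm_iexp_diff)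
      also have "\<dots> = \<bar>\<xi>\<bar> * \<bar>X n \<omega> - X' \<omega>\<bar>" by (simp add: abs_mult right_diff_distrib[symmetric])
      also have "\<bar>X n \<omega> - X' \<omega>\<bar> = ?d" by (rule abs_minus_commute)
      txt \<open>Splitting at \<open>\<eta>\<close> replaces the Cauchy-Schwarz inequality.\<close>
      also have "?d \<le> \<eta> + (?D \<omega>)\<^sup>2 / \<eta>"
      proof (cases "?d \<le> \<eta>")
        case False
        then have "?d * \<eta> \<le> ?d * ?d" by (intro mult_left_mono) auto
        then have "?d \<le> (?D \<omega>)\<^sup>2 / \<eta>" using \<eta> by (simp add: pos_le_divide_eq power2_eq_square abs_mult_self_eq)
        then show ?thesis using \<eta> by simp
      qed (use \<eta> in \<open>simp add: add_increasing2\<close>)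
      finally show "cmod (iexp (\<xi> * X n \<omega>) - iexp (\<xi> * X' \<omega>)) \<le> \<bar>\<xi>\<bar> * (\<eta> + (?D \<omega>)\<^sup>2 / \<eta>)"
        by (simp add: mult_left_mono)
    qed (use i in \<open>auto intro!: integrable_norm Bochner_Integration.integrable_diff ie simp del: of_real_mult\<close>)
    also have "\<dots> = \<bar>\<xi>\<bar> * (\<eta> + (\<integral>\<omega>. (?D \<omega>)\<^sup>2 \<partial>M) / \<eta>)"
      using i by (simp add: prob_space)
    also have "\<dots> \<le> \<bar>\<xi>\<bar> * (\<eta> + \<eta>\<^sup>2 / \<eta>)"
      using sm \<eta> by (intro mult_left_mono add_left_mono divide_right_mono) auto
    also have "\<dots> = 2 * \<bar>\<xi>\<bar> * \<eta>" using \<eta> by (simp add: power2_eq_square)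
    also have "\<dots> < e" using \<open>0 < e\<close> by (simp add: \<eta>_def field_simps add_pos_nonneg)
    finally show ?thesis .
  qed
  then show "\<exists>N. \<forall>n\<ge>N. norm ((\<integral>\<omega>. iexp (\<xi> * X n \<omega>) \<partial>M) - (\<integral>\<omega>. iexp (\<xi> * X' \<omega>) \<partial>M)) < e" by blast
qed

lemma levy_char:
  assumes X: "levy_triplet M X \<sigma> b \<nu>" and sf: "sigma_finite_measure \<nu>" and t0: "0 \<le> t"
  shows "char (distr M borel (X t)) \<xi> = exp (t * psi \<sigma> b \<nu> \<xi>)"
proof (cases "t = 0")
  case True
  have lp: "levy_process M X" using X by (simp add: levy_triplet_def)
  interpret prob_space M using lp by (simp add: levy_process_def)
  have [measurable]: "X 0 \<in> borel_measurable M" and ae: "AE \<omega> in M. X 0 \<omega> = 0" using lp by (auto simp: levy_process_def)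
  have "char (distr M borel (X 0)) \<xi> = (\<integral>\<omega>. iexp (\<xi> * X 0 \<omega>) \<partial>M)"
    unfolding char_def by (subst integral_distr) auto
  also have "\<dots> = (\<integral>\<omega>. 1 \<partial>M)"
    by (rule integral_cong_AE, measurable) (use ae in \<open>eventually_elim, simp\<close>)
  finally show ?thesis using True by (simp add: prob_space)
next
  case False
  with t0 have t: "0 < t" by simp
  from X obtain W \<mu> J where lp: "levy_process M X" and \<nu>: "levy_measure \<nu>" and bm: "brownian_motion M W"
    and prm: "poisson_random_measure M (jump_intensity \<nu>) \<mu>"
    and ind: "indep_process_random_measure M W (jump_intensity \<nu>) \<mu>"
    and J: "\<forall>t\<ge>0. is_compensated_small_jumps M \<mu> \<nu> t (J t)"
    and rep: "\<forall>t\<ge>0. AE \<omega> in M. X t \<omega> = b * t + \<sigma> * W t \<omega> + J t \<omega> + large_jumps \<mu> t \<omega>"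
    unfolding levy_triplet_def by blast
  interpret prob_space M using lp by (simp add: levy_process_def)
  have Xm[measurable]: "X t \<in> borel_measurable M" using lp t0 by (auto simp: levy_process_def)
  have Wm[measurable]: "W t \<in> borel_measurable M" using bm t0 by (auto simp: brownian_motion_def)
  have Jm[measurable]: "J t \<in> borel_measurable M" using J t0 by (auto simp: is_compensated_small_jumps_def)
  note sn[measurable_cong] = levy_measureD(1)[OF \<nu>]
  let ?m = "jump_intensity \<nu>"
  define Z where "Z \<omega> = \<sigma> * W t \<omega>" for \<omega>
  have Zm[measurable]: "Z \<in> borel_measurable M" unfolding Z_def by measurable
  have chZ: "char (distr M borel Z) \<xi> = exp (- (\<sigma>\<^sup>2 * \<xi>\<^sup>2 * t / 2))"
    unfolding Z_def[abs_def] by (rule char_brownian[OF bm t])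
  have indZ: "indep_set (sigma_sets (space M) {Z -` B \<inter> space M | B. B \<in> sets borel}) (prm_sigma M ?m \<mu>)"
  proof -
    have "{Z -` B \<inter> space M | B. B \<in> sets borel} \<subseteq> {W t -` B \<inter> space M | t B. 0 \<le> t \<and> B \<in> sets borel}"
    proof clarsimp
      fix B :: "real set" assume B: "B \<in> sets borel"
      have "(\<lambda>w. \<sigma> * w) -` B \<inter> space borel \<in> sets borel" by (rule measurable_sets[OF _ B]) measurable
      then show "\<exists>t' B'. Z -` B \<inter> space M = W t' -` B' \<inter> space M \<and> 0 \<le> t' \<and> B' \<in> sets borel"
        by (intro exI[of _ t] exI[of _ "(\<lambda>w. \<sigma> * w) -` B"]) (auto simp: Z_def t0)
    qed
    then have "sigma_sets (space M) {Z -` B \<inter> space M | B. B \<in> sets borel} \<subseteq>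
        sigma_sets (space M) {W t -` B \<inter> space M | t B. 0 \<le> t \<and> B \<in> sets borel}"
      by (rule sigma_sets_mono')
    then show ?thesis
      unfolding indep_set_def prm_sigma_def
      by (intro indep_sets_mono_sets[OF ind[unfolded indep_process_random_measure_def indep_set_def]])
        (auto split: bool.split)
  qed
  define F where "F A p = indicat_real {0..t} (fst p) * (indicat_real A (snd p) * snd p)" for A and p :: "real \<times> real"
  have mm: "g \<in> borel_measurable (borel \<Otimes>\<^sub>M borel) \<Longrightarrow> g \<in> borel_measurable ?m" for g :: "real \<times> real \<Rightarrow> real"
  proof -
    assume g[measurable]: "g \<in> borel_measurable (borel \<Otimes>\<^sub>M borel)"
    have "(\<lambda>p. p) \<in> ?m \<rightarrow>\<^sub>M borel \<Otimes>\<^sub>M (borel :: real measure)"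
      unfolding jump_intensity_def
    proof (rule measurable_pair)
      show "fst \<circ> (\<lambda>p. p) \<in> restrict_space lborel {0..} \<Otimes>\<^sub>M restrict_space \<nu> (- {0}) \<rightarrow>\<^sub>M borel"
        unfolding comp_def by (rule measurable_compose[OF measurable_fst]) (auto intro: measurable_restrict_space1)
      show "snd \<circ> (\<lambda>p. p) \<in> restrict_space lborel {0..} \<Otimes>\<^sub>M restrict_space \<nu> (- {0}) \<rightarrow>\<^sub>M borel"
        unfolding comp_def by (rule measurable_compose[OF measurable_snd]) (auto intro: measurable_restrict_space1 simp: sn)
    qed
    from measurable_compose[OF this g] show ?thesis by simp
  qed
  have Fm: "F A \<in> borel_measurable ?m" if [measurable]: "A \<in> sets borel" for A
    unfolding F_def by (rule mm) measurable
  have mA: "{0..t} \<times> A \<in> sets ?m" "emeasure ?m ({0..t} \<times> A) < \<infinity>"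
    if A: "A \<in> sets borel" "A \<subseteq> {x. \<delta> < \<bar>x\<bar>}" "0 < \<delta>" for A \<delta>
  proof -
    have "0 \<notin> A" using A by auto
    note * = jump_intensity_emeasure[OF \<nu> sf t0 A(1) this]
    have "emeasure \<nu> A \<le> emeasure \<nu> {x. \<delta> < \<bar>x\<bar>}" using A(2) by (rule emeasure_mono) (simp add: sn)
    then have "emeasure \<nu> A < \<infinity>" using levy_measure_tail[OF \<nu> A(3)] by (rule le_less_trans)
    then show "{0..t} \<times> A \<in> sets ?m" "emeasure ?m ({0..t} \<times> A) < \<infinity>"
      using * by (simp_all add: ennreal_mult_less_top)
  qed
  have F0: "F A p = 0" if "p \<in> space ?m - {0..t} \<times> A" for A p
    using that by (cases p) (auto simp: F_def indicator_def)
  have Fint: "AE \<omega> in M. integrable (\<mu> \<omega>) (F A)"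
    if A: "A \<in> sets borel" "A \<subseteq> {x. \<delta> < \<bar>x\<bar>}" "0 < \<delta>" for A \<delta>
    by (rule prm_AE_integrable[OF prm Fm[OF A(1)] mA[OF A]]) (rule F0)
  have LINT: "(LINT p : {0..t} \<times> A | \<mu> \<omega>. snd p) = (\<integral>p. F A p \<partial>\<mu> \<omega>)" for A \<omega>
    unfolding set_lebesgue_integral_def F_def
    by (rule Bochner_Integration.integral_cong) (auto simp: indicator_def)
  have joint: "\<exists>Y. Y \<in> borel_measurable M \<and> (AE \<omega> in M. Y \<omega> = (\<integral>p. F A p \<partial>\<mu> \<omega>)) \<and>
     (\<forall>\<xi>. char (distr M borel (\<lambda>\<omega>. Z \<omega> + Y \<omega>)) \<xi> = char (distr M borel Z) \<xi> * exp (\<integral>p. (iexp (\<xi> * F A p) - 1) \<partial>?m))"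
    if A: "A \<in> sets borel" "A \<subseteq> {x. \<delta> < \<bar>x\<bar>}" "0 < \<delta>" for A \<delta>
    by (rule prm_joint_char[OF prm Fm[OF A(1)] mA[OF A] F0 Zm indZ]) blast+
  obtain L where Lm[measurable]: "L \<in> borel_measurable M" and L: "AE \<omega> in M. L \<omega> = (\<integral>p. F {x. 1 < \<bar>x\<bar>} p \<partial>\<mu> \<omega>)"
    using joint[of "{x. 1 < \<bar>x\<bar>}" 1] by auto
  \<comment> \<open>\<open>large_jumps\<close> is replaced by its measurable version L, so that the
    squared distances below are distances between random variables.\<close>
  define X' where "X' \<omega> = b * t + Z \<omega> + J t \<omega> + L \<omega>" for \<omega>
  have X'm[measurable]: "X' \<in> borel_measurable M" unfolding X'_def by measurable
  have "AE \<omega> in M. X t \<omega> = b * t + \<sigma> * W t \<omega> + J t \<omega> + large_jumps \<mu> t \<omega>" using rep t0 by blast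
  then have X'ae: "AE \<omega> in M. X t \<omega> = X' \<omega>"
    using L by eventually_elim (simp add: X'_def Z_def large_jumps_def LINT)
  \<comment> \<open>The double successor keeps \<open>\<delta> n\<close> below 1, so that
    \<open>A n\<close> contains all jumps larger than 1.\<close>
  define \<delta> where "\<delta> n = inverse (real (Suc (Suc n)))" for n
  have \<delta>: "0 < \<delta> n" "\<delta> n < 1" for n by (auto simp: \<delta>_def field_simps)
  have \<delta>lim: "\<delta> \<longlonglongrightarrow> 0" unfolding \<delta>_def by (rule LIMSEQ_Suc[OF LIMSEQ_inverse_real_of_nat])
  define A where "A n = {x. \<delta> n < \<bar>x\<bar>}" for n
  have Am[measurable]: "A n \<in> sets borel" for n unfolding A_def by measurable
  define cc where "cc n = (LINT x : {x. \<delta> n < \<bar>x\<bar> \<and> \<bar>x\<bar> \<le> 1} | \<nu>. x)" for n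
  define P where "P n Y \<longleftrightarrow> Y \<in> borel_measurable M \<and> (AE \<omega> in M. Y \<omega> = (\<integral>p. F (A n) p \<partial>\<mu> \<omega>)) \<and>
     (\<forall>\<xi>. char (distr M borel (\<lambda>\<omega>. Z \<omega> + Y \<omega>)) \<xi> = char (distr M borel Z) \<xi> * exp (\<integral>p. (iexp (\<xi> * F (A n) p) - 1) \<partial>?m))" for n Y
  have "\<exists>Y. P n Y" for n
    unfolding P_def by (rule joint[OF Am _ \<delta>(1)[of n]]) (simp add: A_def)
  then obtain Y where Y: "\<And>n. P n (Y n)" by metis
  have Ym[measurable]: "\<And>n. Y n \<in> borel_measurable M"
    and Yae: "\<And>n. AE \<omega> in M. Y n \<omega> = (\<integral>p. F (A n) p \<partial>\<mu> \<omega>)"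
    and Ych: "\<And>n \<xi>. char (distr M borel (\<lambda>\<omega>. Z \<omega> + Y n \<omega>)) \<xi> = char (distr M borel Z) \<xi> * exp (\<integral>p. (iexp (\<xi> * F (A n) p) - 1) \<partial>?m)"
    using Y unfolding P_def by blast+
  \<comment> \<open>\<open>Y n\<close> collects all jumps beyond \<open>\<delta> n\<close>, those
    above 1 included. With a single Poisson integral, the only independence needed between summands
    is that of Z and the jump measure.\<close>
  define Xn where "Xn n \<omega> = b * t + Z \<omega> + Y n \<omega> - t * cc n" for n \<omega>
  have Xnm[measurable]: "Xn n \<in> borel_measurable M" for n unfolding Xn_def by measurable
  have comp: "AE \<omega> in M. compensated_jumps \<mu> \<nu> t (\<delta> n) \<omega> = Y n \<omega> - t * cc n - L \<omega>" for n
  proof -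
    let ?S = "{x. \<delta> n < \<bar>x\<bar> \<and> \<bar>x\<bar> \<le> 1}" and ?B = "{x::real. 1 < \<bar>x\<bar>}"
    have split: "F (A n) = (\<lambda>p. F ?S p + F ?B p)"
      using \<delta>[of n] by (auto simp: F_def A_def indicator_def fun_eq_iff)
    have "AE \<omega> in M. integrable (\<mu> \<omega>) (F ?S)" by (rule Fint[OF _ _ \<delta>(1)[of n]]) auto
    moreover have "AE \<omega> in M. integrable (\<mu> \<omega>) (F ?B)" by (rule Fint[of _ 1]) auto
    ultimately show ?thesis
      using Yae[of n] L
      by eventually_elim (simp add: compensated_jumps_def LINT split cc_def)
  qed
  have lim: "(\<lambda>n. \<integral>\<^sup>+ \<omega>. ennreal ((X' \<omega> - Xn n \<omega>)\<^sup>2) \<partial>M) \<longlonglongrightarrow> 0"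
  proof -
    have "((\<lambda>\<delta>. \<integral>\<^sup>+ \<omega>. ennreal ((J t \<omega> - compensated_jumps \<mu> \<nu> t \<delta> \<omega>)\<^sup>2) \<partial>M) \<longlongrightarrow> 0) (at_right 0)"
      using J t0 by (auto simp: is_compensated_small_jumps_def)
    moreover have "filterlim \<delta> (at_right 0) sequentially"
    proof -
      have "\<delta> n \<noteq> 0" for n using \<delta>(1)[of n] by simp
      then show ?thesis using \<delta>(1) \<delta>lim by (auto simp: filterlim_at)
    qed
    ultimately have "(\<lambda>n. \<integral>\<^sup>+ \<omega>. ennreal ((J t \<omega> - compensated_jumps \<mu> \<nu> t (\<delta> n) \<omega>)\<^sup>2) \<partial>M) \<longlonglongrightarrow> 0"
      by (rule filterlim_compose)
    moreover have "(\<integral>\<^sup>+ \<omega>. ennreal ((J t \<omega> - compensated_jumps \<mu> \<nu> t (\<delta> n) \<omega>)\<^sup>2) \<partial>M) = (\<integral>\<^sup>+ \<omega>. ennreal ((X' \<omega> - Xn n \<omega>)\<^sup>2) \<partial>M)" for n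
      by (rule nn_integral_cong_AE) (use comp[of n] in \<open>eventually_elim, simp only: X'_def Xn_def, simp add: algebra_simps\<close>)
    ultimately show ?thesis by simp
  qed
  from tendsto_iexp_L2[OF prob_space_axioms Xnm X'm lim, of \<xi>]
  have "(\<lambda>n. \<integral>\<omega>. iexp (\<xi> * Xn n \<omega>) \<partial>M) \<longlonglongrightarrow> (\<integral>\<omega>. iexp (\<xi> * X' \<omega>) \<partial>M)" .
  also have "(\<integral>\<omega>. iexp (\<xi> * X' \<omega>) \<partial>M) = char (distr M borel (X t)) \<xi>"
    unfolding char_def
    by (subst integral_distr, measurable, rule integral_cong_AE, measurable) (use X'ae in \<open>eventually_elim, simp\<close>)
  finally have lim1: "(\<lambda>n. \<integral>\<omega>. iexp (\<xi> * Xn n \<omega>) \<partial>M) \<longlonglongrightarrow> char (distr M borel (X t)) \<xi>" .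
  \<comment> \<open>The Levy-Khintchine integrand cut at \<open>\<delta> n\<close>: the compensator
    \<open>cc n\<close> is exactly what completes the bare integrand
    \<open>iexp (\<xi> * x) - 1\<close> on \<open>A n\<close> to it.\<close>
  define g where "g n x = indicat_real (A n) x *\<^sub>R psi_fun \<xi> x" for n x
  have gm[measurable]: "g n \<in> borel_measurable borel" for n unfolding g_def by measurable
  have gb: "cmod (g n x) \<le> (2 + \<xi>\<^sup>2) * min 1 (x\<^sup>2)" for n x
    using psi_fun_bound[of \<xi> x] by (auto simp: g_def indicator_def)
  have "(\<integral>\<omega>. iexp (\<xi> * Xn n \<omega>) \<partial>M) = exp (- (\<sigma>\<^sup>2 * \<xi>\<^sup>2 * t / 2) + \<i> * (\<xi> * (b * t)) + t * (\<integral>x. g n x \<partial>\<nu>))" for n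
  proof -
    define h where "h x = indicat_real (A n) x *\<^sub>R (iexp (\<xi> * x) - 1)" for x
    have hm[measurable]: "h \<in> borel_measurable borel" unfolding h_def by measurable
    have tail: "emeasure \<nu> (A n) < \<infinity>" using levy_measure_tail[OF \<nu> \<delta>(1)] by (simp add: A_def)
    have hi: "integrable \<nu> h"
    proof (rule Bochner_Integration.integrable_bound)
      show "integrable \<nu> (\<lambda>x. 2 * indicat_real (A n) x)" using tail by (intro integrable_mult_right integrable_real_indicator) (auto simp: sn)
      have "cmod (iexp (\<xi> * x) - 1) \<le> 2" for x using norm_triangle_ineq4[of "iexp (\<xi> * x)" 1] by simp
      then show "AE x in \<nu>. cmod (h x) \<le> norm (2 * indicat_real (A n) x)" by (auto simp: h_def indicator_def)
    qed measurable
    have ci: "integrable \<nu> (\<lambda>x. indicat_real {x. \<delta> n < \<bar>x\<bar> \<and> \<bar>x\<bar> \<le> 1} x *\<^sub>R x)"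
    proof (rule Bochner_Integration.integrable_bound)
      show "integrable \<nu> (\<lambda>x. indicat_real (A n) x)" using tail by (intro integrable_real_indicator) (auto simp: sn)
      show "AE x in \<nu>. norm (indicat_real {x. \<delta> n < \<bar>x\<bar> \<and> \<bar>x\<bar> \<le> 1} x *\<^sub>R x) \<le> norm (indicat_real (A n) x)" by (auto simp: A_def indicator_def)
    qed measurable
    have "(\<integral>x. g n x \<partial>\<nu>) = (\<integral>x. h x - \<i> * \<xi> * complex_of_real (indicat_real {x. \<delta> n < \<bar>x\<bar> \<and> \<bar>x\<bar> \<le> 1} x *\<^sub>R x) \<partial>\<nu>)"
      by (rule Bochner_Integration.integral_cong) (auto simp: g_def h_def psi_fun_def A_def indicator_def)
    also have "\<dots> = (\<integral>x. h x \<partial>\<nu>) - \<i> * \<xi> * cc n"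
      using hi ci by (subst Bochner_Integration.integral_diff) (auto simp: cc_def set_lebesgue_integral_def simp del: real_scaleR_def of_real_mult)
    finally have gint: "(\<integral>x. g n x \<partial>\<nu>) = (\<integral>x. h x \<partial>\<nu>) - \<i> * \<xi> * cc n" .
    have "(\<integral>p. (iexp (\<xi> * F (A n) p) - 1) \<partial>?m) = (\<integral>p. indicat_real {0..t} (fst p) *\<^sub>R h (snd p) \<partial>?m)"
      by (rule Bochner_Integration.integral_cong) (auto simp: F_def h_def indicator_def)
    also have "\<dots> = t * (\<integral>x. h x \<partial>\<nu>)"
      by (rule jump_intensity_integral(1)[OF \<nu> sf t0 hm hi]) (simp add: h_def)
    finally have Fi: "(\<integral>p. (iexp (\<xi> * F (A n) p) - 1) \<partial>?m) = t * (\<integral>x. h x \<partial>\<nu>)" .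
    have "(\<integral>\<omega>. iexp (\<xi> * Xn n \<omega>) \<partial>M) = (\<integral>\<omega>. iexp (\<xi> * (b * t - t * cc n)) * iexp (\<xi> * (Z \<omega> + Y n \<omega>)) \<partial>M)"
      by (rule Bochner_Integration.integral_cong) (auto simp: Xn_def exp_add[symmetric] algebra_simps)
    also have "\<dots> = iexp (\<xi> * (b * t - t * cc n)) * char (distr M borel (\<lambda>\<omega>. Z \<omega> + Y n \<omega>)) \<xi>"
      unfolding char_def by (subst integral_distr) auto
    also have "\<dots> = iexp (\<xi> * (b * t - t * cc n)) * (exp (- (\<sigma>\<^sup>2 * \<xi>\<^sup>2 * t / 2)) * exp (t * (\<integral>x. h x \<partial>\<nu>)))"
      unfolding Ych Fi chZ ..
    also have "\<dots> = exp (- (\<sigma>\<^sup>2 * \<xi>\<^sup>2 * t / 2) + \<i> * (\<xi> * (b * t)) + t * (\<integral>x. g n x \<partial>\<nu>))"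
      unfolding gint by (simp add: exp_of_real[symmetric] exp_add[symmetric] algebra_simps)
    finally show ?thesis .
  qed
  moreover have "(\<lambda>n. exp (- (\<sigma>\<^sup>2 * \<xi>\<^sup>2 * t / 2) + \<i> * (\<xi> * (b * t)) + t * (\<integral>x. g n x \<partial>\<nu>)))
      \<longlonglongrightarrow> exp (- (\<sigma>\<^sup>2 * \<xi>\<^sup>2 * t / 2) + \<i> * (\<xi> * (b * t)) + t * (\<integral>x. psi_fun \<xi> x \<partial>\<nu>))"
  proof (intro tendsto_intros integral_dominated_convergence[where w="\<lambda>x. (2 + \<xi>\<^sup>2) * min 1 (x\<^sup>2)"])
    show "integrable \<nu> (\<lambda>x. (2 + \<xi>\<^sup>2) * min 1 (x\<^sup>2))" by (intro integrable_mult_right levy_measureD(3) \<nu>)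
    show "AE x in \<nu>. (\<lambda>n. g n x) \<longlonglongrightarrow> psi_fun \<xi> x"
    proof (rule AE_I2)
      fix x :: real
      show "(\<lambda>n. g n x) \<longlonglongrightarrow> psi_fun \<xi> x"
      proof (cases "x = 0")
        case False
        have "eventually (\<lambda>n. \<delta> n < \<bar>x\<bar>) sequentially" using False by (intro order_tendstoD[OF \<delta>lim]) auto
        then have "eventually (\<lambda>n. g n x = psi_fun \<xi> x) sequentially" by eventually_elim (simp add: g_def A_def)
        then show ?thesis by (rule tendsto_eventually)
      qed (simp add: g_def psi_fun_def)
    qed
    show "AE x in \<nu>. cmod (g n x) \<le> (2 + \<xi>\<^sup>2) * min 1 (x\<^sup>2)" for n using gb by simp
  qed measurable
  ultimately have "char (distr M borel (X t)) \<xi> = exp (- (\<sigma>\<^sup>2 * \<xi>\<^sup>2 * t / 2) + \<i> * (\<xi> * (b * t)) + t * (\<integral>x. psi_fun \<xi> x \<partial>\<nu>))"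
    using lim1 LIMSEQ_unique by simp
  also have "\<dots> = exp (t * psi \<sigma> b \<nu> \<xi>)" by (simp add: psi_def algebra_simps)
  finally show ?thesis .
qed

section \<open>Approximation by trigonometric polynomials\<close>

lemma Cb_cos:
  shows "Cb (\<lambda>x. cos (\<xi> * x + \<theta>))"
    and "(deriv ^^ k) (\<lambda>x. cos (\<xi> * x + \<theta>)) = (\<lambda>x. \<xi> ^ k * cos (\<xi> * x + \<theta> + real k * (pi / 2)))"
proof -
  let ?G = "\<lambda>k x. \<xi> ^ k * cos (\<xi> * x + \<theta> + real k * (pi / 2))"
  have D: "(?G k has_real_derivative ?G (Suc k) x) (at x)" for k x
  proof -
    have "- sin (\<xi> * x + \<theta> + real k * (pi / 2)) = cos (\<xi> * x + \<theta> + real (Suc k) * (pi / 2))"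
      by (simp add: minus_sin_cos_eq algebra_simps add_divide_distrib)
    moreover have "(?G k has_real_derivative \<xi> ^ k * (- sin (\<xi> * x + \<theta> + real k * (pi / 2)) * \<xi>)) (at x)"
      by (auto intro!: derivative_eq_intros)
    ultimately show ?thesis by (simp add: mult_ac)
  qed
  have B: "\<exists>B. \<forall>x. \<bar>?G k x\<bar> \<le> B" for k
    by (rule exI[of _ "\<bar>\<xi>\<bar> ^ k"]) (auto simp: abs_mult power_abs intro!: mult_left_le)
  show "Cb (\<lambda>x. cos (\<xi> * x + \<theta>))" by (rule CbI(1)[of ?G]) (use D B in auto)
  show "(deriv ^^ k) (\<lambda>x. cos (\<xi> * x + \<theta>)) = ?G k" by (rule CbI(2)[of ?G]) (use D B in auto)
qed

text \<open>Trigonometric polynomials with fundamental frequency w. The free phase \<theta> makes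
  sines instances of cosines, and k = 0 supplies the constants.\<close>

inductive trig :: "real \<Rightarrow> (real \<Rightarrow> real) \<Rightarrow> bool" for w where
  cos: "trig w (\<lambda>x. cos (real k * w * x + \<theta>))"
| add: "trig w f \<Longrightarrow> trig w g \<Longrightarrow> trig w (\<lambda>x. f x + g x)"
| cmult: "trig w f \<Longrightarrow> trig w (\<lambda>x. a * f x)"

lemma trig_const: "trig w (\<lambda>x. a)"
  using trig.cmult[OF trig.cos[of w 0 0], of a] by simp

lemma trig_cos_mult: "trig w (\<lambda>x. cos (real k * w * x + \<theta>) * cos (real l * w * x + \<eta>))"
proof -
  \<comment> \<open>The order of k and l matters because the difference frequency
    \<open>k - l\<close> is a natural number; the other case follows by symmetry.\<close>
  have *: "trig w (\<lambda>x. cos (real k * w * x + \<theta>) * cos (real l * w * x + \<eta>))" if "l \<le> k" for k l \<theta> \<eta>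
  proof -
    have "cos (real k * w * x + \<theta>) * cos (real l * w * x + \<eta>) =
      1/2 * cos (real (k - l) * w * x + (\<theta> - \<eta>)) + 1/2 * cos (real (k + l) * w * x + (\<theta> + \<eta>))" for x
    proof -
      have "real (k - l) * w * x + (\<theta> - \<eta>) = (real k * w * x + \<theta>) - (real l * w * x + \<eta>)"
        "real (k + l) * w * x + (\<theta> + \<eta>) = (real k * w * x + \<theta>) + (real l * w * x + \<eta>)"
        using that by (simp_all add: of_nat_diff algebra_simps)
      then show ?thesis by (simp only: cos_times_cos) simp
    qed
    then have eq: "(\<lambda>x. cos (real k * w * x + \<theta>) * cos (real l * w * x + \<eta>)) =
      (\<lambda>x. 1/2 * cos (real (k - l) * w * x + (\<theta> - \<eta>)) + 1/2 * cos (real (k + l) * w * x + (\<theta> + \<eta>)))"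
      by (rule ext)
    show ?thesis unfolding eq by (intro trig.intros)
  qed
  show ?thesis
  proof (cases "l \<le> k")
    case False
    then show ?thesis using *[of k l \<eta> \<theta>] by (simp add: mult.commute)
  qed (rule *)
qed

lemma trig_mult:
  assumes f: "trig w f" and g: "trig w g" shows "trig w (\<lambda>x. f x * g x)"
  using f
proof induction
  case (cos k \<theta>)
  show ?case using g
  proof induction
    case (cos l \<eta>) show ?case by (rule trig_cos_mult)
  next
    case (add f g) then show ?case by (simp add: distrib_left trig.add)
  next
    case (cmult f a) then show ?case using trig.cmult[OF cmult.IH, of a] by (simp add: mult_ac)
  qed
next
  case (add f f') then show ?case by (simp add: distrib_right trig.add)
next
  case (cmult f a) then show ?case using trig.cmult[OF cmult.IH, of a] by (simp add: mult_ac)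
qed

lemma trig_Cb: "trig w f \<Longrightarrow> Cb f"
  by (induction rule: trig.induct) (auto intro: Cb_cos Cb_add Cb_cmult)

lemma trig_deriv: assumes "trig w f" shows "trig w (deriv f)"
  using assms
proof induction
  case (cos k \<theta>)
  show ?case using Cb_cos(2)[of 1 "real k * w" \<theta>] trig.cmult[OF trig.cos[of w k "\<theta> + pi/2"], of "real k * w"]
    by (simp add: add.assoc)
next
  case (add f g)
  then show ?case using Cb_add(2)[of f g 1] by (simp add: trig_Cb trig.add)
next
  case (cmult f a)
  then show ?case using Cb_cmult(2)[of f 1 a] by (simp add: trig_Cb trig.cmult)
qed

text \<open>The constant a is the mean of f, the only Fourier term without a periodic
  antiderivative.\<close>

lemma trig_antideriv:
  assumes "trig w f" "w \<noteq> 0"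
  shows "\<exists>a F. trig w F \<and> (\<forall>x. (F has_real_derivative (f x - a)) (at x))"
  using assms(1)
proof induction
  case (cos k \<theta>)
  show ?case
  proof (cases "k = 0")
    case True
    then show ?thesis by (intro exI[of _ "cos \<theta>"] exI[of _ "\<lambda>_. 0"]) (auto intro: trig_const)
  next
    case False
    have "((\<lambda>x. 1 / (real k * w) * cos (real k * w * x + (\<theta> - pi/2))) has_real_derivative (cos (real k * w * x + \<theta>) - 0)) (at x)" for x
    proof -
      have "- sin (real k * w * x + (\<theta> - pi/2)) = cos (real k * w * x + \<theta>)"
        by (simp add: minus_sin_cos_eq algebra_simps)
      moreover have "((\<lambda>x. 1 / (real k * w) * cos (real k * w * x + (\<theta> - pi/2))) has_real_derivative
          1 / (real k * w) * (- sin (real k * w * x + (\<theta> - pi/2)) * (real k * w))) (at x)"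
        by (auto intro!: derivative_eq_intros)
      ultimately show ?thesis using False assms(2) by simp
    qed
    then show ?thesis by (intro exI[of _ 0] exI[of _ "\<lambda>x. 1 / (real k * w) * cos (real k * w * x + (\<theta> - pi/2))"] conjI allI trig.intros)
  qed
next
  case (add f g)
  then obtain a F b G where "trig w F" "\<forall>x. (F has_real_derivative (f x - a)) (at x)"
    "trig w G" "\<forall>x. (G has_real_derivative (g x - b)) (at x)" by blast
  then show ?case
    by (intro exI[of _ "a + b"] exI[of _ "\<lambda>x. F x + G x"]) (auto intro!: trig.add derivative_eq_intros)
next
  case (cmult f c)
  then obtain a F where "trig w F" "\<forall>x. (F has_real_derivative (f x - a)) (at x)" by blast
  then show ?case
    by (intro exI[of _ "c * a"] exI[of _ "\<lambda>x. c * F x"]) (auto intro!: trig.cmult derivative_eq_intros simp: algebra_simps)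
qed

lemma trig_periodic: assumes "trig (pi / R) f" "R \<noteq> 0" shows "f (x + 2 * R * of_int z) = f x"
  using assms(1)
proof induction
  case (cos k \<theta>)
  have "real k * (pi / R) * (x + 2 * R * of_int z) + \<theta> = (real k * (pi / R) * x + \<theta>) + of_int (int k * z) * (2 * pi)"
    using assms(2) by (simp add: field_simps)
  then show ?case
    using cos.plus_of_int[of "real k * (pi / R) * x + \<theta>" "int k * z"] by (simp only: of_real_eq_id id_apply)
qed auto

text \<open>The same point works for all functions of the given period at once, so a function and
  its derivatives can be compared at one place.\<close>

lemma trig_reduce:
  assumes "R > 0" obtains x0 where "x0 \<in> {-R..R}" "\<And>f. trig (pi / R) f \<Longrightarrow> f x = f x0"
proof
  define z where "z = \<lfloor>(x + R) / (2 * R)\<rfloor>"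
  have "of_int z \<le> (x + R) / (2 * R)" "(x + R) / (2 * R) < of_int z + 1" unfolding z_def by linarith+
  then have "of_int z * (2 * R) \<le> x + R" "x + R < (of_int z + 1) * (2 * R)"
    using assms by (simp_all add: pos_le_divide_eq pos_divide_less_eq)
  then show "x + 2 * R * of_int (- z) \<in> {-R..R}" by (simp add: algebra_simps)
  show "f x = f (x + 2 * R * of_int (- z))" if "trig (pi / R) f" for f
    by (rule trig_periodic[OF that, symmetric]) (use assms in simp)
qed

text \<open>Stone-Weierstrass on the unit circle, onto which the interval is wrapped by x \<mapsto>
  \<open>cis (pi / R * x)\<close>.\<close>

lemma trig_approx0:
  fixes h :: "real \<Rightarrow> real"
  assumes R: "0 < R" and e: "0 < e" and h: "continuous_on UNIV h" and per: "h (- R) = h R"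
  shows "\<exists>f. trig (pi / R) f \<and> (\<forall>x\<in>{-R..R}. \<bar>h x - f x\<bar> < e)"
proof -
  let ?S = "sphere (0::complex) 1"
  \<comment> \<open>On each half circle the angle is an \<open>arccos\<close> up to sign. The halves
    meet at 1, where both arguments are 0, and at -1, where they are R and -R and periodicity of h
    makes the values agree.\<close>
  define H where "H z = (if 0 \<le> Im z then h (R / pi * arccos (Re z)) else h (- (R / pi * arccos (Re z))))" for z
  \<comment> \<open>The algebra consists of those continuous functions whose pullback is already a
    trigonometric polynomial, so the approximant has the desired form automatically.\<close>
  define P where "P F \<longleftrightarrow> continuous_on ?S F \<and> trig (pi / R) (\<lambda>x. F (cis (pi / R * x)))" for F :: "complex \<Rightarrow> real"
  have Re1: "\<bar>Re z\<bar> \<le> 1" if "z \<in> ?S" for z using abs_Re_le_cmod[of z] that by simp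
  have H: "continuous_on ?S H"
  proof -
    have S: "?S = (?S \<inter> {z. 0 \<le> Im z}) \<union> (?S \<inter> {z. Im z \<le> 0})" by auto
    have cl: "closed (?S \<inter> {z. 0 \<le> Im z})" "closed (?S \<inter> {z. Im z \<le> 0})"
      by (auto intro!: closed_Int closed_halfspace_Im_ge closed_halfspace_Im_le)
    have c: "continuous_on T (\<lambda>z. h (a * arccos (Re z)))" if "T \<subseteq> ?S" for T a
      using that Re1 by (intro continuous_on_compose2[OF h] continuous_intros) (auto simp: abs_le_iff)
    show ?thesis
      unfolding H_def
    proof (subst S, rule continuous_on_cases[OF cl])
      show "continuous_on (?S \<inter> {z. 0 \<le> Im z}) (\<lambda>z. h (R / pi * arccos (Re z)))" by (rule c) auto
      show "continuous_on (?S \<inter> {z. Im z \<le> 0}) (\<lambda>z. h (- (R / pi * arccos (Re z))))"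
        using c[of "?S \<inter> {z. Im z \<le> 0}" "- (R / pi)"] by simp
      show "\<forall>z. z \<in> ?S \<inter> {z. 0 \<le> Im z} \<and> \<not> 0 \<le> Im z \<or> z \<in> ?S \<inter> {z. Im z \<le> 0} \<and> 0 \<le> Im z \<longrightarrow>
          h (R / pi * arccos (Re z)) = h (- (R / pi * arccos (Re z)))"
      proof (intro allI impI)
        fix z assume "z \<in> ?S \<inter> {z. 0 \<le> Im z} \<and> \<not> 0 \<le> Im z \<or> z \<in> ?S \<inter> {z. Im z \<le> 0} \<and> 0 \<le> Im z"
        then have "cmod z = 1" "Im z = 0" by auto
        then have "Re z = 1 \<or> Re z = -1" by (auto simp: cmod_def)
        then show "h (R / pi * arccos (Re z)) = h (- (R / pi * arccos (Re z)))" using per by auto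
      qed
    qed
  qed
  have "\<exists>F. P F \<and> (\<forall>z\<in>?S. \<bar>H z - F z\<bar> < e)"
  proof (rule Stone_Weierstrass_HOL[where P=P])
    show "P (\<lambda>x. c)" for c by (auto simp: P_def trig_const)
    show "P F \<Longrightarrow> continuous_on ?S F" for F by (simp add: P_def)
    show "P F \<and> P G \<Longrightarrow> P (\<lambda>x. F x + G x)" for F G by (auto simp: P_def intro: continuous_intros trig.add)
    show "P F \<and> P G \<Longrightarrow> P (\<lambda>x. F x * G x)" for F G by (auto simp: P_def intro: continuous_intros trig_mult)
    show "\<exists>f. P f \<and> f x \<noteq> f y" if "x \<in> ?S \<and> y \<in> ?S \<and> x \<noteq> y" for x y
    proof -
      have "P Re" using trig.cos[of "pi / R" 1 0] by (auto simp: P_def intro: continuous_intros)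
      moreover have "P Im" using trig.cos[of "pi / R" 1 "- (pi/2)"]
        by (auto simp: P_def cos_diff intro: continuous_intros)
      moreover have "Re x \<noteq> Re y \<or> Im x \<noteq> Im y" using that complex_eqI by blast
      ultimately show ?thesis by blast
    qed
  qed (use H e in auto)
  then obtain F where F: "P F" "\<And>z. z \<in> ?S \<Longrightarrow> \<bar>H z - F z\<bar> < e" by blast
  have "H (cis (pi / R * x)) = h x" if x: "x \<in> {-R..R}" for x
  proof (cases "0 \<le> x")
    case True
    have b: "0 \<le> pi / R * x" "pi / R * x \<le> pi" using True x R by (auto simp: field_simps)
    then have "0 \<le> sin (pi / R * x)" by (rule sin_ge_zero)
    then show ?thesis using b R by (simp add: H_def arccos_cos)
  next
    case False
    have "0 \<le> pi / R * y" "pi / R * y \<le> pi" if "0 \<le> y" "y \<le> R" for y using that R by (auto simp: field_simps)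
    from this[of "- x"] have b: "0 \<le> - (pi / R * x)" "- (pi / R * x) \<le> pi" using False x by auto
    have ac: "arccos (cos (pi / R * x)) = - (pi / R * x)" using arccos_cos[OF b] by simp
    show ?thesis
    proof (cases "x = - R")
      case True
      \<comment> \<open>The endpoint -R is mapped to -1, which belongs to the closed upper half, so
        H returns h at R there.\<close>
      then show ?thesis using R per by (simp add: H_def)
    next
      case neq: False
      have "0 < pi / R * y" "pi / R * y < pi" if "0 < y" "y < R" for y using that R by (auto simp: field_simps)
      from this[of "- x"] neq have "0 < - (pi / R * x)" "- (pi / R * x) < pi" using False x by auto
      then have "0 < sin (- (pi / R * x))" by (rule sin_gt_zero)
      then show ?thesis using R ac by (simp add: H_def)
    qed
  qed
  then have "\<bar>h x - F (cis (pi / R * x))\<bar> < e" if "x \<in> {-R..R}" for x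
    using F(2)[of "cis (pi / R * x)"] that by simp
  then show ?thesis using F(1) unfolding P_def by (intro exI[of _ "\<lambda>x. F (cis (pi / R * x))"]) auto
qed

text \<open>The second derivative \<open>h2\<close> is approximated and integrated twice. The mean of the approximation
  would destroy periodicity, but it can be dropped: it is small, as \<open>h2\<close> has mean 0 over a period.\<close>

lemma trig_approx2:
  fixes h h1 h2 :: "real \<Rightarrow> real"
  assumes R: "0 < R" and e: "0 < e" and D: "\<And>x. (h has_real_derivative h1 x) (at x)" "\<And>x. (h1 has_real_derivative h2 x) (at x)"
    and c: "continuous_on UNIV h2" and per: "h (- R) = h R" "h1 (- R) = h1 R" "h2 (- R) = h2 R"
  shows "\<exists>T. trig (pi / R) T \<and> (\<forall>x\<in>{-R..R}. \<bar>T x - h x\<bar> \<le> e \<and> \<bar>deriv T x - h1 x\<bar> \<le> e \<and> \<bar>deriv (deriv T) x - h2 x\<bar> \<le> e)"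
proof -
  \<comment> \<open>The three errors below are 2 \<eta>, 4 R \<eta> and 4 R R \<eta>; the factor
    \<open>2 * (1 + 2 * R)\<^sup>2\<close> dominates all three coefficients.\<close>
  define \<eta> where "\<eta> = e / (2 * (1 + 2 * R)\<^sup>2)"
  have \<eta>: "0 < \<eta>" using e R by (simp add: \<eta>_def)
  have \<eta>e: "\<eta> * (2 * (1 + 4 * R + 4 * (R * R))) = e"   proof -
    have "(1 + 2 * R)\<^sup>2 \<noteq> 0" using R by simp
    then have "\<eta> * (2 * (1 + 2 * R)\<^sup>2) = e" by (simp add: \<eta>_def)
    then show ?thesis by (simp add: power2_eq_square algebra_simps)
  qed
  obtain P where P: "trig (pi / R) P" "\<And>x. x \<in> {-R..R} \<Longrightarrow> \<bar>h2 x - P x\<bar> < \<eta>"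
    using trig_approx0[OF R \<eta> c per(3)] by blast
  have w: "pi / R \<noteq> 0" using R by simp
  obtain a F where F: "trig (pi / R) F" "\<And>x. (F has_real_derivative (P x - a)) (at x)"
    using trig_antideriv[OF P(1) w] by blast
  obtain b T0 where T0: "trig (pi / R) T0" "\<And>x. (T0 has_real_derivative (F x - b)) (at x)"
    using trig_antideriv[OF F(1) w] by blast
  have pR: "f (- R) = f R" if "trig (pi / R) f" for f
    using trig_periodic[OF that, of "- R" 1] R by simp
  \<comment> \<open>The additive constant makes T agree with h at 0, from where the last integration
    starts.\<close>
  define T where "T x = T0 x + (h 0 - T0 0)" for x
  have T: "trig (pi / R) T" unfolding T_def by (intro trig.add T0(1) trig_const)
  have DT: "(T has_real_derivative (F x - b)) (at x)" for x unfolding T_def by (auto intro!: derivative_eq_intros T0(2))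
  have dT: "deriv T = (\<lambda>x. F x - b)" using DT by (auto simp: DERIV_imp_deriv)
  have ddT: "deriv (deriv T) = (\<lambda>x. P x - a)" unfolding dT by (rule ext, rule DERIV_imp_deriv) (auto intro!: derivative_eq_intros F(2))
  have DG: "((\<lambda>x. F x - b - h1 x) has_real_derivative (P x - a - h2 x)) (at x)" for x
    by (auto intro!: derivative_eq_intros F(2) D)
  have DE: "((\<lambda>x. T x - h x) has_real_derivative (F x - b - h1 x)) (at x)" for x
    by (auto intro!: derivative_eq_intros DT D)
  have RR: "- R < R" using R by simp
  \<comment> \<open>Both F and \<open>h1\<close> take equal values at the two ends of the period, so
    the derivative of their difference vanishes somewhere; at that point a equals
    \<open>P - h2\<close>, which is small.\<close>
  obtain z where z: "- R < z" "z < R" "F R - b - h1 R - (F (- R) - b - h1 (- R)) = (R - - R) * (P z - a - h2 z)"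
    using MVT2[OF RR DG] by blast
  then have "a = P z - h2 z" using pR[OF F(1)] per R by auto
  then have a: "\<bar>a\<bar> < \<eta>" using P(2)[of z] z by (auto simp: abs_minus_commute)
  have b2: "\<bar>P x - a - h2 x\<bar> \<le> 2 * \<eta>" if "x \<in> {-R..R}" for x
    using P(2)[OF that] a by linarith
  \<comment> \<open>The same argument one level up yields a zero of \<open>F - b - h1\<close>. The
    first integration starts there, so b itself requires no bound.\<close>
  obtain z' where z': "- R < z'" "z' < R" "T R - h R - (T (- R) - h (- R)) = (R - - R) * (F z' - b - h1 z')"
    using MVT2[OF RR DE] by blast
  then have z'0: "F z' - b - h1 z' = 0" using pR[OF T] per R by auto
  have b1: "\<bar>F x - b - h1 x\<bar> \<le> 4 * R * \<eta>" if x: "x \<in> {-R..R}" for x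
  proof -
    have "norm ((F x - b - h1 x) - (F z' - b - h1 z')) \<le> 2 * \<eta> * norm (x - z')"
      by (rule field_differentiable_bound[where S="{-R..R}" and f'="\<lambda>x. P x - a - h2 x"])
        (use DG b2 x z' in \<open>auto intro: has_field_derivative_at_within\<close>)
    also have "\<dots> \<le> 2 * \<eta> * (2 * R)" using x z' \<eta> by (intro mult_left_mono) auto
    finally show ?thesis using z'0 by (simp add: mult_ac)
  qed
  have b0: "\<bar>T x - h x\<bar> \<le> 4 * R * R * \<eta>" if x: "x \<in> {-R..R}" for x
  proof -
    have "norm ((T x - h x) - (T 0 - h 0)) \<le> 4 * R * \<eta> * norm (x - 0)"
      by (rule field_differentiable_bound[where S="{-R..R}" and f'="\<lambda>x. F x - b - h1 x"])
        (use DE b1 x R in \<open>auto intro: has_field_derivative_at_within\<close>)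
    also have "\<dots> \<le> 4 * R * \<eta> * R" using x R \<eta> by (intro mult_left_mono) auto
    finally show ?thesis by (simp add: T_def mult_ac)
  qed
  have p: "0 \<le> \<eta> * R" "0 \<le> \<eta> * (R * R)" using \<eta> R by auto
  have "2 * \<eta> \<le> e" "4 * R * \<eta> \<le> e" "4 * R * R * \<eta> \<le> e" using p \<eta> \<eta>e by (simp_all add: algebra_simps)
  then have "\<bar>T x - h x\<bar> \<le> e \<and> \<bar>deriv T x - h1 x\<bar> \<le> e \<and> \<bar>deriv (deriv T) x - h2 x\<bar> \<le> e" if "x \<in> {-R..R}" for x
    using b0[OF that] b1[OF that] b2[OF that] unfolding ddT unfolding dT by linarith
  then show ?thesis using T by blast
qed

section \<open>Dynkin's formula\<close>

definition Lop :: "real \<Rightarrow> real \<Rightarrow> real \<Rightarrow> real measure \<Rightarrow> real measure \<Rightarrow> (real \<Rightarrow> real) \<Rightarrow> real \<Rightarrow> real" where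
  "Lop \<beta>0 \<beta>1 \<beta>2 A B g x = \<beta>0 * g x + \<beta>1 * deriv g x + \<beta>2 * deriv (deriv g) x + avg A g x + avg B (deriv (deriv g)) x"

lemma Cb_Lop:
  assumes "fin_borel A" "fin_borel B" "Cb g"
  shows "Cb (Lop \<beta>0 \<beta>1 \<beta>2 A B g)"
  unfolding Lop_def[abs_def]
  by (intro Cb_add(1) Cb_cmult(1) Cb_avg(1) Cb_deriv assms)

lemma avg_sum:
  assumes A: "fin_borel A" and g: "\<And>i. i \<in> I \<Longrightarrow> Cb (g i)"
  shows "avg A (\<lambda>x. \<Sum>i\<in>I. a i * g i x) x = (\<Sum>i\<in>I. a i * avg A (g i) x)"
proof -
  have "integrable A (\<lambda>v. a i * g i (x + v))" if i: "i \<in> I" for i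
  proof -
    obtain K where "\<And>x. \<bar>g i x\<bar> \<le> K" using Cb_bound0[OF g[OF i]] by blast
    then show ?thesis using Cb_measurable[OF g[OF i]]
      by (intro integrable_mult_right fin_borel_integrable[OF A, where B=K]) auto
  qed
  then show ?thesis unfolding avg_def by (subst Bochner_Integration.integral_sum) auto
qed

lemma Lop_sum:
  assumes AB: "fin_borel A" "fin_borel B" and g: "\<And>i. i \<in> I \<Longrightarrow> Cb (g i)"
  shows "Lop \<beta>0 \<beta>1 \<beta>2 A B (\<lambda>x. \<Sum>i\<in>I. a i * g i x) = (\<lambda>x. \<Sum>i\<in>I. a i * Lop \<beta>0 \<beta>1 \<beta>2 A B (g i) x)"
proof
  fix x
  have d: "deriv (\<lambda>x. \<Sum>i\<in>I. a i * g i x) = (\<lambda>x. \<Sum>i\<in>I. a i * deriv (g i) x)"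
    using Cb_sum(2)[where k=1 and a=a and A=I and g=g] g by simp
  have dd: "deriv (\<lambda>x. \<Sum>i\<in>I. a i * deriv (g i) x) = (\<lambda>x. \<Sum>i\<in>I. a i * deriv (deriv (g i)) x)"
    using Cb_sum(2)[where k=1 and a=a and A=I and g="\<lambda>i. deriv (g i)"] Cb_deriv[OF g] by simp
  show "Lop \<beta>0 \<beta>1 \<beta>2 A B (\<lambda>x. \<Sum>i\<in>I. a i * g i x) x = (\<Sum>i\<in>I. a i * Lop \<beta>0 \<beta>1 \<beta>2 A B (g i) x)"
    unfolding Lop_def d dd
    by (subst avg_sum[OF AB(1) g], assumption, subst avg_sum[OF AB(2) Cb_deriv[OF Cb_deriv[OF g]]], assumption)
      (simp add: sum.distrib[symmetric] sum_distrib_left algebra_simps)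
qed

text \<open>Isolates what Dynkin's formula needs. The assumption \<open>symbol\<close> links the two
  sides: the exponent of the characteristic functions is the Fourier symbol of the operator.\<close>

locale levy_family =
  fixes \<rho> :: "real \<Rightarrow> real measure" and \<psi> :: "real \<Rightarrow> complex" and \<beta>0 \<beta>1 \<beta>2 :: real and A B :: "real measure"
  assumes AB: "fin_borel A" "fin_borel B"
    and rd: "\<And>t. 0 \<le> t \<Longrightarrow> real_distribution (\<rho> t)"
    and char: "\<And>t \<xi>. 0 \<le> t \<Longrightarrow> char (\<rho> t) \<xi> = exp (t * \<psi> \<xi>)"
    and symbol: "\<And>\<xi> \<theta> x. Lop \<beta>0 \<beta>1 \<beta>2 A B (\<lambda>x. cos (\<xi> * x + \<theta>)) x = Re (\<psi> \<xi> * iexp (\<xi> * x + \<theta>))"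
begin

abbreviation L where "L \<equiv> Lop \<beta>0 \<beta>1 \<beta>2 A B"

lemma CbL: "Cb g \<Longrightarrow> Cb (L g)"
  by (rule Cb_Lop[OF AB])

lemma CbLk: "Cb g \<Longrightarrow> Cb ((L ^^ k) g)"
  by (induction k) (auto intro: CbL)

lemma rho_fin_borel: "0 \<le> t \<Longrightarrow> fin_borel (\<rho> t)"
  using rd[of t] by (simp add: fin_borel_def real_distribution_def real_distribution_axioms_def prob_space.finite_measure)

lemma rho_integrable:
  fixes g :: "real \<Rightarrow> real"
  shows "0 \<le> t \<Longrightarrow> Cb g \<Longrightarrow> integrable (\<rho> t) g"
  using Cb_bound0[of g] fin_borel_integrable[OF rho_fin_borel Cb_measurable] by (metis real_norm_def)

text \<open>At time 0 the characteristic function is constantly 1, which by uniqueness is that of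
  the unit mass at 0.\<close>

lemma rho0: "Cb g \<Longrightarrow> (\<integral>x. g x \<partial>\<rho> 0) = g 0"
proof -
  assume g: "Cb g"
  interpret R: real_distribution "\<rho> 0" using rd[of 0] by simp
  interpret P: prob_space "return borel (0::real)" by (rule prob_space_return) simp
  have r: "real_distribution (return borel 0)" by unfold_locales auto
  have "char (return borel 0) \<xi> = 1" for \<xi> unfolding char_def by (subst integral_return) auto
  then have "char (\<rho> 0) = char (return borel 0)" using char[of 0] by auto
  then have "\<rho> 0 = return borel 0" by (rule Levy_uniqueness[OF rd[of 0, simplified] r])
  then show ?thesis using Cb_measurable[OF g] by (simp add: integral_return)
qed

text \<open>The characteristic functions depend continuously on t, so Levy's continuity theorem
  gives weak convergence of the laws, which is tested on a bounded continuous function.\<close>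

lemma continuous_expect:
  fixes g :: "real \<Rightarrow> real"
  assumes "Cb g" shows "continuous_on {0..} (\<lambda>t. \<integral>x. g x \<partial>\<rho> t)"
proof (rule continuous_on_sequentiallyI)
  fix u :: "nat \<Rightarrow> real" and a assume u: "\<forall>n. u n \<in> {0..}" and a: "a \<in> {0..}" and lim: "u \<longlonglongrightarrow> a"
  obtain K where K: "\<And>x. \<bar>g x\<bar> \<le> K" using Cb_bound0[OF assms] by blast
  have "weak_conv_m (\<lambda>n. \<rho> (u n)) (\<rho> a)"
  proof (rule levy_continuity)
    show "(\<lambda>n. char (\<rho> (u n)) t) \<longlonglongrightarrow> char (\<rho> a) t" for t
      using u a lim by (simp add: char) (intro tendsto_intros)
  qed (use u a rd in auto)
  then show "(\<lambda>n. \<integral>x. g x \<partial>\<rho> (u n)) \<longlonglongrightarrow> (\<integral>x. g x \<partial>\<rho> a)"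
    using u a by (intro weak_conv_imp_integral_bdd_continuous_conv[OF rd rd _ Cb_isCont[OF assms], where B=K]) (auto simp: K)
qed

text \<open>The integrated form is taken because it survives bounded pointwise limits by dominated
  convergence; a derivative in t would not pass to the limit so directly.\<close>

definition dynkin :: "(real \<Rightarrow> real) \<Rightarrow> bool" where
  "dynkin g \<longleftrightarrow> (\<forall>t\<ge>0. ((\<lambda>r. \<integral>x. L g x \<partial>\<rho> r) has_integral ((\<integral>x. g x \<partial>\<rho> t) - (\<integral>x. g x \<partial>\<rho> 0))) {0..t})"

text \<open>Both expectations are real parts: of
  \<open>iexp \<theta> * exp (r * \<psi> \<xi>)\<close> for the function and of the derivative of
  this in r for its image under the operator. The fundamental theorem of calculus connects
  them.\<close>

lemma dynkin_cos: "dynkin (\<lambda>x. cos (\<xi> * x + \<theta>))"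
  unfolding dynkin_def
proof (intro allI impI)
  fix t :: real assume t: "0 \<le> t"
  have ie: "complex_integrable (\<rho> r) (\<lambda>x. iexp (\<xi> * x + \<theta>))" if "0 \<le> r" for r
    by (rule fin_borel_integrable[OF rho_fin_borel[OF that], where B=1]) auto
  have E: "(\<integral>x. iexp (\<xi> * x + \<theta>) \<partial>\<rho> r) = iexp \<theta> * exp (r * \<psi> \<xi>)" if "0 \<le> r" for r
  proof -
    have "(\<integral>x. iexp (\<xi> * x + \<theta>) \<partial>\<rho> r) = (\<integral>x. iexp \<theta> * iexp (\<xi> * x) \<partial>\<rho> r)"
      by (simp add: exp_add[symmetric] algebra_simps)
    also have "\<dots> = iexp \<theta> * char (\<rho> r) \<xi>" unfolding char_def by simp
    finally show ?thesis by (simp add: char[OF that])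
  qed
  have 1: "(\<integral>x. cos (\<xi> * x + \<theta>) \<partial>\<rho> r) = Re (iexp \<theta> * exp (r * \<psi> \<xi>))" if "0 \<le> r" for r
  proof -
    have "(\<integral>x. cos (\<xi> * x + \<theta>) \<partial>\<rho> r) = (\<integral>x. Re (iexp (\<xi> * x + \<theta>)) \<partial>\<rho> r)" by (simp add: Re_exp)
    also have "\<dots> = Re (\<integral>x. iexp (\<xi> * x + \<theta>) \<partial>\<rho> r)" by (rule integral_Re[OF ie[OF that]])
    finally show ?thesis by (simp only: E[OF that])
  qed
  have 2: "(\<integral>x. L (\<lambda>x. cos (\<xi> * x + \<theta>)) x \<partial>\<rho> r) = Re (iexp \<theta> * (\<psi> \<xi> * exp (r * \<psi> \<xi>)))" if "0 \<le> r" for r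
  proof -
    have "(\<integral>x. L (\<lambda>x. cos (\<xi> * x + \<theta>)) x \<partial>\<rho> r) = (\<integral>x. Re (\<psi> \<xi> * iexp (\<xi> * x + \<theta>)) \<partial>\<rho> r)" by (simp only: symbol)
    also have "\<dots> = Re (\<integral>x. \<psi> \<xi> * iexp (\<xi> * x + \<theta>) \<partial>\<rho> r)" by (rule integral_Re) (intro integrable_mult_right ie that)
    also have "(\<integral>x. \<psi> \<xi> * iexp (\<xi> * x + \<theta>) \<partial>\<rho> r) = \<psi> \<xi> * (\<integral>x. iexp (\<xi> * x + \<theta>) \<partial>\<rho> r)"
      by (rule integral_mult_right_zero)
    also have "(\<integral>x. iexp (\<xi> * x + \<theta>) \<partial>\<rho> r) = iexp \<theta> * exp (r * \<psi> \<xi>)" by (rule E[OF that])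
    finally show ?thesis by (simp only: mult_ac)
  qed
  have "((\<lambda>r. Re (iexp \<theta> * (\<psi> \<xi> * exp (r * \<psi> \<xi>)))) has_integral (Re (iexp \<theta> * exp (t * \<psi> \<xi>)) - Re (iexp \<theta> * exp (0 * \<psi> \<xi>)))) {0..t}"
  proof (rule fundamental_theorem_of_calculus[OF t, of "\<lambda>r. Re (iexp \<theta> * exp (r * \<psi> \<xi>))", simplified of_real_0])
    fix r
    have "((\<lambda>r. exp (of_real r * \<psi> \<xi>)) has_vector_derivative (\<psi> \<xi> * exp (r * \<psi> \<xi>))) (at r within {0..t})"
    proof -
      have "((\<lambda>z. exp (z * \<psi> \<xi>)) has_field_derivative (\<psi> \<xi> * exp (of_real r * \<psi> \<xi>))) (at (of_real r))"
        by (auto intro!: derivative_eq_intros)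
      from has_vector_derivative_real_field[OF this] show ?thesis by (rule has_vector_derivative_at_within)
    qed
    then have "((\<lambda>r. iexp \<theta> * exp (of_real r * \<psi> \<xi>)) has_vector_derivative (iexp \<theta> * (\<psi> \<xi> * exp (r * \<psi> \<xi>)))) (at r within {0..t})"
      by (rule has_vector_derivative_mult_right)
    then show "((\<lambda>r. Re (iexp \<theta> * exp (of_real r * \<psi> \<xi>))) has_vector_derivative Re (iexp \<theta> * (\<psi> \<xi> * exp (r * \<psi> \<xi>)))) (at r within {0..t})"
      by (simp only: has_vector_derivative_complex_iff) (simp add: has_real_derivative_iff_has_vector_derivative)
  qed
  then show "((\<lambda>r. \<integral>x. L (\<lambda>x. cos (\<xi> * x + \<theta>)) x \<partial>\<rho> r) has_integral ((\<integral>x. cos (\<xi> * x + \<theta>) \<partial>\<rho> t) - (\<integral>x. cos (\<xi> * x + \<theta>) \<partial>\<rho> 0))) {0..t}"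
    using t by (subst has_integral_cong[of "{0..t}", OF 2]) (auto simp: 1)
qed

lemma dynkin_add:
  assumes "Cb f" "Cb g" "dynkin f" "dynkin g" shows "dynkin (\<lambda>x. f x + g x)"
  unfolding dynkin_def
proof (intro allI impI)
  fix t :: real assume t: "0 \<le> t"
  have L: "L (\<lambda>x. f x + g x) x = L f x + L g x" for x
    using fun_cong[OF Lop_sum[OF AB, where I="UNIV::bool set" and g="\<lambda>b. if b then f else g" and a="\<lambda>_. 1"], of \<beta>0 \<beta>1 \<beta>2 x] assms
    by (simp add: UNIV_bool add.commute)
  have "((\<lambda>r. (\<integral>x. L f x \<partial>\<rho> r) + (\<integral>x. L g x \<partial>\<rho> r)) has_integral
      (((\<integral>x. f x \<partial>\<rho> t) - (\<integral>x. f x \<partial>\<rho> 0)) + ((\<integral>x. g x \<partial>\<rho> t) - (\<integral>x. g x \<partial>\<rho> 0)))) {0..t}"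
    using assms t by (intro has_integral_add) (auto simp: dynkin_def)
  moreover have "(\<integral>x. L (\<lambda>x. f x + g x) x \<partial>\<rho> r) = (\<integral>x. L f x \<partial>\<rho> r) + (\<integral>x. L g x \<partial>\<rho> r)" if "r \<in> {0..t}" for r
    using that assms by (simp add: L rho_integrable CbL)
  ultimately show "((\<lambda>r. \<integral>x. L (\<lambda>x. f x + g x) x \<partial>\<rho> r) has_integral ((\<integral>x. f x + g x \<partial>\<rho> t) - (\<integral>x. f x + g x \<partial>\<rho> 0))) {0..t}"
    using t assms by (subst has_integral_cong) (auto simp: rho_integrable algebra_simps)
qed

lemma dynkin_cmult:
  assumes "Cb f" "dynkin f" shows "dynkin (\<lambda>x. a * f x)"
  unfolding dynkin_def
proof (intro allI impI)
  fix t :: real assume t: "0 \<le> t"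
  have L: "L (\<lambda>x. a * f x) x = a * L f x" for x
    using fun_cong[OF Lop_sum[OF AB, where I="{()}" and g="\<lambda>_. f" and a="\<lambda>_. a"], of \<beta>0 \<beta>1 \<beta>2 x] assms by simp
  have "((\<lambda>r. a * (\<integral>x. L f x \<partial>\<rho> r)) has_integral (a * ((\<integral>x. f x \<partial>\<rho> t) - (\<integral>x. f x \<partial>\<rho> 0)))) {0..t}"
    using assms t by (intro has_integral_mult_right) (auto simp: dynkin_def)
  then show "((\<lambda>r. \<integral>x. L (\<lambda>x. a * f x) x \<partial>\<rho> r) has_integral ((\<integral>x. a * f x \<partial>\<rho> t) - (\<integral>x. a * f x \<partial>\<rho> 0))) {0..t}"
    by (simp add: L right_diff_distrib)
qed

lemma dynkin_trig: "trig w f \<Longrightarrow> dynkin f"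
  by (induction rule: trig.induct) (auto intro: dynkin_cos dynkin_add dynkin_cmult trig_Cb)

text \<open>The operator sees only two derivatives and two finite measures, so bounded convergence
  of the functions and of these derivatives suffices. Dominated convergence is applied in the
  averages, then under the laws, then in time.\<close>

lemma dynkin_limit:
  assumes g: "Cb g" and gj: "\<And>j::nat. Cb (gj j)" and dy: "\<And>j. dynkin (gj j)"
    and b: "\<And>j x. \<bar>gj j x\<bar> \<le> K" "\<And>j x. \<bar>deriv (gj j) x\<bar> \<le> K" "\<And>j x. \<bar>deriv (deriv (gj j)) x\<bar> \<le> K"
    and lim: "\<And>x. (\<lambda>j. gj j x) \<longlonglongrightarrow> g x" "\<And>x. (\<lambda>j. deriv (gj j) x) \<longlonglongrightarrow> deriv g x"
      "\<And>x. (\<lambda>j. deriv (deriv (gj j)) x) \<longlonglongrightarrow> deriv (deriv g) x"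
  shows "dynkin g"
  unfolding dynkin_def
proof (intro allI impI)
  fix t :: real assume t: "0 \<le> t"
  define K' where "K' = \<bar>\<beta>0\<bar> * K + \<bar>\<beta>1\<bar> * K + \<bar>\<beta>2\<bar> * K + measure A UNIV * K + measure B UNIV * K"
  have K: "0 \<le> K" using b(1)[of 0 0] by linarith
  have K': "0 \<le> K'" unfolding K'_def using K by (intro add_nonneg_nonneg mult_nonneg_nonneg) auto
  have avg_lim: "(\<lambda>j. avg C (fj j) x) \<longlonglongrightarrow> avg C f x"
    if C: "fin_borel C" and fj: "\<And>j. Cb (fj j)" "Cb f" "\<And>j x. \<bar>fj j x\<bar> \<le> K" "\<And>x. (\<lambda>j. fj j x) \<longlonglongrightarrow> f x" for C fj f x
    unfolding avg_def
  proof (rule integral_dominated_convergence[where w="\<lambda>_. K"])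
    show "integrable C (\<lambda>_. K)" by (rule fin_borel_integrable[OF C, where B=K]) (use K in auto)
    show "(\<lambda>v. f (x + v)) \<in> borel_measurable C"
      using Cb_measurable[OF fj(2)] by (intro fin_borelD(4)[OF C]) auto
    show "(\<lambda>v. fj i (x + v)) \<in> borel_measurable C" for i
      using Cb_measurable[OF fj(1)] by (intro fin_borelD(4)[OF C]) auto
  qed (use fj in auto)
  have Llim: "(\<lambda>j. L (gj j) x) \<longlonglongrightarrow> L g x" for x
    unfolding Lop_def
    by (intro tendsto_intros lim avg_lim AB g gj Cb_deriv b)
  have Lb: "\<bar>L (gj j) x\<bar> \<le> K'" for j x
  proof -
    have m: "gj j \<in> borel_measurable borel" "deriv (deriv (gj j)) \<in> borel_measurable borel"
      by (intro Cb_measurable Cb_deriv gj)+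
    have "\<bar>\<beta>0 * gj j x\<bar> \<le> \<bar>\<beta>0\<bar> * K" "\<bar>\<beta>1 * deriv (gj j) x\<bar> \<le> \<bar>\<beta>1\<bar> * K" "\<bar>\<beta>2 * deriv (deriv (gj j)) x\<bar> \<le> \<bar>\<beta>2\<bar> * K"
      unfolding abs_mult by (intro mult_left_mono b abs_ge_zero)+
    moreover have "\<bar>avg A (gj j) x\<bar> \<le> measure A UNIV * K" "\<bar>avg B (deriv (deriv (gj j))) x\<bar> \<le> measure B UNIV * K"
      by (intro avg_bound AB b m)+
    ultimately show ?thesis unfolding Lop_def K'_def by linarith
  qed
  have DC: "(\<lambda>j. \<integral>x. fj j x \<partial>\<rho> r) \<longlonglongrightarrow> (\<integral>x. f x \<partial>\<rho> r)"
    if r: "0 \<le> r" and fj: "\<And>j. Cb (fj j)" "Cb f" "\<And>j x. \<bar>fj j x\<bar> \<le> C" "\<And>x. (\<lambda>j. fj j x) \<longlonglongrightarrow> f x" for r C fj f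
  proof (rule integral_dominated_convergence[where w="\<lambda>_. C"])
    have "0 \<le> C" using fj(3)[of 0 0] by linarith
    then show "integrable (\<rho> r) (\<lambda>_. C)" by (intro fin_borel_integrable[OF rho_fin_borel[OF r], where B=C]) auto
    show "f \<in> borel_measurable (\<rho> r)" "fj i \<in> borel_measurable (\<rho> r)" for i
      using fin_borelD(4)[OF rho_fin_borel[OF r] Cb_measurable] fj by auto
  qed (use fj in auto)
  have int: "(\<lambda>r. \<integral>x. L h x \<partial>\<rho> r) integrable_on {0..t}" if "Cb h" for h
    by (rule integrable_continuous_real, rule continuous_on_subset[OF continuous_expect[OF CbL[OF that]]]) auto
  have Ebd: "\<bar>\<integral>x. L (gj j) x \<partial>\<rho> r\<bar> \<le> K'" if r: "0 \<le> r" for r j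
  proof -
    interpret real_distribution "\<rho> r" by (rule rd[OF r])
    have "\<bar>\<integral>x. L (gj j) x \<partial>\<rho> r\<bar> \<le> (\<integral>x. K' \<partial>\<rho> r)"
      using rho_integrable[OF r CbL[OF gj]] Lb K' by (intro integral_abs_bound_integral) auto
    then show ?thesis by (simp add: prob_space del: space_eq_univ)
  qed
  have c: "(\<lambda>j. integral {0..t} (\<lambda>r. \<integral>x. L (gj j) x \<partial>\<rho> r)) \<longlonglongrightarrow> integral {0..t} (\<lambda>r. \<integral>x. L g x \<partial>\<rho> r)"
    by (rule dominated_convergence(2)[where h="\<lambda>_. K'"])
      (use int gj Ebd DC[OF _ CbL[OF gj] CbL[OF g] Lb Llim] in auto)
  have "integral {0..t} (\<lambda>r. \<integral>x. L (gj j) x \<partial>\<rho> r) = (\<integral>x. gj j x \<partial>\<rho> t) - (\<integral>x. gj j x \<partial>\<rho> 0)" for j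
    using dy[of j] t by (auto simp: dynkin_def intro: integral_unique)
  moreover have "(\<lambda>j. (\<integral>x. gj j x \<partial>\<rho> t) - (\<integral>x. gj j x \<partial>\<rho> 0)) \<longlonglongrightarrow> (\<integral>x. g x \<partial>\<rho> t) - (\<integral>x. g x \<partial>\<rho> 0)"
    using t by (intro tendsto_diff DC[OF _ gj g b(1) lim(1)]) auto
  ultimately have "integral {0..t} (\<lambda>r. \<integral>x. L g x \<partial>\<rho> r) = (\<integral>x. g x \<partial>\<rho> t) - (\<integral>x. g x \<partial>\<rho> 0)"
    using c LIMSEQ_unique by simp
  then show "((\<lambda>r. \<integral>x. L g x \<partial>\<rho> r) has_integral ((\<integral>x. g x \<partial>\<rho> t) - (\<integral>x. g x \<partial>\<rho> 0))) {0..t}"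
    using integrable_integral[OF int[OF g]] by simp
qed

end

lemma deriv_const_on_open:
  fixes f :: "real \<Rightarrow> real"
  assumes "open S" "x \<in> S" "\<And>y. y \<in> S \<Longrightarrow> f y = k"
  shows "deriv f x = 0"
proof (rule DERIV_imp_deriv)
  have "((\<lambda>_. k) has_real_derivative 0) (at x)" by simp
  then show "(f has_real_derivative 0) (at x)"
    by (rule has_field_derivative_transform_within_open[OF _ assms(1,2)]) (simp add: assms(3))
qed

context levy_family
begin

text \<open>The function is cut off by \<open>c (x / N)\<close>, and the product is approximated with period \<open>2 N\<close>.\<close>

lemma dynkin_Cb:
  assumes c: "Cb c" "0 < a" "\<And>x. \<bar>x\<bar> \<le> a \<Longrightarrow> c x = 1" "d < 1" "\<And>x. d < \<bar>x\<bar> \<Longrightarrow> c x = 0" and g: "Cb g"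
  shows "dynkin g"
proof -
  define N where "N j = real (Suc j)" for j
  have N: "0 < N j" "1 \<le> N j" for j by (auto simp: N_def)
  let ?g1 = "deriv g" and ?g2 = "deriv (deriv g)" and ?c1 = "deriv c" and ?c2 = "deriv (deriv c)"
  define h where "h j x = g x * c (x / N j)" for j x
  define h1 where "h1 j x = ?g1 x * c (x / N j) + g x * (?c1 (x / N j) / N j)" for j x
  define h2 where "h2 j x = ?g2 x * c (x / N j) + 2 * (?g1 x * (?c1 (x / N j) / N j)) + g x * (?c2 (x / N j) / (N j)\<^sup>2)" for j x
  note Dg = Cb_DERIV0[OF g] Cb_DERIV0[OF Cb_deriv[OF g]]
  note Dc = Cb_DERIV0[OF c(1)] Cb_DERIV0[OF Cb_deriv[OF c(1)]]
  have Dc': "((\<lambda>x. c (x / N j)) has_real_derivative (?c1 (x / N j) / N j)) (at x)"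
    "((\<lambda>x. ?c1 (x / N j)) has_real_derivative (?c2 (x / N j) / N j)) (at x)" for j x
    using DERIV_chain2[OF Dc(1), of "\<lambda>x. x / N j" "1 / N j" x UNIV] DERIV_chain2[OF Dc(2), of "\<lambda>x. x / N j" "1 / N j" x UNIV]
      DERIV_cdivide[OF DERIV_ident, of "N j"] by auto
  have Dh: "(h j has_real_derivative h1 j x) (at x)" for j x
    unfolding h_def h1_def by (auto intro!: derivative_eq_intros Dg Dc' simp: mult_ac)
  have Dh1: "(h1 j has_real_derivative h2 j x) (at x)" for j x
  proof -
    have "(h1 j has_real_derivative (?g1 x * (?c1 (x / N j) / N j) + ?g2 x * c (x / N j)) +
        (g x * (?c2 (x / N j) / N j / N j) + ?g1 x * (?c1 (x / N j) / N j))) (at x)"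
      unfolding h1_def by (intro DERIV_add DERIV_mult' DERIV_cdivide Dg Dc')
    then show ?thesis by (simp add: h2_def power2_eq_square add_ac)
  qed
  have cont: "continuous_on UNIV (h2 j)" for j
  proof -
    have "continuous_on UNIV f" if "Cb f" for f using Cb_isCont[OF that] by (simp add: continuous_at_imp_continuous_on)
    note c1 = this
    have c2: "continuous_on UNIV (\<lambda>x. f (x / N j) / k)" if "Cb f" "k \<noteq> 0" for f k
      using N[of j] by (intro continuous_on_divide continuous_on_const continuous_on_compose2[OF c1[OF that(1)]] continuous_on_id) (use that in auto)
    have N0: "N j \<noteq> 0" "(N j)\<^sup>2 \<noteq> 0" using N[of j] by auto
    note cs = c2[OF c(1), of 1, simplified] c2[OF Cb_deriv[OF c(1)] N0(1)] c2[OF Cb_deriv[OF Cb_deriv[OF c(1)]] N0(2)]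
    note gs = c1[OF g] c1[OF Cb_deriv[OF g]] c1[OF Cb_deriv[OF Cb_deriv[OF g]]]
    show ?thesis unfolding h2_def
      by (intro continuous_on_add continuous_on_mult continuous_on_const cs gs)
  qed
  have out: "c x = 0" "?c1 x = 0" "?c2 x = 0" if "d < \<bar>x\<bar>" for x
  proof -
    have S: "open {x. d < \<bar>x\<bar>}" by (intro open_Collect_less continuous_intros)
    have 1: "?c1 y = 0" if "d < \<bar>y\<bar>" for y
      by (rule deriv_const_on_open[OF S]) (use that c(5) in auto)
    show "c x = 0" using that by (rule c(5))
    show "?c1 x = 0" using that by (rule 1)
    show "?c2 x = 0" by (rule deriv_const_on_open[OF S]) (use that 1 in auto)
  qed
  have inn: "c x = 1" "?c1 x = 0" "?c2 x = 0" if "\<bar>x\<bar> < a" for x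
  proof -
    have S: "open {x. \<bar>x\<bar> < a}" by (intro open_Collect_less continuous_intros)
    have 1: "?c1 y = 0" if "\<bar>y\<bar> < a" for y
      by (rule deriv_const_on_open[OF S]) (use that c(3) in auto)
    show "c x = 1" using that by (intro c(3)) simp
    show "?c1 x = 0" using that by (rule 1)
    show "?c2 x = 0" by (rule deriv_const_on_open[OF S]) (use that 1 in auto)
  qed
  \<comment> \<open>As d < 1, the cutoff and its derivatives vanish at the ends of the window; the
    product therefore continues periodically together with two derivatives.\<close>
  have per: "h j (- N j) = h j (N j)" "h1 j (- N j) = h1 j (N j)" "h2 j (- N j) = h2 j (N j)" for j
    using out[of 1] out[of "-1"] c(4) N[of j] by (auto simp: h_def h1_def h2_def)
  obtain G0 where G0: "0 \<le> G0" "\<And>x. \<bar>g x\<bar> \<le> G0" using Cb_bound0[OF g] by blast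
  obtain G1 where G1: "0 \<le> G1" "\<And>x. \<bar>?g1 x\<bar> \<le> G1" using Cb_bound0[OF Cb_deriv[OF g]] by blast
  obtain G2 where G2: "0 \<le> G2" "\<And>x. \<bar>?g2 x\<bar> \<le> G2" using Cb_bound0[OF Cb_deriv[OF Cb_deriv[OF g]]] by blast
  obtain C0 where C0: "0 \<le> C0" "\<And>x. \<bar>c x\<bar> \<le> C0" using Cb_bound0[OF c(1)] by blast
  obtain C1 where C1: "0 \<le> C1" "\<And>x. \<bar>?c1 x\<bar> \<le> C1" using Cb_bound0[OF Cb_deriv[OF c(1)]] by blast
  obtain C2 where C2: "0 \<le> C2" "\<And>x. \<bar>?c2 x\<bar> \<le> C2" using Cb_bound0[OF Cb_deriv[OF Cb_deriv[OF c(1)]]] by blast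
  have dv: "\<bar>u / v\<bar> \<le> w" if "\<bar>u\<bar> \<le> w" "1 \<le> v" for u v w :: real
  proof -
    have "\<bar>u\<bar> * 1 \<le> w * v" using that by (intro mult_mono) auto
    then show ?thesis using that by (simp add: abs_divide divide_le_eq)
  qed
  have C1': "\<bar>?c1 (x / N j) / N j\<bar> \<le> C1" for j x by (rule dv[OF C1(2) N(2)])
  have C2': "\<bar>?c2 (x / N j) / (N j)\<^sup>2\<bar> \<le> C2" for j x by (rule dv[OF C2(2)]) (intro one_le_power N)
  have ml: "\<bar>u * v\<bar> \<le> U * V" if "\<bar>u\<bar> \<le> U" "\<bar>v\<bar> \<le> V" for u v U V :: real
    unfolding abs_mult using that by (intro mult_mono) auto
  define K where "K = G0 * C0 + (G1 * C0 + G0 * C1) + (G2 * C0 + 2 * (G1 * C1) + G0 * C2)"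
  have pos: "0 \<le> G0 * C0" "0 \<le> G1 * C0" "0 \<le> G0 * C1" "0 \<le> G2 * C0" "0 \<le> G1 * C1" "0 \<le> G0 * C2"
    using G0 G1 G2 C0 C1 C2 by auto
  have hb: "\<bar>h j x\<bar> \<le> K" for j x
    using ml[OF G0(2) C0(2), of x "x / N j"] pos unfolding h_def K_def by linarith
  have h1b: "\<bar>h1 j x\<bar> \<le> K" for j x
    using ml[OF G1(2) C0(2), of x "x / N j"] ml[OF G0(2) C1', of x x j] pos unfolding h1_def K_def by linarith
  have h2b: "\<bar>h2 j x\<bar> \<le> K" for j x
    using ml[OF G2(2) C0(2), of x "x / N j"] ml[OF G1(2) C1', of x x j] ml[OF G0(2) C2', of x x j] pos unfolding h2_def K_def by linarith
  have "\<exists>T. trig (pi / N j) T \<and> (\<forall>x\<in>{-N j..N j}. \<bar>T x - h j x\<bar> \<le> 1 / N j \<and> \<bar>deriv T x - h1 j x\<bar> \<le> 1 / N j \<and> \<bar>deriv (deriv T) x - h2 j x\<bar> \<le> 1 / N j)" for j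
    by (rule trig_approx2[OF N(1) _ Dh Dh1 cont per]) (use N(1)[of j] in simp)
  then obtain T where T: "\<And>j. trig (pi / N j) (T j)"
    and Ta: "\<And>j x. x \<in> {-N j..N j} \<Longrightarrow> \<bar>T j x - h j x\<bar> \<le> 1 / N j"
      "\<And>j x. x \<in> {-N j..N j} \<Longrightarrow> \<bar>deriv (T j) x - h1 j x\<bar> \<le> 1 / N j"
      "\<And>j x. x \<in> {-N j..N j} \<Longrightarrow> \<bar>deriv (deriv (T j)) x - h2 j x\<bar> \<le> 1 / N j"
    by metis
  have N1: "1 / N j \<le> 1" for j using N(2)[of j] by simp
  \<comment> \<open>Closeness holds on one period only, but the approximants are periodic, so their
    bounds extend to the whole line.\<close>
  have Tb: "\<bar>T j x\<bar> \<le> K + 1 \<and> \<bar>deriv (T j) x\<bar> \<le> K + 1 \<and> \<bar>deriv (deriv (T j)) x\<bar> \<le> K + 1" for j x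
  proof -
    obtain x0 where x0: "x0 \<in> {-N j..N j}" "\<And>f. trig (pi / N j) f \<Longrightarrow> f x = f x0" using trig_reduce[OF N(1)[of j], of x] by blast
    have "T j x = T j x0" "deriv (T j) x = deriv (T j) x0" "deriv (deriv (T j)) x = deriv (deriv (T j)) x0"
      by (intro x0(2) trig_deriv T)+
    then show ?thesis using Ta[OF x0(1)] hb[of j x0] h1b[of j x0] h2b[of j x0] N1[of j] by (simp only:) linarith
  qed
  have Nlim: "(\<lambda>j. 1 / N j) \<longlonglongrightarrow> 0"
    using LIMSEQ_inverse_real_of_nat by (simp add: N_def inverse_eq_divide)
  \<comment> \<open>For fixed x the window eventually contains x, and near \<open>x / N j\<close>
    the cutoff is constantly 1, so that the product and its derivatives are those of g.\<close>
  have ev: "\<forall>\<^sub>F j in sequentially. \<bar>x / N j\<bar> < a \<and> x \<in> {-N j..N j}" for x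
  proof -
    have "(\<lambda>j. \<bar>x\<bar> * (1 / N j)) \<longlonglongrightarrow> \<bar>x\<bar> * 0" by (intro tendsto_intros Nlim)
    then have "\<forall>\<^sub>F j in sequentially. \<bar>x\<bar> * (1 / N j) < min a 1" using c(2) by (intro order_tendstoD) auto
    then show ?thesis
    proof eventually_elim
      case (elim j)
      then have "\<bar>x\<bar> / N j < a" "\<bar>x\<bar> / N j < 1" by auto
      then show ?case using N(1)[of j] by (auto simp: abs_divide divide_less_eq)
    qed
  qed
  have limI: "(\<lambda>j. F j) \<longlonglongrightarrow> f" if "\<forall>\<^sub>F j in sequentially. \<bar>F j - f\<bar> \<le> 1 / N j" for F and f :: real
  proof -
    have "(\<lambda>j. F j - f) \<longlonglongrightarrow> 0" by (rule Lim_null_comparison[OF _ Nlim]) (use that in simp)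
    then show ?thesis by (simp add: LIM_zero_iff)
  qed
  show ?thesis
  proof (rule dynkin_limit[OF g trig_Cb[OF T] dynkin_trig[OF T], where K="K+1"])
    fix x
    have "\<forall>\<^sub>F j in sequentially. \<bar>T j x - g x\<bar> \<le> 1 / N j"
      using ev[of x] by eventually_elim (use Ta(1) in \<open>force simp: h_def inn\<close>)
    then show "(\<lambda>j. T j x) \<longlonglongrightarrow> g x" by (rule limI)
    have "\<forall>\<^sub>F j in sequentially. \<bar>deriv (T j) x - ?g1 x\<bar> \<le> 1 / N j"
      using ev[of x] by eventually_elim (use Ta(2) in \<open>force simp: h1_def inn\<close>)
    then show "(\<lambda>j. deriv (T j) x) \<longlonglongrightarrow> ?g1 x" by (rule limI)
    have "\<forall>\<^sub>F j in sequentially. \<bar>deriv (deriv (T j)) x - ?g2 x\<bar> \<le> 1 / N j"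
      using ev[of x] by eventually_elim (use Ta(3) in \<open>force simp: h2_def inn\<close>)
    then show "(\<lambda>j. deriv (deriv (T j)) x) \<longlonglongrightarrow> ?g2 x" by (rule limI)
  qed (use Tb in auto)
qed

text \<open>Dynkin's formula for every iterate says that the expectation of the k-th iterate has the
  expectation of the next one as its time derivative. Taylor's formula with integral remainder does
  the rest.\<close>

lemma taylor_expansion:
  assumes dy: "\<And>g. Cb g \<Longrightarrow> dynkin g" and f: "Cb f" and t: "0 \<le> t"
  shows "(\<integral>x. f x \<partial>\<rho> t) = (\<Sum>k\<le>n. t ^ k / fact k * (L ^^ k) f 0)
    + t ^ (n + 1) / fact n * (LINT \<alpha> : {0..1} | lborel. (1 - \<alpha>) ^ n * (\<integral>x. (L ^^ (n + 1)) f x \<partial>\<rho> (\<alpha> * t)))"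
proof -
  define u where "u k r = (\<integral>x. (L ^^ k) f x \<partial>\<rho> r)" for k r
  have uc: "continuous_on {0..} (u k)" for k
    unfolding u_def by (rule continuous_expect[OF CbLk[OF f]])
  have uD: "(u k has_vector_derivative u (Suc k) r) (at r within {0..t})" if r: "r \<in> {0..t}" for k r
  proof -
    have "((\<lambda>r. integral {0..r} (u (Suc k))) has_vector_derivative u (Suc k) r) (at r within {0..t})"
      by (rule integral_has_vector_derivative[OF _ r]) (rule continuous_on_subset[OF uc], auto)
    then have 1: "((\<lambda>r. u k 0 + integral {0..r} (u (Suc k))) has_vector_derivative u (Suc k) r) (at r within {0..t})"
      by (auto intro!: derivative_eq_intros)
    have "u k r = u k 0 + integral {0..r} (u (Suc k))" if "r \<in> {0..t}" for r
      using dy[OF CbLk[OF f, of k]] that unfolding dynkin_def u_def by (auto dest!: spec[of _ r] integral_unique)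
    from has_vector_derivative_transform[OF r this 1] show ?thesis by simp
  qed
  \<comment> \<open>Time is rescaled to [0, 1], where the remainder of the theorem is integrated;
    every derivative in \<alpha> then produces a factor t.\<close>
  define Df where "Df k \<alpha> = t ^ k * u k (\<alpha> * t)" for k \<alpha>
  have img: "(\<lambda>\<alpha>. \<alpha> * t) ` {0..1} \<subseteq> {0..t}" using t by (auto intro: mult_left_le_one_le)
  have D: "(Df k has_vector_derivative Df (Suc k) \<alpha>) (at \<alpha> within {0..1})" if "\<alpha> \<in> {0..1}" for k \<alpha>
  proof -
    have "\<alpha> * t \<in> {0..t}" using img that by blast
    from has_vector_derivative_within_subset[OF uD[OF this] img]
    have "((u k \<circ> (\<lambda>\<alpha>. \<alpha> * t)) has_vector_derivative t *\<^sub>R u (Suc k) (\<alpha> * t)) (at \<alpha> within {0..1})"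
      by (intro vector_diff_chain_within) (auto intro!: derivative_eq_intros)
    from has_vector_derivative_mult_right[OF this, of "t ^ k"]
    show ?thesis by (simp add: Df_def[abs_def] comp_def mult_ac)
  qed
  have "((\<lambda>x. ((1 - x) ^ (Suc n - 1) / fact (Suc n - 1)) *\<^sub>R Df (Suc n) x) has_integral
      Df 0 1 - (\<Sum>i<Suc n. ((1 - 0) ^ i / fact i) *\<^sub>R Df i 0)) {0..1}"
    by (rule Taylor_has_integral[where Df=Df]) (use D in auto)
  then have I: "integral {0..1} (\<lambda>x. (1 - x) ^ n / fact n * (t ^ Suc n * u (Suc n) (x * t))) = u 0 t - (\<Sum>i<Suc n. t ^ i / fact i * u i 0)"
    by (auto dest!: integral_unique simp: Df_def)
  have S: "set_integrable lborel {0..1} (\<lambda>x. (1 - x) ^ n * u (Suc n) (x * t))"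
    by (rule borel_integrable_atLeastAtMost', intro continuous_intros continuous_on_compose2[OF uc])
      (use t in auto)
  have "t ^ (n + 1) / fact n * (LINT \<alpha> : {0..1} | lborel. (1 - \<alpha>) ^ n * u (Suc n) (\<alpha> * t)) =
     t ^ (n + 1) / fact n * integral {0..1} (\<lambda>\<alpha>. (1 - \<alpha>) ^ n * u (Suc n) (\<alpha> * t))"
    by (subst set_borel_integral_eq_integral(2)[OF S]) simp
  also have "\<dots> = integral {0..1} (\<lambda>x. (1 - x) ^ n / fact n * (t ^ Suc n * u (Suc n) (x * t)))"
    by (subst integral_mult_right[symmetric]) (simp add: field_simps)
  finally have R: "t ^ (n + 1) / fact n * (LINT \<alpha> : {0..1} | lborel. (1 - \<alpha>) ^ n * u (Suc n) (\<alpha> * t)) = u 0 t - (\<Sum>i<Suc n. t ^ i / fact i * u i 0)"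
    using I by simp
  have "u i 0 = (L ^^ i) f 0" for i unfolding u_def by (rule rho0[OF CbLk[OF f]])
  then show ?thesis using R by (simp add: u_def lessThan_Suc_atMost)
qed

end

section \<open>The generator as a combination of derivatives and averages\<close>

lemma smooth_compact_Cb:
  fixes f :: "real \<Rightarrow> real"
  assumes f: "smooth f" and supp: "\<And>x. r < \<bar>x\<bar> \<Longrightarrow> f x = 0"
  shows "Cb f" and "r < \<bar>x\<bar> \<Longrightarrow> (deriv ^^ k) f x = 0"
proof -
  have S: "open {x::real. r < \<bar>x\<bar>}" by (intro open_Collect_less continuous_intros)
  have 0: "r < \<bar>x\<bar> \<Longrightarrow> (deriv ^^ k) f x = 0" for k x
  proof (induction k arbitrary: x)
    case (Suc k)
    show ?case unfolding funpow.simps comp_def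
      by (rule deriv_const_on_open[OF S, where k=0]) (use Suc in auto)
  qed (simp add: supp)
  then show "r < \<bar>x\<bar> \<Longrightarrow> (deriv ^^ k) f x = 0" .
  have fd: "(deriv ^^ k) f field_differentiable at x" for k x
    using f[unfolded smooth_def times_differentiable_on_def, rule_format, of k "Suc k" x] by simp
  have "\<exists>B. \<forall>x. \<bar>(deriv ^^ k) f x\<bar> \<le> B" for k
  proof -
    have "continuous_on {-r..r} ((deriv ^^ k) f)"
      using field_differentiable_imp_continuous_at[OF fd] by (intro continuous_at_imp_continuous_on) auto
    then have "bounded ((deriv ^^ k) f ` {-r..r})"
      by (intro compact_imp_bounded compact_continuous_image) auto
    then obtain B where B: "\<forall>x\<in>{-r..r}. \<bar>(deriv ^^ k) f x\<bar> \<le> B"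
      unfolding bounded_iff by auto
    have "\<bar>(deriv ^^ k) f x\<bar> \<le> max B 0" for x
    proof (cases "r < \<bar>x\<bar>")
      case True then show ?thesis by (simp add: 0)
    next
      case False
      then have "x \<in> {-r..r}" by auto
      from B[rule_format, OF this] show ?thesis by simp
    qed
    then show ?thesis by blast
  qed
  then show "Cb f" using fd unfolding Cb_def by blast
qed

lemma fin_borel_density:
  fixes f :: "real \<Rightarrow> real"
  assumes "sets M = sets borel" "integrable M f" "\<And>x. 0 \<le> f x"
  shows "fin_borel (density M (\<lambda>x. ennreal (f x)))"
proof -
  have "space M = UNIV" using assms(1) sets_eq_imp_space_eq by fastforce
  moreover have "f \<in> borel_measurable M" using assms(2) by simp
  ultimately have "emeasure (density M (\<lambda>x. ennreal (f x))) UNIV = (\<integral>\<^sup>+x. ennreal (f x) \<partial>M)"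
    using assms(1) by (subst emeasure_density) auto
  also have "\<dots> = ennreal (\<integral>x. f x \<partial>M)" by (rule nn_integral_eq_integral) (use assms in auto)
  finally show ?thesis using assms(1) \<open>space M = UNIV\<close>
    by (auto simp: fin_borel_def intro!: finite_measureI)
qed

definition taylor_meas :: "real measure" where
  "taylor_meas = density lborel (\<lambda>\<beta>. ennreal ((1 - \<beta>) * indicator {0..1} \<beta>))"

definition big_meas :: "(real \<Rightarrow> real) \<Rightarrow> real measure \<Rightarrow> real measure" where
  "big_meas c \<nu> = density \<nu> (\<lambda>u. ennreal (1 - c u))"

definition small_meas :: "(real \<Rightarrow> real) \<Rightarrow> real measure \<Rightarrow> real measure" where
  "small_meas c \<nu> = density \<nu> (\<lambda>w. ennreal (c w * w\<^sup>2))"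

text \<open>Taylor's remainder evaluates the second derivative at x + \<beta> w. Pushing the pair
  (w, \<beta>) to its product turns the double integral into an average over a single shift.\<close>

definition small_push :: "(real \<Rightarrow> real) \<Rightarrow> real measure \<Rightarrow> real measure" where
  "small_push c \<nu> = distr (small_meas c \<nu> \<Otimes>\<^sub>M taylor_meas) borel (\<lambda>p. snd p * fst p)"

lemma taylor_weight_nonneg: "0 \<le> (1 - \<beta>) * indicat_real {0..1} \<beta>"
  by (auto simp: indicator_def)

lemma fin_taylor: "fin_borel taylor_meas"
  unfolding taylor_meas_def
proof (rule fin_borel_density)
  show "integrable lborel (\<lambda>\<beta>. (1 - \<beta>) * indicat_real {0..1} \<beta>)"
    using borel_integrable_atLeastAtMost'[of 0 1 "\<lambda>\<beta>::real. 1 - \<beta>"]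
    by (simp add: set_integrable_def continuous_intros mult.commute)
qed (auto simp: taylor_weight_nonneg)

lemma integral_taylor_meas:
  assumes "f \<in> borel_measurable borel"
  shows "(\<integral>\<beta>. f \<beta> \<partial>taylor_meas) = (LINT \<beta> : {0..1} | lborel. (1 - \<beta>) * f \<beta>)"
  unfolding taylor_meas_def set_lebesgue_integral_def
  by (subst integral_real_density) (use assms in \<open>auto simp: taylor_weight_nonneg mult_ac\<close>)

lemma taylor_integral:
  assumes g: "Cb g"
  shows "g (x + w) - g x - w * deriv g x = w\<^sup>2 * (\<integral>\<beta>. deriv (deriv g) (x + \<beta> * w) \<partial>taylor_meas)"
proof -
  let ?g2 = "deriv (deriv g)"
  have g2c: "continuous_on UNIV ?g2" using Cb_isCont[OF Cb_deriv[OF Cb_deriv[OF g]]] by (simp add: continuous_at_imp_continuous_on)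
  define Df where "Df i \<beta> = w ^ i * (deriv ^^ i) g (x + \<beta> * w)" for i \<beta>
  have D: "(Df i has_vector_derivative Df (Suc i) \<beta>) (at \<beta> within {0..1})" for i \<beta>
  proof -
    have "((\<lambda>\<beta>. (deriv ^^ i) g (x + \<beta> * w)) has_real_derivative (deriv ^^ Suc i) g (x + \<beta> * w) * w) (at \<beta> within {0..1})"
      by (rule DERIV_chain2[OF Cb_DERIV[OF g]]) (auto intro!: derivative_eq_intros)
    from DERIV_cmult[OF this, of "w ^ i"] show ?thesis
      unfolding Df_def has_real_derivative_iff_has_vector_derivative[symmetric] by (simp add: mult_ac)
  qed
  have "((\<lambda>\<beta>. ((1 - \<beta>) ^ (2 - 1) / fact (2 - 1)) *\<^sub>R Df 2 \<beta>) has_integral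
      Df 0 1 - (\<Sum>i<2. ((1 - 0) ^ i / fact i) *\<^sub>R Df i 0)) {0..1}"
    by (rule Taylor_has_integral[where Df=Df]) (use D in auto)
  then have I: "integral {0..1} (\<lambda>\<beta>. w\<^sup>2 * ((1 - \<beta>) * ?g2 (x + \<beta> * w))) = g (x + w) - g x - w * deriv g x"
    by (auto dest!: integral_unique simp: Df_def numeral_2_eq_2 mult_ac)
  have S: "set_integrable lborel {0..1} (\<lambda>\<beta>. (1 - \<beta>) * ?g2 (x + \<beta> * w))"
    by (intro borel_integrable_atLeastAtMost' continuous_intros continuous_on_compose2[OF g2c]) auto
  have "(\<lambda>\<beta>. ?g2 (x + \<beta> * w)) \<in> borel_measurable borel"
    using Cb_measurable[OF Cb_deriv[OF Cb_deriv[OF g]]] by measurable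
  then show ?thesis using I
    by (simp add: integral_taylor_meas set_borel_integral_eq_integral(2)[OF S])
qed

section \<open>The generator split by the truncation function\<close>

locale trunc_levy =
  fixes \<nu> :: "real measure" and c :: "real \<Rightarrow> real" and \<epsilon> :: real
  assumes \<nu>: "levy_measure \<nu>" and sf: "sigma_finite_measure \<nu>" and tr: "truncation \<epsilon> c" and \<epsilon>: "0 < \<epsilon>" "\<epsilon> < 1"
begin

lemma c_bounds: "0 \<le> c x" "c x \<le> 1" "\<bar>x\<bar> \<le> \<epsilon> / 2 \<Longrightarrow> c x = 1" "\<epsilon> < \<bar>x\<bar> \<Longrightarrow> c x = 0"
proof -
  have *: "indicator {-\<epsilon>/2..\<epsilon>/2} x \<le> c x" "c x \<le> indicator {-\<epsilon>..\<epsilon>} x"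
    using tr by (auto simp: truncation_def)
  show ge: "0 \<le> c x" using *(1) by (rule order_trans[rotated]) simp
  show le: "c x \<le> 1" by (rule order_trans[OF *(2)]) (simp add: indicator_def)
  show "c x = 1" if "\<bar>x\<bar> \<le> \<epsilon> / 2"
  proof -
    have "x \<in> {-\<epsilon>/2..\<epsilon>/2}" using that by auto
    then show ?thesis using *(1) le by simp
  qed
  show "c x = 0" if "\<epsilon> < \<bar>x\<bar>"
  proof -
    have "x \<notin> {-\<epsilon>..\<epsilon>}" using that by auto
    then show ?thesis using *(2) ge by simp
  qed
qed

lemma Cb_c: "Cb c"
  by (rule smooth_compact_Cb(1)[where r=\<epsilon>]) (use tr c_bounds in \<open>auto simp: truncation_def\<close>)

lemma cm[measurable]: "c \<in> borel_measurable borel"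
  by (rule Cb_measurable[OF Cb_c])

lemma sn: "sets \<nu> = sets borel" by (rule levy_measureD(1)[OF \<nu>])

text \<open>Both \<open>u\<^sup>2\<close> and 1 are at least \<open>\<epsilon>\<^sup>2 / 4\<close>,
  whose reciprocal is the constant.\<close>

lemma away_bound: "\<epsilon> / 2 < \<bar>u\<bar> \<Longrightarrow> 1 \<le> 4 / \<epsilon>\<^sup>2 * min 1 (u\<^sup>2)"
proof -
  assume "\<epsilon> / 2 < \<bar>u\<bar>"
  then have "\<epsilon>\<^sup>2 \<le> 4 * u\<^sup>2" using power_mono[of "\<epsilon> / 2" "\<bar>u\<bar>" 2] \<epsilon> by (simp add: power_divide)
  moreover have "\<epsilon>\<^sup>2 \<le> 4" using power_mono[of \<epsilon> 1 2] \<epsilon> by simp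
  ultimately have "\<epsilon>\<^sup>2 \<le> 4 * min 1 (u\<^sup>2)" by (simp add: min_def)
  then show ?thesis using \<epsilon> by (simp add: pos_le_divide_eq)
qed

lemma big_bound: "1 - c u \<le> 4 / \<epsilon>\<^sup>2 * min 1 (u\<^sup>2)"
proof (cases "\<bar>u\<bar> \<le> \<epsilon> / 2")
  case True then show ?thesis using \<epsilon> by (simp add: c_bounds)
next
  case False
  then have "1 \<le> 4 / \<epsilon>\<^sup>2 * min 1 (u\<^sup>2)" by (intro away_bound) simp
  then show ?thesis using c_bounds(1)[of u] by linarith
qed

lemma small_bound: "c u * u\<^sup>2 \<le> min 1 (u\<^sup>2)"
proof (cases "\<epsilon> < \<bar>u\<bar>")
  case True then show ?thesis by (simp add: c_bounds)
next
  case False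
  then have "u\<^sup>2 \<le> 1" using \<epsilon> abs_square_le_1[of u] by simp
  moreover have "c u * u\<^sup>2 \<le> 1 * u\<^sup>2" by (intro mult_right_mono c_bounds) simp
  ultimately show ?thesis by simp
qed

lemma big_integrable: "integrable \<nu> (\<lambda>u. 1 - c u)"
  by (rule levy_measure_integrable[OF \<nu>, where K="4 / \<epsilon>\<^sup>2"]) (use big_bound c_bounds(2) in \<open>auto simp: abs_of_nonneg\<close>)

lemma small_integrable: "integrable \<nu> (\<lambda>w. c w * w\<^sup>2)"
  by (rule levy_measure_integrable[OF \<nu>, where K=1]) (use small_bound c_bounds(1) in \<open>auto simp: abs_mult\<close>)

text \<open>The factor \<open>w\<^sup>2 (1 - \<beta>) d\<beta>\<close> in \<open>V\<close> comes from the Taylor expansion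
  \<open>g (x + w) - g x - w g' x = w\<^sup>2 \<integral>(1 - \<beta>) g'' (x + \<beta> w) d\<beta>\<close> of the integrand of the generator.\<close>

abbreviation U where "U \<equiv> big_meas c \<nu>"
abbreviation V where "V \<equiv> small_push c \<nu>"

lemma fin_U: "fin_borel U"
  unfolding big_meas_def by (rule fin_borel_density[OF sn big_integrable]) (simp add: c_bounds)

lemma fin_small: "fin_borel (small_meas c \<nu>)"
  unfolding small_meas_def by (rule fin_borel_density[OF sn small_integrable]) (simp add: c_bounds)

lemma fin_V: "fin_borel V"
proof -
  interpret S: finite_measure "small_meas c \<nu>" using fin_borelD(1)[OF fin_small] .
  interpret T: finite_measure taylor_meas using fin_borelD(1)[OF fin_taylor] .
  interpret P: finite_measure "small_meas c \<nu> \<Otimes>\<^sub>M taylor_meas" by (rule finite_measure_pair_measure) unfold_locales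
  have [measurable_cong]: "sets (small_meas c \<nu>) = sets borel" "sets taylor_meas = sets borel"
    using fin_borelD(2) fin_small fin_taylor by auto
  show ?thesis unfolding fin_borel_def small_push_def by (intro conjI P.finite_measure_distr) auto
qed

lemma integral_V:
  assumes g: "g \<in> borel_measurable borel" "\<And>x. \<bar>g x\<bar> \<le> K"
  shows "(\<integral>v. g v \<partial>V) = (\<integral>w. (c w * w\<^sup>2) * (\<integral>\<beta>. g (\<beta> * w) \<partial>taylor_meas) \<partial>\<nu>)"
    and "(\<lambda>w. \<integral>\<beta>. g (\<beta> * w) \<partial>taylor_meas) \<in> borel_measurable borel"
    and "\<bar>\<integral>\<beta>. g (\<beta> * w) \<partial>taylor_meas\<bar> \<le> measure taylor_meas UNIV * K"
proof -
  interpret S: finite_measure "small_meas c \<nu>" using fin_borelD(1)[OF fin_small] .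
  interpret T: finite_measure taylor_meas using fin_borelD(1)[OF fin_taylor] .
  interpret PS: pair_sigma_finite "small_meas c \<nu>" taylor_meas ..
  interpret P: finite_measure "small_meas c \<nu> \<Otimes>\<^sub>M taylor_meas" by (rule finite_measure_pair_measure) unfold_locales
  have [measurable_cong]: "sets (small_meas c \<nu>) = sets borel" "sets taylor_meas = sets borel"
    using fin_borelD(2) fin_small fin_taylor by auto
  note g(1)[measurable] note [measurable_cong] = sn
  have K: "0 \<le> K" using g(2)[of 0] by linarith
  show m: "(\<lambda>w. \<integral>\<beta>. g (\<beta> * w) \<partial>taylor_meas) \<in> borel_measurable borel" by measurable
  have "(\<integral>v. g v \<partial>V) = (\<integral>p. g (snd p * fst p) \<partial>(small_meas c \<nu> \<Otimes>\<^sub>M taylor_meas))"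
    unfolding small_push_def by (subst integral_distr) auto
  also have "\<dots> = (\<integral>w. \<integral>\<beta>. g (\<beta> * w) \<partial>taylor_meas \<partial>small_meas c \<nu>)"
    by (subst PS.integral_fst'[symmetric]) (auto intro!: P.integrable_const_bound[of _ K] g)
  also have "\<dots> = (\<integral>w. (c w * w\<^sup>2) * (\<integral>\<beta>. g (\<beta> * w) \<partial>taylor_meas) \<partial>\<nu>)"
    unfolding small_meas_def by (subst integral_real_density) (use m c_bounds(1) in auto)
  finally show "(\<integral>v. g v \<partial>V) = (\<integral>w. (c w * w\<^sup>2) * (\<integral>\<beta>. g (\<beta> * w) \<partial>taylor_meas) \<partial>\<nu>)" .
  have "\<bar>\<integral>\<beta>. g (\<beta> * w) \<partial>taylor_meas\<bar> \<le> (\<integral>\<beta>. K \<partial>taylor_meas)"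
    using K g(2) by (intro integral_abs_bound_integral fin_borel_integrable[OF fin_taylor, where B=K]) auto
  then show "\<bar>\<integral>\<beta>. g (\<beta> * w) \<partial>taylor_meas\<bar> \<le> measure taylor_meas UNIV * K"
    using fin_borelD(3)[OF fin_taylor] by (simp add: mult.commute)
qed

text \<open>The integrand is split with weights c and 1 - c. Only the part near 0 keeps the
  first-order compensation, where Taylor's formula applies; away from 0 the value, the constant and
  the drift correction are separately integrable.\<close>

lemma levy_gen_Lop:
  assumes g: "Cb g"
  shows "levy_gen \<sigma> b \<nu> g = Lop (b0 c \<nu>) (b1 c b \<nu>) (b2 \<sigma>) U V g"
proof
  fix x
  note [measurable_cong] = sn
  let ?g1 = "deriv g" and ?g2 = "deriv (deriv g)"
  obtain K where K: "0 \<le> K" "\<And>x. \<bar>g x\<bar> \<le> K" using Cb_bound0[OF g] by blast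
  obtain K2 where K2: "0 \<le> K2" "\<And>x. \<bar>?g2 x\<bar> \<le> K2" using Cb_bound0[OF Cb_deriv[OF Cb_deriv[OF g]]] by blast
  note gm[measurable] = Cb_measurable[OF g] and g2m[measurable] = Cb_measurable[OF Cb_deriv[OF Cb_deriv[OF g]]]
  have xm: "(\<lambda>v. ?g2 (x + v)) \<in> borel_measurable borel" by measurable
  define R where "R w = (\<integral>\<beta>. ?g2 (x + \<beta> * w) \<partial>taylor_meas)" for w
  have Rm[measurable]: "R \<in> borel_measurable borel" and Rb: "\<bar>R w\<bar> \<le> measure taylor_meas UNIV * K2" for w
    unfolding R_def using integral_V(2,3)[OF xm K2(2)] by auto
  have i1: "integrable \<nu> (\<lambda>w. c w * w\<^sup>2 * R w)"
  proof (rule levy_measure_integrable[OF \<nu>, where K="measure taylor_meas UNIV * K2"])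
    fix w
    have "norm (c w * w\<^sup>2 * R w) = (c w * w\<^sup>2) * \<bar>R w\<bar>" using c_bounds(1) by (simp add: abs_mult)
    also have "\<dots> \<le> min 1 (w\<^sup>2) * (measure taylor_meas UNIV * K2)"
      using c_bounds(1) by (intro mult_mono small_bound Rb) auto
    finally show "norm (c w * w\<^sup>2 * R w) \<le> measure taylor_meas UNIV * K2 * min 1 (w\<^sup>2)" by (simp add: mult.commute)
  qed measurable
  have i2: "integrable \<nu> (\<lambda>u. (1 - c u) * g (x + u))"
  proof (rule Bochner_Integration.integrable_bound[OF integrable_mult_left[OF big_integrable, of K]])
    show "AE u in \<nu>. norm ((1 - c u) * g (x + u)) \<le> norm ((1 - c u) * K)"
      using K c_bounds(2) by (auto simp: abs_mult intro!: mult_left_mono AE_I2)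
  qed measurable
  \<comment> \<open>The indicator and c agree up to \<epsilon> / 2 and beyond 1; in between the
    integrand is at most 1, on a set away from the origin.\<close>
  have i4: "integrable \<nu> (\<lambda>u. u * (indicat_real {-1..1} u - c u))"
  proof (rule levy_measure_integrable[OF \<nu>, where K="4 / \<epsilon>\<^sup>2"])
    fix u :: real
    consider "\<bar>u\<bar> \<le> \<epsilon> / 2" | "\<epsilon> / 2 < \<bar>u\<bar>" "\<bar>u\<bar> \<le> 1" | "1 < \<bar>u\<bar>" by linarith
    then show "norm (u * (indicat_real {-1..1} u - c u)) \<le> 4 / \<epsilon>\<^sup>2 * min 1 (u\<^sup>2)"
    proof cases
      case 1 then show ?thesis using \<epsilon> by (auto simp: c_bounds indicator_def)
    next
      case 2
      have "norm (u * (indicat_real {-1..1} u - c u)) \<le> 1 * 1"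
        unfolding real_norm_def abs_mult using 2 c_bounds(1,2)[of u] by (intro mult_mono) (auto simp: indicator_def)
      also have "\<dots> \<le> 4 / \<epsilon>\<^sup>2 * min 1 (u\<^sup>2)" using away_bound[OF 2(1)] by simp
      finally show ?thesis .
    next
      case 3 then show ?thesis using \<epsilon> by (auto simp: c_bounds indicator_def)
    qed
  qed measurable
  have split: "g (u + x) - g x - u * ?g1 x * indicator {-1..1} u =
      c u * u\<^sup>2 * R u + (1 - c u) * g (x + u) - (1 - c u) * g x - u * (indicat_real {-1..1} u - c u) * ?g1 x" for u
  proof -
    have "c u * u\<^sup>2 * R u = c u * (g (x + u) - g x - u * ?g1 x)"
      unfolding R_def taylor_integral[OF g] by simp
    then show ?thesis by (simp add: algebra_simps)
  qed
  have "(\<integral>u. (g (u + x) - g x - u * ?g1 x * indicator {-1..1} u) \<partial>\<nu>) =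
      (\<integral>u. c u * u\<^sup>2 * R u \<partial>\<nu>) + (\<integral>u. (1 - c u) * g (x + u) \<partial>\<nu>) - (\<integral>u. (1 - c u) * g x \<partial>\<nu>)
      - (\<integral>u. u * (indicat_real {-1..1} u - c u) * ?g1 x \<partial>\<nu>)"
    unfolding split using i1 i2 i4 big_integrable
    by (subst Bochner_Integration.integral_diff Bochner_Integration.integral_add, auto)+
  also have "(\<integral>u. c u * u\<^sup>2 * R u \<partial>\<nu>) = avg V ?g2 x"
    unfolding avg_def R_def using integral_V(1)[OF xm K2(2)] by simp
  also have "(\<integral>u. (1 - c u) * g (x + u) \<partial>\<nu>) = avg U g x"
    unfolding avg_def big_meas_def by (subst integral_real_density) (auto simp: c_bounds)
  also have "(\<integral>u. (1 - c u) * g x \<partial>\<nu>) = - b0 c \<nu> * g x" by (simp add: b0_def)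
  also have "(\<integral>u. u * (indicat_real {-1..1} u - c u) * ?g1 x \<partial>\<nu>) = (b - b1 c b \<nu>) * ?g1 x"
    by (simp add: b1_def)
  finally show "levy_gen \<sigma> b \<nu> g x = Lop (b0 c \<nu>) (b1 c b \<nu>) (b2 \<sigma>) U V g x"
    unfolding levy_gen_def Lop_def b2_def by (simp add: numeral_2_eq_2 algebra_simps)
qed

text \<open>Complex waves are eigenfunctions of the generator with eigenvalue \<open>psi\<close>;
  this is the real part of that relation, with a phase.\<close>

lemma levy_gen_cos:
  "levy_gen \<sigma> b \<nu> (\<lambda>x. cos (\<xi> * x + \<theta>)) x = Re (psi \<sigma> b \<nu> \<xi> * iexp (\<xi> * x + \<theta>))"
proof -
  let ?g = "\<lambda>x. cos (\<xi> * x + \<theta>)"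
  let ?y = "\<xi> * x + \<theta>"
  have d1: "deriv ?g x = - \<xi> * sin ?y"
    using fun_cong[OF Cb_cos(2)[of 1 \<xi> \<theta>], of x] by (simp add: cos_add sin_add algebra_simps)
  have d2: "(deriv ^^ 2) ?g x = - \<xi>\<^sup>2 * cos ?y"
    using fun_cong[OF Cb_cos(2)[of 2 \<xi> \<theta>], of x] by simp
  have pi: "integrable \<nu> (psi_fun \<xi>)"
    by (rule levy_measure_integrable[OF \<nu> _ psi_fun_bound]) measurable
  have "?g (u + x) - ?g x - u * deriv ?g x * indicator {-1..1} u = Re (psi_fun \<xi> u * iexp ?y)" for u
  proof -
    have gen: "cos (\<xi> * u + y) - cos y + u * \<xi> * sin y * indicator {-1..1} u = Re (psi_fun \<xi> u * iexp y)" for y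
      by (simp add: psi_fun_def Re_exp Im_exp cos_add algebra_simps indicator_def)
    have "cos (\<xi> * (u + x) + \<theta>) = cos (\<xi> * u + ?y)" by (simp add: algebra_simps)
    then show ?thesis unfolding d1 using gen[of ?y] by (simp add: mult_ac)
  qed
  then have "(\<integral>u. (?g (u + x) - ?g x - u * deriv ?g x * indicator {-1..1} u) \<partial>\<nu>) = (\<integral>u. Re (psi_fun \<xi> u * iexp ?y) \<partial>\<nu>)" by simp
  also have "\<dots> = Re (\<integral>u. psi_fun \<xi> u * iexp ?y \<partial>\<nu>)" by (rule integral_Re) (intro integrable_mult_left pi)
  also have "(\<integral>u. psi_fun \<xi> u * iexp ?y \<partial>\<nu>) = (\<integral>u. psi_fun \<xi> u \<partial>\<nu>) * iexp ?y" by (rule integral_mult_left_zero)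
  finally show ?thesis
    unfolding levy_gen_def d1 d2 psi_def by (simp add: Re_exp Im_exp algebra_simps power2_eq_square)
qed

end

section \<open>Powers of the generator\<close>

fun inc0 :: "multi \<Rightarrow> multi" where "inc0 (k0, k1, k2, k3, k4) = (Suc k0, k1, k2, k3, k4)"
fun inc1 :: "multi \<Rightarrow> multi" where "inc1 (k0, k1, k2, k3, k4) = (k0, Suc k1, k2, k3, k4)"
fun inc2 :: "multi \<Rightarrow> multi" where "inc2 (k0, k1, k2, k3, k4) = (k0, k1, Suc k2, k3, k4)"
fun inc3 :: "multi \<Rightarrow> multi" where "inc3 (k0, k1, k2, k3, k4) = (k0, k1, k2, Suc k3, k4)"
fun inc4 :: "multi \<Rightarrow> multi" where "inc4 (k0, k1, k2, k3, k4) = (k0, k1, k2, k3, Suc k4)"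

lemma finite_multis: "finite (multis k)"
  by (rule finite_subset[of _ "{..k} \<times> {..k} \<times> {..k} \<times> {..k} \<times> {..k}"]) (auto simp: multis_def)

text \<open>\<open>I\<close> raises the component \<open>p\<close> of a multi-index by one.\<close>

lemma multinom_shift:
  fixes G :: "multi \<Rightarrow> real" and p :: "multi \<Rightarrow> nat"
  assumes inj: "inj_on I (multis k)" and img: "I ` multis k = {kk \<in> multis (Suc k). 0 < p kk}"
    and m: "\<And>kk. kk \<in> multis k \<Longrightarrow> multinom kk = p (I kk) * multinom (I kk) / Suc k"
  shows "(\<Sum>kk\<in>multis k. multinom kk * G (I kk)) = (\<Sum>kk\<in>multis (Suc k). p kk * multinom kk / Suc k * G kk)"
proof -
  have "(\<Sum>kk\<in>multis k. multinom kk * G (I kk)) = (\<Sum>kk\<in>multis k. ((\<lambda>kk. p kk * multinom kk / Suc k * G kk) \<circ> I) kk)"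
    by (rule sum.cong) (auto simp: m)
  also have "\<dots> = (\<Sum>kk\<in>{kk \<in> multis (Suc k). 0 < p kk}. p kk * multinom kk / Suc k * G kk)"
    unfolding img[symmetric] by (rule sum.reindex[OF inj, symmetric])
  also have "\<dots> = (\<Sum>kk\<in>multis (Suc k). p kk * multinom kk / Suc k * G kk)"
    by (rule sum.mono_neutral_left) (auto simp: finite_multis)
  finally show ?thesis .
qed

lemma multinom_inc:
  fixes k0 k1 k2 k3 k4 :: nat
  defines "S \<equiv> real (Suc (k0 + k1 + k2 + k3 + k4))"
  shows "multinom (k0, k1, k2, k3, k4) = real (Suc k0) * multinom (Suc k0, k1, k2, k3, k4) / S"
    and "multinom (k0, k1, k2, k3, k4) = real (Suc k1) * multinom (k0, Suc k1, k2, k3, k4) / S"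
    and "multinom (k0, k1, k2, k3, k4) = real (Suc k2) * multinom (k0, k1, Suc k2, k3, k4) / S"
    and "multinom (k0, k1, k2, k3, k4) = real (Suc k3) * multinom (k0, k1, k2, Suc k3, k4) / S"
    and "multinom (k0, k1, k2, k3, k4) = real (Suc k4) * multinom (k0, k1, k2, k3, Suc k4) / S"
proof -
  let ?F = "fact (k0 + k1 + k2 + k3 + k4) :: real"
  let ?D = "fact k0 * fact k1 * fact k2 * fact k3 * fact k4 :: real"
  have g: "F / D = y * ((S * F) / E) / S" if "E = y * D" "y \<noteq> 0" for F D E y
    using that by (simp add: S_def del: of_nat_Suc)
  have F: "S * ?F = fact (Suc (k0 + k1 + k2 + k3 + k4))" by (simp add: S_def)
  note g' = g[of _ _ ?D ?F, unfolded F]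
  show "multinom (k0, k1, k2, k3, k4) = real (Suc k0) * multinom (Suc k0, k1, k2, k3, k4) / S"
    using g'[of "fact (Suc k0) * fact k1 * fact k2 * fact k3 * fact k4" "real (Suc k0)"] by (simp del: of_nat_Suc)
  show "multinom (k0, k1, k2, k3, k4) = real (Suc k1) * multinom (k0, Suc k1, k2, k3, k4) / S"
    using g'[of "fact k0 * fact (Suc k1) * fact k2 * fact k3 * fact k4" "real (Suc k1)"] by (simp del: of_nat_Suc add: mult.left_commute)
  show "multinom (k0, k1, k2, k3, k4) = real (Suc k2) * multinom (k0, k1, Suc k2, k3, k4) / S"
    using g'[of "fact k0 * fact k1 * fact (Suc k2) * fact k3 * fact k4" "real (Suc k2)"] by (simp del: of_nat_Suc add: mult.left_commute)
  show "multinom (k0, k1, k2, k3, k4) = real (Suc k3) * multinom (k0, k1, k2, Suc k3, k4) / S"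
    using g'[of "fact k0 * fact k1 * fact k2 * fact (Suc k3) * fact k4" "real (Suc k3)"] by (simp del: of_nat_Suc add: mult.left_commute)
  show "multinom (k0, k1, k2, k3, k4) = real (Suc k4) * multinom (k0, k1, k2, k3, Suc k4) / S"
    using g'[of "fact k0 * fact k1 * fact k2 * fact k3 * fact (Suc k4)" "real (Suc k4)"] by (simp del: of_nat_Suc add: mult.left_commute)
qed

text \<open>Each of the five shifted sums is the sum over the next level with the weight k_i / (k +
  1), and these weights add up to 1 at every multi-index of size k + 1.\<close>

lemma multinom_step:
  "(\<Sum>kk\<in>multis (Suc k). multinom kk * G kk) =
   (\<Sum>kk\<in>multis k. multinom kk * (G (inc0 kk) + G (inc1 kk) + G (inc2 kk) + G (inc3 kk) + G (inc4 kk)))"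
proof -
  let ?p0 = "\<lambda>(k0, k1, k2, k3, k4). k0 :: nat" and ?p1 = "\<lambda>(k0, k1, k2, k3, k4). k1 :: nat"
    and ?p2 = "\<lambda>(k0, k1, k2, k3, k4). k2 :: nat" and ?p3 = "\<lambda>(k0, k1, k2, k3, k4). k3 :: nat"
    and ?p4 = "\<lambda>(k0, k1, k2, k3, k4). k4 :: nat"
  have s0: "(\<Sum>kk\<in>multis k. multinom kk * G (inc0 kk)) = (\<Sum>kk\<in>multis (Suc k). ?p0 kk * multinom kk / Suc k * G kk)"
  proof (rule multinom_shift)
    show "inc0 ` multis k = {kk \<in> multis (Suc k). 0 < ?p0 kk}"
    proof safe
      fix a b c d e assume "(a, b, c, d, e) \<in> multis (Suc k)" "0 < a"
      then show "(a, b, c, d, e) \<in> inc0 ` multis k" by (intro image_eqI[of _ _ "(a - 1, b, c, d, e)"]) (auto simp: multis_def)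
    qed (auto simp: multis_def)
  next
    fix kk assume "kk \<in> multis k"
    then obtain a b c d e where kk: "kk = (a, b, c, d, e)" "k = a + b + c + d + e" by (auto simp: multis_def)
    show "multinom kk = ?p0 (inc0 kk) * multinom (inc0 kk) / Suc k"
      unfolding kk inc0.simps prod.case by (rule multinom_inc(1))
  qed (auto simp: inj_on_def)
  have s1: "(\<Sum>kk\<in>multis k. multinom kk * G (inc1 kk)) = (\<Sum>kk\<in>multis (Suc k). ?p1 kk * multinom kk / Suc k * G kk)"
  proof (rule multinom_shift)
    show "inc1 ` multis k = {kk \<in> multis (Suc k). 0 < ?p1 kk}"
    proof safe
      fix a b c d e assume "(a, b, c, d, e) \<in> multis (Suc k)" "0 < b"
      then show "(a, b, c, d, e) \<in> inc1 ` multis k" by (intro image_eqI[of _ _ "(a, b - 1, c, d, e)"]) (auto simp: multis_def)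
    qed (auto simp: multis_def)
  next
    fix kk assume "kk \<in> multis k"
    then obtain a b c d e where kk: "kk = (a, b, c, d, e)" "k = a + b + c + d + e" by (auto simp: multis_def)
    show "multinom kk = ?p1 (inc1 kk) * multinom (inc1 kk) / Suc k"
      unfolding kk inc1.simps prod.case by (rule multinom_inc(2))
  qed (auto simp: inj_on_def)
  have s2: "(\<Sum>kk\<in>multis k. multinom kk * G (inc2 kk)) = (\<Sum>kk\<in>multis (Suc k). ?p2 kk * multinom kk / Suc k * G kk)"
  proof (rule multinom_shift)
    show "inc2 ` multis k = {kk \<in> multis (Suc k). 0 < ?p2 kk}"
    proof safe
      fix a b c d e assume "(a, b, c, d, e) \<in> multis (Suc k)" "0 < c"
      then show "(a, b, c, d, e) \<in> inc2 ` multis k" by (intro image_eqI[of _ _ "(a, b, c - 1, d, e)"]) (auto simp: multis_def)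
    qed (auto simp: multis_def)
  next
    fix kk assume "kk \<in> multis k"
    then obtain a b c d e where kk: "kk = (a, b, c, d, e)" "k = a + b + c + d + e" by (auto simp: multis_def)
    show "multinom kk = ?p2 (inc2 kk) * multinom (inc2 kk) / Suc k"
      unfolding kk inc2.simps prod.case by (rule multinom_inc(3))
  qed (auto simp: inj_on_def)
  have s3: "(\<Sum>kk\<in>multis k. multinom kk * G (inc3 kk)) = (\<Sum>kk\<in>multis (Suc k). ?p3 kk * multinom kk / Suc k * G kk)"
  proof (rule multinom_shift)
    show "inc3 ` multis k = {kk \<in> multis (Suc k). 0 < ?p3 kk}"
    proof safe
      fix a b c d e assume "(a, b, c, d, e) \<in> multis (Suc k)" "0 < d"
      then show "(a, b, c, d, e) \<in> inc3 ` multis k" by (intro image_eqI[of _ _ "(a, b, c, d - 1, e)"]) (auto simp: multis_def)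
    qed (auto simp: multis_def)
  next
    fix kk assume "kk \<in> multis k"
    then obtain a b c d e where kk: "kk = (a, b, c, d, e)" "k = a + b + c + d + e" by (auto simp: multis_def)
    show "multinom kk = ?p3 (inc3 kk) * multinom (inc3 kk) / Suc k"
      unfolding kk inc3.simps prod.case by (rule multinom_inc(4))
  qed (auto simp: inj_on_def)
  have s4: "(\<Sum>kk\<in>multis k. multinom kk * G (inc4 kk)) = (\<Sum>kk\<in>multis (Suc k). ?p4 kk * multinom kk / Suc k * G kk)"
  proof (rule multinom_shift)
    show "inc4 ` multis k = {kk \<in> multis (Suc k). 0 < ?p4 kk}"
    proof safe
      fix a b c d e assume "(a, b, c, d, e) \<in> multis (Suc k)" "0 < e"
      then show "(a, b, c, d, e) \<in> inc4 ` multis k" by (intro image_eqI[of _ _ "(a, b, c, d, e - 1)"]) (auto simp: multis_def)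
    qed (auto simp: multis_def)
  next
    fix kk assume "kk \<in> multis k"
    then obtain a b c d e where kk: "kk = (a, b, c, d, e)" "k = a + b + c + d + e" by (auto simp: multis_def)
    show "multinom kk = ?p4 (inc4 kk) * multinom (inc4 kk) / Suc k"
      unfolding kk inc4.simps prod.case by (rule multinom_inc(5))
  qed (auto simp: inj_on_def)
  have "(\<Sum>kk\<in>multis k. multinom kk * (G (inc0 kk) + G (inc1 kk) + G (inc2 kk) + G (inc3 kk) + G (inc4 kk))) =
     (\<Sum>kk\<in>multis (Suc k). ?p0 kk * multinom kk / Suc k * G kk + ?p1 kk * multinom kk / Suc k * G kk + ?p2 kk * multinom kk / Suc k * G kk
       + ?p3 kk * multinom kk / Suc k * G kk + ?p4 kk * multinom kk / Suc k * G kk)"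
    by (simp only: distrib_left sum.distrib s0 s1 s2 s3 s4)
  also have "\<dots> = (\<Sum>kk\<in>multis (Suc k). multinom kk * G kk)"
  proof (rule sum.cong[OF refl])
    fix kk assume kk: "kk \<in> multis (Suc k)"
    have "?p0 kk + ?p1 kk + ?p2 kk + ?p3 kk + ?p4 kk = Suc k" using kk by (auto simp: multis_def)
    then have s: "real (?p0 kk) + real (?p1 kk) + real (?p2 kk) + real (?p3 kk) + real (?p4 kk) = real (Suc k)"
      by (simp only: of_nat_add[symmetric])
    have "?p0 kk * multinom kk / Suc k * G kk + ?p1 kk * multinom kk / Suc k * G kk + ?p2 kk * multinom kk / Suc k * G kk
       + ?p3 kk * multinom kk / Suc k * G kk + ?p4 kk * multinom kk / Suc k * G kk =
      (real (?p0 kk) + real (?p1 kk) + real (?p2 kk) + real (?p3 kk) + real (?p4 kk)) * (multinom kk * G kk / Suc k)"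
      by (simp only: distrib_right times_divide_eq_left times_divide_eq_right mult.assoc add_divide_distrib)
    then show "?p0 kk * multinom kk / Suc k * G kk + ?p1 kk * multinom kk / Suc k * G kk + ?p2 kk * multinom kk / Suc k * G kk
       + ?p3 kk * multinom kk / Suc k * G kk + ?p4 kk * multinom kk / Suc k * G kk = multinom kk * G kk"
      unfolding s by simp
  qed
  finally show ?thesis by simp
qed

section \<open>The terms of the multinomial expansion\<close>

definition conv_mix :: "real measure \<Rightarrow> real measure \<Rightarrow> nat \<Rightarrow> nat \<Rightarrow> real measure" where
  "conv_mix A B k l = (conv_pow A k \<star> conv_pow B l)"

text \<open>A product of powers of the five commuting operators, applied to f: all derivatives are
  gathered into \<open>ell\<close> of them, two for each power of \<open>\<beta>2\<close> and of B,
  and all averages into one convolution.\<close>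

fun Lterm :: "real \<Rightarrow> real \<Rightarrow> real \<Rightarrow> real measure \<Rightarrow> real measure \<Rightarrow> (real \<Rightarrow> real) \<Rightarrow> multi \<Rightarrow> real \<Rightarrow> real" where
  "Lterm \<beta>0 \<beta>1 \<beta>2 A B f (k0, k1, k2, k3, k4) = (\<lambda>x. \<beta>0 ^ k0 * \<beta>1 ^ k1 * \<beta>2 ^ k2 *
     avg (conv_mix A B k3 k4) ((deriv ^^ ell (k0, k1, k2, k3, k4)) f) x)"

lemma fin_conv_mix: "fin_borel A \<Longrightarrow> fin_borel B \<Longrightarrow> fin_borel (conv_mix A B k l)"
  unfolding conv_mix_def by (intro fin_borel_convolution fin_borel_conv_pow)

lemma conv_mix_Suc1:
  assumes "fin_borel A" "fin_borel B"
  shows "(A \<star> conv_mix A B k l) = conv_mix A B (Suc k) l"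
  unfolding conv_mix_def by (simp add: conv_assoc assms fin_borel_conv_pow)

lemma conv_mix_Suc2:
  assumes AB: "fin_borel A" "fin_borel B"
  shows "(B \<star> conv_mix A B k l) = conv_mix A B k (Suc l)"
proof -
  have "(B \<star> conv_mix A B k l) = ((B \<star> conv_pow A k) \<star> conv_pow B l)"
    unfolding conv_mix_def by (intro conv_assoc AB fin_borel_conv_pow)
  also have "(B \<star> conv_pow A k) = (conv_pow A k \<star> B)"
    by (intro conv_commute AB fin_borel_conv_pow)
  also have "((conv_pow A k \<star> B) \<star> conv_pow B l) = conv_mix A B k (Suc l)"
    unfolding conv_mix_def conv_pow.simps by (intro conv_assoc[symmetric] AB fin_borel_conv_pow)
  finally show ?thesis .
qed

context
  fixes A B :: "real measure" and \<beta>0 \<beta>1 \<beta>2 :: real and f :: "real \<Rightarrow> real"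
  assumes AB: "fin_borel A" "fin_borel B" and f: "Cb f"
begin

lemma Cb_Lterm: "Cb (Lterm \<beta>0 \<beta>1 \<beta>2 A B f kk)"
  by (cases kk rule: prod_cases5) (simp add: Cb_cmult Cb_avg fin_conv_mix AB Cb_derivs f del: ell.simps)

text \<open>Each summand of the operator raises exactly one exponent, because derivatives pass under
  averages and averages merge by convolution.\<close>

lemma Lop_Lterm:
  "Lop \<beta>0 \<beta>1 \<beta>2 A B (Lterm \<beta>0 \<beta>1 \<beta>2 A B f kk) x =
    Lterm \<beta>0 \<beta>1 \<beta>2 A B f (inc0 kk) x + Lterm \<beta>0 \<beta>1 \<beta>2 A B f (inc1 kk) x + Lterm \<beta>0 \<beta>1 \<beta>2 A B f (inc2 kk) x
    + Lterm \<beta>0 \<beta>1 \<beta>2 A B f (inc3 kk) x + Lterm \<beta>0 \<beta>1 \<beta>2 A B f (inc4 kk) x"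
proof -
  obtain k0 k1 k2 k3 k4 where kk: "kk = (k0, k1, k2, k3, k4)" by (cases kk rule: prod_cases5)
  define l where "l = ell kk"
  define \<kappa> where "\<kappa> = conv_mix A B k3 k4"
  define C where "C = \<beta>0 ^ k0 * \<beta>1 ^ k1 * \<beta>2 ^ k2"
  have \<kappa>: "fin_borel \<kappa>" unfolding \<kappa>_def by (rule fin_conv_mix[OF AB])
  have F: "Cb ((deriv ^^ i) f)" for i by (rule Cb_derivs[OF f])
  have d: "deriv (avg \<kappa> ((deriv ^^ i) f)) = avg \<kappa> ((deriv ^^ Suc i) f)" for i
    using Cb_avg(2)[OF \<kappa> F, of 1 i] by simp
  have av: "avg D (avg \<kappa> ((deriv ^^ i) f)) x = avg (D \<star> \<kappa>) ((deriv ^^ i) f) x" if "fin_borel D" for D i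
  proof -
    obtain K where "\<And>x. \<bar>(deriv ^^ i) f x\<bar> \<le> K" using Cb_bound0[OF F] by blast
    then show ?thesis by (intro avg_convolution[symmetric] that \<kappa> Cb_measurable[OF F])
  qed
  have L: "Lterm \<beta>0 \<beta>1 \<beta>2 A B f kk = (\<lambda>x. C * avg \<kappa> ((deriv ^^ l) f) x)"
    by (simp add: kk C_def \<kappa>_def l_def)
  have "Lop \<beta>0 \<beta>1 \<beta>2 A B (Lterm \<beta>0 \<beta>1 \<beta>2 A B f kk) x = C * Lop \<beta>0 \<beta>1 \<beta>2 A B (avg \<kappa> ((deriv ^^ l) f)) x"
    unfolding L using fun_cong[OF Lop_sum[OF AB, where I="{()}" and g="\<lambda>_. avg \<kappa> ((deriv ^^ l) f)" and a="\<lambda>_. C"], of \<beta>0 \<beta>1 \<beta>2 x]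
    by (simp add: Cb_avg \<kappa> F)
  also have "Lop \<beta>0 \<beta>1 \<beta>2 A B (avg \<kappa> ((deriv ^^ l) f)) x =
     \<beta>0 * avg \<kappa> ((deriv ^^ l) f) x + \<beta>1 * avg \<kappa> ((deriv ^^ Suc l) f) x + \<beta>2 * avg \<kappa> ((deriv ^^ Suc (Suc l)) f) x
     + avg (conv_mix A B (Suc k3) k4) ((deriv ^^ l) f) x + avg (conv_mix A B k3 (Suc k4)) ((deriv ^^ Suc (Suc l)) f) x"
    unfolding Lop_def d av[OF AB(1)] av[OF AB(2)] unfolding \<kappa>_def conv_mix_Suc1[OF AB] conv_mix_Suc2[OF AB] ..
  finally show ?thesis
    by (simp add: kk C_def \<kappa>_def l_def algebra_simps del: funpow.simps)
qed

lemma Lop_power: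
  "(Lop \<beta>0 \<beta>1 \<beta>2 A B ^^ k) f = (\<lambda>x. \<Sum>kk\<in>multis k. multinom kk * Lterm \<beta>0 \<beta>1 \<beta>2 A B f kk x)"
proof (induction k)
  case 0
  have "multis 0 = {(0, 0, 0, 0, 0)}" by (auto simp: multis_def)
  moreover have "avg (conv_mix A B 0 0) f x = f x" for x
  proof -
    obtain K where K: "\<And>x. \<bar>f x\<bar> \<le> K" using Cb_bound0[OF f] by blast
    have r: "avg (return borel 0) g y = g y" if "g \<in> borel_measurable borel" for g y
      unfolding avg_def by (subst integral_return) (use that in auto)
    have "avg (return borel 0) f = f" using r[OF Cb_measurable[OF f]] by auto
    then show ?thesis unfolding conv_mix_def conv_pow.simps
      using avg_convolution[OF fin_borel_return fin_borel_return Cb_measurable[OF f] K] r[OF Cb_measurable[OF f]] by simp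
  qed
  ultimately show ?case by auto
next
  case (Suc k)
  have "(Lop \<beta>0 \<beta>1 \<beta>2 A B ^^ Suc k) f = (\<lambda>x. \<Sum>kk\<in>multis k. multinom kk * Lop \<beta>0 \<beta>1 \<beta>2 A B (Lterm \<beta>0 \<beta>1 \<beta>2 A B f kk) x)"
    unfolding funpow.simps comp_def Suc by (rule Lop_sum[OF AB Cb_Lterm])
  then show ?case unfolding Lop_Lterm multinom_step .
qed

end

section \<open>The coordinate measures as convolution powers\<close>

text \<open>Nonnegative integrals avoid integrability conditions. The function h is arbitrary
  because splitting off one coordinate replaces it by a translate.\<close>

lemma nn_integral_PiM_sum:
  fixes I :: "'i set"
  assumes A: "fin_borel A" and I: "finite I" and h: "h \<in> borel_measurable borel"
  shows "(\<integral>\<^sup>+u. h (\<Sum>i\<in>I. u i) \<partial>(\<Pi>\<^sub>M i\<in>I. A)) = (\<integral>\<^sup>+v. h v \<partial>conv_pow A (card I))"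
  using I h
proof (induction I arbitrary: h)
  case empty
  then show ?case by (simp add: PiM_empty nn_integral_return)
next
  case (insert j I)
  interpret A: finite_measure A using fin_borelD(1)[OF A] .
  interpret P: product_sigma_finite "\<lambda>_::'i. A" ..
  note [measurable_cong] = fin_borelD(2)[OF A]
  note insert.prems[measurable]
  have P: "fin_borel (conv_pow A (card I))" by (rule fin_borel_conv_pow[OF A])
  interpret C: finite_measure "conv_pow A (card I)" using fin_borelD(1)[OF P] .
  have "(\<integral>\<^sup>+u. h (\<Sum>i\<in>insert j I. u i) \<partial>(\<Pi>\<^sub>M i\<in>insert j I. A)) =
    (\<integral>\<^sup>+y. (\<integral>\<^sup>+u. h (\<Sum>i\<in>insert j I. (u(j := y)) i) \<partial>(\<Pi>\<^sub>M i\<in>I. A)) \<partial>A)"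
    by (rule P.product_nn_integral_insert_rev[OF insert.hyps]) measurable
  also have "\<dots> = (\<integral>\<^sup>+y. (\<integral>\<^sup>+u. h (y + (\<Sum>i\<in>I. u i)) \<partial>(\<Pi>\<^sub>M i\<in>I. A)) \<partial>A)"
  proof (intro nn_integral_cong)
    fix y :: real and u :: "'i \<Rightarrow> real"
    have "(\<Sum>i\<in>I. (u(j := y)) i) = (\<Sum>i\<in>I. u i)" using insert.hyps by (intro sum.cong) auto
    then show "h (\<Sum>i\<in>insert j I. (u(j := y)) i) = h (y + (\<Sum>i\<in>I. u i))" using insert.hyps by simp
  qed
  also have "\<dots> = (\<integral>\<^sup>+y. (\<integral>\<^sup>+v. h (y + v) \<partial>conv_pow A (card I)) \<partial>A)"
    by (intro nn_integral_cong insert.IH) measurable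
  also have "\<dots> = (\<integral>\<^sup>+v. h v \<partial>(A \<star> conv_pow A (card I)))"
    by (rule nn_integral_convolution[symmetric])
      (use fin_borelD(2)[OF A] fin_borelD(2)[OF P] A.finite_measure_axioms C.finite_measure_axioms in auto)
  finally show ?case using insert.hyps by simp
qed

text \<open>All \<open>w j\<close> are integrated in one product and all \<open>\<beta> j\<close> in
  another, whereas the convolution power needs each \<open>w j\<close> next to its own
  \<open>\<beta> j\<close>. One Fubini exchange per induction step brings the new pair
  together.\<close>

lemma nn_integral_PiM_sum_mult:
  fixes J :: "'i set"
  assumes B: "fin_borel B" and C: "fin_borel C" and J: "finite J" and h: "h \<in> borel_measurable borel"
  shows "(\<integral>\<^sup>+w. (\<integral>\<^sup>+\<beta>. h (\<Sum>j\<in>J. \<beta> j * w j) \<partial>(\<Pi>\<^sub>M j\<in>J. C)) \<partial>(\<Pi>\<^sub>M j\<in>J. B)) =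
    (\<integral>\<^sup>+v. h v \<partial>conv_pow (distr (B \<Otimes>\<^sub>M C) borel (\<lambda>p. snd p * fst p)) (card J))"
  using J h
proof (induction J arbitrary: h)
  case empty
  then show ?case by (simp add: PiM_empty nn_integral_return)
next
  case (insert j J)
  let ?V = "distr (B \<Otimes>\<^sub>M C) borel (\<lambda>p. snd p * fst p :: real)"
  interpret B: finite_measure B using fin_borelD(1)[OF B] .
  interpret C: finite_measure C using fin_borelD(1)[OF C] .
  interpret BC: finite_measure "B \<Otimes>\<^sub>M C" by (rule finite_measure_pair_measure) unfold_locales
  interpret PB: product_sigma_finite "\<lambda>_::'i. B" ..
  interpret PC: product_sigma_finite "\<lambda>_::'i. C" ..
  interpret FB: finite_product_sigma_finite "\<lambda>_::'i. B" J by unfold_locales (rule insert.hyps)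
  interpret FC: finite_product_sigma_finite "\<lambda>_::'i. C" J by unfold_locales (rule insert.hyps)
  interpret FC': finite_product_sigma_finite "\<lambda>_::'i. C" "insert j J" by unfold_locales (use insert.hyps in simp)
  interpret Q: pair_sigma_finite "\<Pi>\<^sub>M j\<in>J. B" C ..
  note [measurable_cong] = fin_borelD(2)[OF B] fin_borelD(2)[OF C]
  note insert.prems[measurable]
  have V: "fin_borel ?V"
    unfolding fin_borel_def by (intro conjI BC.finite_measure_distr) auto
  have P: "fin_borel (conv_pow ?V (card J))" by (rule fin_borel_conv_pow[OF V])
  interpret CP: finite_measure "conv_pow ?V (card J)" using fin_borelD(1)[OF P] .
  interpret VF: finite_measure ?V using fin_borelD(1)[OF V] .
  note [measurable_cong] = fin_borelD(2)[OF P]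
  have eq: "(\<Sum>i\<in>insert j J. (\<beta>(j := b)) i * (w(j := y)) i) = b * y + (\<Sum>i\<in>J. \<beta> i * w i)" for \<beta> w b y
  proof -
    have "(\<Sum>i\<in>J. (\<beta>(j := b)) i * (w(j := y)) i) = (\<Sum>i\<in>J. \<beta> i * w i)" using insert.hyps by (intro sum.cong) auto
    then show ?thesis using insert.hyps by simp
  qed
  have "(\<integral>\<^sup>+w. (\<integral>\<^sup>+\<beta>. h (\<Sum>i\<in>insert j J. \<beta> i * w i) \<partial>(\<Pi>\<^sub>M i\<in>insert j J. C)) \<partial>(\<Pi>\<^sub>M i\<in>insert j J. B)) =
    (\<integral>\<^sup>+y. (\<integral>\<^sup>+w. (\<integral>\<^sup>+\<beta>. h (\<Sum>i\<in>insert j J. \<beta> i * (w(j := y)) i) \<partial>(\<Pi>\<^sub>M i\<in>insert j J. C)) \<partial>(\<Pi>\<^sub>M i\<in>J. B)) \<partial>B)"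
    by (rule PB.product_nn_integral_insert_rev[OF insert.hyps]) measurable
  also have "\<dots> = (\<integral>\<^sup>+y. (\<integral>\<^sup>+w. (\<integral>\<^sup>+b. (\<integral>\<^sup>+\<beta>. h (\<Sum>i\<in>insert j J. (\<beta>(j := b)) i * (w(j := y)) i) \<partial>(\<Pi>\<^sub>M i\<in>J. C)) \<partial>C) \<partial>(\<Pi>\<^sub>M i\<in>J. B)) \<partial>B)"
    by (intro nn_integral_cong PC.product_nn_integral_insert_rev[OF insert.hyps]) measurable
  also have "\<dots> = (\<integral>\<^sup>+y. (\<integral>\<^sup>+w. (\<integral>\<^sup>+b. (\<integral>\<^sup>+\<beta>. h (b * y + (\<Sum>i\<in>J. \<beta> i * w i)) \<partial>(\<Pi>\<^sub>M i\<in>J. C)) \<partial>C) \<partial>(\<Pi>\<^sub>M i\<in>J. B)) \<partial>B)"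
    by (simp only: eq)
  also have "\<dots> = (\<integral>\<^sup>+y. (\<integral>\<^sup>+b. (\<integral>\<^sup>+w. (\<integral>\<^sup>+\<beta>. h (b * y + (\<Sum>i\<in>J. \<beta> i * w i)) \<partial>(\<Pi>\<^sub>M i\<in>J. C)) \<partial>(\<Pi>\<^sub>M i\<in>J. B)) \<partial>C) \<partial>B)"
    by (intro nn_integral_cong Q.Fubini'[symmetric]) measurable
  also have "\<dots> = (\<integral>\<^sup>+y. (\<integral>\<^sup>+b. (\<integral>\<^sup>+v. h (b * y + v) \<partial>conv_pow ?V (card J)) \<partial>C) \<partial>B)"
    by (intro nn_integral_cong insert.IH) measurable
  also have "\<dots> = (\<integral>\<^sup>+p. (\<integral>\<^sup>+v. h (snd p * fst p + v) \<partial>conv_pow ?V (card J)) \<partial>(B \<Otimes>\<^sub>M C))"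
    by (subst C.nn_integral_fst[symmetric]) auto
  also have "\<dots> = (\<integral>\<^sup>+z. (\<integral>\<^sup>+v. h (z + v) \<partial>conv_pow ?V (card J)) \<partial>?V)"
    by (subst nn_integral_distr) auto
  also have "\<dots> = (\<integral>\<^sup>+v. h v \<partial>(?V \<star> conv_pow ?V (card J)))"
    by (rule nn_integral_convolution[symmetric])
      (use fin_borelD(2)[OF P] VF.finite_measure_axioms CP.finite_measure_axioms in auto)
  finally show ?case using insert.hyps by simp
qed

context trunc_levy
begin

text \<open>Translates the multiple integrals of the coefficients into the convolution powers of the
  expansion. Only the sizes of the index sets matter, so {2..k3} stands for one big jump less than
  {1..k3}.\<close>

lemma distr_coord:
  assumes I: "finite I" and J: "finite J"
  shows "distr (coord_measure c \<nu> I J) borel (\<lambda>(u, w, \<beta>). (\<Sum>i\<in>I. u i) + (\<Sum>j\<in>J. \<beta> j * w j)) = conv_mix U V (card I) (card J)"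
    and "(\<lambda>(u, w, \<beta>). (\<Sum>i\<in>I. u i) + (\<Sum>j\<in>J. \<beta> j * w j)) \<in> borel_measurable (coord_measure c \<nu> I J)"
proof -
  let ?S = "small_meas c \<nu>" and ?T = taylor_meas
  let ?f = "\<lambda>(u, w, \<beta>). (\<Sum>i\<in>I. u i) + (\<Sum>j\<in>J. \<beta> j * w j) :: real"
  have cm: "coord_measure c \<nu> I J = (\<Pi>\<^sub>M i\<in>I. U) \<Otimes>\<^sub>M ((\<Pi>\<^sub>M j\<in>J. ?S) \<Otimes>\<^sub>M (\<Pi>\<^sub>M j\<in>J. ?T))"
    by (simp add: coord_measure_def big_meas_def small_meas_def taylor_meas_def)
  interpret FU: finite_measure U using fin_borelD(1)[OF fin_U] .
  interpret FS: finite_measure ?S using fin_borelD(1)[OF fin_small] .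
  interpret FT: finite_measure ?T using fin_borelD(1)[OF fin_taylor] .
  interpret PU: product_sigma_finite "\<lambda>_::nat. U" ..
  interpret PS: product_sigma_finite "\<lambda>_::nat. ?S" ..
  interpret PT: product_sigma_finite "\<lambda>_::nat. ?T" ..
  interpret QU: finite_product_sigma_finite "\<lambda>_::nat. U" I by unfold_locales (rule I)
  interpret QS: finite_product_sigma_finite "\<lambda>_::nat. ?S" J by unfold_locales (rule J)
  interpret QT: finite_product_sigma_finite "\<lambda>_::nat. ?T" J by unfold_locales (rule J)
  interpret ST: pair_sigma_finite "\<Pi>\<^sub>M j\<in>J. ?S" "\<Pi>\<^sub>M j\<in>J. ?T" ..
  note [measurable_cong] = fin_borelD(2)[OF fin_U] fin_borelD(2)[OF fin_small] fin_borelD(2)[OF fin_taylor]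
  have fm[measurable]: "?f \<in> borel_measurable ((\<Pi>\<^sub>M i\<in>I. U) \<Otimes>\<^sub>M ((\<Pi>\<^sub>M j\<in>J. ?S) \<Otimes>\<^sub>M (\<Pi>\<^sub>M j\<in>J. ?T)))"
    by measurable
  then show "?f \<in> borel_measurable (coord_measure c \<nu> I J)" unfolding cm .
  have P: "fin_borel (conv_pow U (card I))" "fin_borel (conv_pow V (card J))"
    by (intro fin_borel_conv_pow fin_U fin_V)+
  interpret P1: finite_measure "conv_pow U (card I)" using fin_borelD(1)[OF P(1)] .
  interpret P2: finite_measure "conv_pow V (card J)" using fin_borelD(1)[OF P(2)] .
  note [measurable_cong] = fin_borelD(2)[OF P(2)]
  show "distr (coord_measure c \<nu> I J) borel ?f = conv_mix U V (card I) (card J)"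
  proof (rule measure_eqI)
    show "sets (distr (coord_measure c \<nu> I J) borel ?f) = sets (conv_mix U V (card I) (card J))"
      using fin_borelD(2)[OF fin_conv_mix[OF fin_U fin_V]] by simp
    fix D assume "D \<in> sets (distr (coord_measure c \<nu> I J) borel ?f)"
    then have D[measurable]: "D \<in> sets borel" by simp
    define h :: "real \<Rightarrow> ennreal" where "h = indicator D"
    have hm[measurable]: "h \<in> borel_measurable borel" by (simp add: h_def)
    have "emeasure (distr (coord_measure c \<nu> I J) borel ?f) D = (\<integral>\<^sup>+z. h z \<partial>distr (coord_measure c \<nu> I J) borel ?f)"
      unfolding h_def by (subst nn_integral_indicator) auto
    also have "\<dots> = (\<integral>\<^sup>+p. h (?f p) \<partial>((\<Pi>\<^sub>M i\<in>I. U) \<Otimes>\<^sub>M ((\<Pi>\<^sub>M j\<in>J. ?S) \<Otimes>\<^sub>M (\<Pi>\<^sub>M j\<in>J. ?T))))"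
      unfolding cm by (subst nn_integral_distr) auto
    also have "\<dots> = (\<integral>\<^sup>+u. (\<integral>\<^sup>+q. h (?f (u, q)) \<partial>((\<Pi>\<^sub>M j\<in>J. ?S) \<Otimes>\<^sub>M (\<Pi>\<^sub>M j\<in>J. ?T))) \<partial>(\<Pi>\<^sub>M i\<in>I. U))"
      by (subst ST.nn_integral_fst[symmetric]) auto
    also have "\<dots> = (\<integral>\<^sup>+u. (\<integral>\<^sup>+w. (\<integral>\<^sup>+\<beta>. h (?f (u, w, \<beta>)) \<partial>(\<Pi>\<^sub>M j\<in>J. ?T)) \<partial>(\<Pi>\<^sub>M j\<in>J. ?S)) \<partial>(\<Pi>\<^sub>M i\<in>I. U))"
      by (intro nn_integral_cong, subst QT.nn_integral_fst[symmetric]) auto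
    also have "\<dots> = (\<integral>\<^sup>+u. (\<integral>\<^sup>+v. h ((\<Sum>i\<in>I. u i) + v) \<partial>conv_pow V (card J)) \<partial>(\<Pi>\<^sub>M i\<in>I. U))"
      unfolding small_push_def prod.case
      by (intro nn_integral_cong nn_integral_PiM_sum_mult[OF fin_small fin_taylor J]) measurable
    also have "\<dots> = (\<integral>\<^sup>+z. (\<integral>\<^sup>+v. h (z + v) \<partial>conv_pow V (card J)) \<partial>conv_pow U (card I))"
      by (rule nn_integral_PiM_sum[OF fin_U I]) measurable
    also have "\<dots> = (\<integral>\<^sup>+v. h v \<partial>conv_mix U V (card I) (card J))"
      unfolding conv_mix_def by (rule nn_integral_convolution[symmetric])
        (use fin_borelD(2)[OF P(1)] fin_borelD(2)[OF P(2)] P1.finite_measure_axioms P2.finite_measure_axioms in auto)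
    also have "\<dots> = emeasure (conv_mix U V (card I) (card J)) D"
      unfolding h_def using fin_borelD(2)[OF fin_conv_mix[OF fin_U fin_V]] by (subst nn_integral_indicator) auto
    finally show "emeasure (distr (coord_measure c \<nu> I J) borel ?f) D = emeasure (conv_mix U V (card I) (card J)) D" .
  qed
qed

end

section \<open>Mollified indicators and regularity of the truncated density\<close>

lemma Cb_scale:
  assumes "Cb g"
  shows "Cb (\<lambda>x. g (a * x))" and "(deriv ^^ k) (\<lambda>x. g (a * x)) = (\<lambda>x. a ^ k * (deriv ^^ k) g (a * x))"
proof -
  let ?G = "\<lambda>k x. a ^ k * (deriv ^^ k) g (a * x)"
  have D: "(?G k has_real_derivative ?G (Suc k) x) (at x)" for k x
  proof -
    have "((\<lambda>x. (deriv ^^ k) g (a * x)) has_real_derivative (deriv ^^ Suc k) g (a * x) * a) (at x)"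
      by (rule DERIV_chain2[OF Cb_DERIV[OF assms]]) (auto intro!: derivative_eq_intros)
    from DERIV_cmult[OF this, of "a ^ k"] show ?thesis by (simp add: mult_ac)
  qed
  have B: "\<exists>B. \<forall>x. \<bar>?G k x\<bar> \<le> B" for k
  proof -
    obtain B where "\<And>x. \<bar>(deriv ^^ k) g x\<bar> \<le> B" using Cb_bound[OF assms, where k=k] by blast
    then have "\<bar>?G k x\<bar> \<le> \<bar>a\<bar> ^ k * B" for x by (auto simp: abs_mult power_abs intro!: mult_left_mono)
    then show ?thesis by blast
  qed
  show "Cb (\<lambda>x. g (a * x))" by (rule CbI(1)[of ?G]) (use D B in auto)
  show "(deriv ^^ k) (\<lambda>x. g (a * x)) = ?G k" by (rule CbI(2)[of ?G]) (use D B in auto)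
qed

lemma Cb_antideriv:
  assumes D: "\<And>x. (F has_real_derivative f x) (at x)" and f: "Cb f" and B: "\<And>x. \<bar>F x\<bar> \<le> B"
  shows "Cb F" "(deriv ^^ Suc k) F = (deriv ^^ k) f"
proof -
  let ?G = "\<lambda>k. case k of 0 \<Rightarrow> F | Suc k \<Rightarrow> (deriv ^^ k) f"
  have D': "(?G k has_real_derivative ?G (Suc k) x) (at x)" for k x
    using D Cb_DERIV[OF f] by (cases k) auto
  have B': "\<exists>B. \<forall>x. \<bar>?G k x\<bar> \<le> B" for k
    using B f unfolding Cb_def by (cases k) auto
  show "Cb F" by (rule CbI(1)[of ?G]) (use D' B' in auto)
  show "(deriv ^^ Suc k) F = (deriv ^^ k) f" by (subst CbI(2)[of ?G]) (use D' B' in auto)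
qed

section \<open>The mollified indicator as a rescaled distribution function\<close>

definition bump_cdf :: "(real \<Rightarrow> real) \<Rightarrow> real \<Rightarrow> real" where
  "bump_cdf \<phi> z = (LINT u : {..z} | lborel. \<phi> u)"

context
  fixes \<phi> :: "real \<Rightarrow> real"
  assumes phi: "bump \<phi>"
begin

lemma bump_facts: "0 \<le> \<phi> x" "1 < \<bar>x\<bar> \<Longrightarrow> \<phi> x = 0" "Cb \<phi>" "\<phi> \<in> borel_measurable borel"
  "integrable lborel \<phi>" "(\<integral>x. \<phi> x \<partial>lborel) = 1"
proof -
  show "0 \<le> \<phi> x" using phi by (simp add: bump_def)
  show z: "1 < \<bar>x\<bar> \<Longrightarrow> \<phi> x = 0" for x
  proof -
    assume "1 < \<bar>x\<bar>"
    then have "x \<notin> {-1..1}" by auto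
    then show ?thesis using phi by (simp add: bump_def)
  qed
  show "Cb \<phi>" by (rule smooth_compact_Cb(1)[where r=1]) (use phi z in \<open>auto simp: bump_def\<close>)
  then show "\<phi> \<in> borel_measurable borel" by (rule Cb_measurable)
  show i: "(\<integral>x. \<phi> x \<partial>lborel) = 1" using phi by (simp add: bump_def)
  show "integrable lborel \<phi>" by (rule ccontr) (use i not_integrable_integral_eq in fastforce)
qed

lemma bump_cdf_bounds: "0 \<le> bump_cdf \<phi> z" "bump_cdf \<phi> z \<le> 1" "z < -1 \<Longrightarrow> bump_cdf \<phi> z = 0" "1 < z \<Longrightarrow> bump_cdf \<phi> z = 1"
proof -
  note [measurable] = bump_facts(4)
  have ii: "integrable lborel (\<lambda>u. indicat_real {..z} u *\<^sub>R \<phi> u)" for z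
    by (rule integrable_mult_indicator) (auto intro: bump_facts)
  show "0 \<le> bump_cdf \<phi> z" unfolding bump_cdf_def set_lebesgue_integral_def
    by (rule integral_nonneg_AE) (auto simp: bump_facts)
  have "bump_cdf \<phi> z \<le> (\<integral>x. \<phi> x \<partial>lborel)" unfolding bump_cdf_def set_lebesgue_integral_def
    by (rule integral_mono[OF ii bump_facts(5)]) (auto simp: indicator_def bump_facts)
  then show "bump_cdf \<phi> z \<le> 1" by (simp add: bump_facts)
  show "bump_cdf \<phi> z = 0" if "z < -1"
  proof -
    have "(\<lambda>u. indicat_real {..z} u *\<^sub>R \<phi> u) = (\<lambda>_. 0)"
      using that bump_facts(2) by (auto simp: indicator_def fun_eq_iff)
    then show ?thesis by (simp add: bump_cdf_def set_lebesgue_integral_def)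
  qed
  show "bump_cdf \<phi> z = 1" if "1 < z"
  proof -
    have "(\<lambda>u. indicat_real {..z} u *\<^sub>R \<phi> u) = \<phi>"
      using that bump_facts(2) by (auto simp: indicator_def fun_eq_iff)
    then show ?thesis by (simp add: bump_cdf_def set_lebesgue_integral_def bump_facts)
  qed
qed

lemma DERIV_bump_cdf: "(bump_cdf \<phi> has_real_derivative \<phi> z) (at z)"
proof -
  have cont: "continuous_on A \<phi>" for A using Cb_isCont[OF bump_facts(3)] by (intro continuous_at_imp_continuous_on) auto
  \<comment> \<open>The lower limit -2 lies strictly left of the support, so the remaining case z
    \<le> -2 falls into the open half-line below -1, where the function is constantly 0.\<close>
  have eq: "bump_cdf \<phi> w = integral {-2..w} \<phi>" for w
  proof -
    have S: "set_integrable lborel {-2..w} \<phi>" by (rule borel_integrable_atLeastAtMost'[OF cont])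
    have "bump_cdf \<phi> w = (LINT u : {-2..w} | lborel. \<phi> u)"
      unfolding bump_cdf_def set_lebesgue_integral_def
      by (rule Bochner_Integration.integral_cong) (use bump_facts(2) in \<open>auto simp: indicator_def\<close>)
    then show ?thesis using set_borel_integral_eq_integral(2)[OF S] by simp
  qed
  show ?thesis
  proof (cases "-2 < z")
    case True
    have "((\<lambda>w. integral {-2..w} \<phi>) has_real_derivative \<phi> z) (at z within {-2..z+1})"
      by (rule integral_has_real_derivative[OF cont]) (use True in auto)
    moreover have "at z within {-2..z+1} = at z" using True by (intro at_within_Icc_at) auto
    ultimately show ?thesis unfolding eq[abs_def] by simp
  next
    case False
    have "((\<lambda>_. 0) has_real_derivative 0) (at z)" by simp
    then have "(bump_cdf \<phi> has_real_derivative 0) (at z)"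
      by (rule has_field_derivative_transform_within_open[of _ _ _ "{..<-1}"]) (use False bump_cdf_bounds(3) in auto)
    then show ?thesis using False bump_facts(2)[of z] by auto
  qed
qed

lemma Cb_bump_cdf: "Cb (bump_cdf \<phi>)" "(deriv ^^ Suc k) (bump_cdf \<phi>) = (deriv ^^ k) \<phi>"
proof -
  have b: "\<bar>bump_cdf \<phi> x\<bar> \<le> 1" for x using bump_cdf_bounds(1,2)[of x] by auto
  show "Cb (bump_cdf \<phi>)" "(deriv ^^ Suc k) (bump_cdf \<phi>) = (deriv ^^ k) \<phi>"
    by (rule Cb_antideriv[OF DERIV_bump_cdf bump_facts(3) b])+
qed

text \<open>Linear substitution. For m = 0 the mollifier is identically 0, which is why the
  sequences below run over \<open>Suc m\<close>.\<close>

lemma moll_ind_eq: "0 < m \<Longrightarrow> moll_ind \<phi> y m x = bump_cdf \<phi> (real m * (x - y))"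
proof -
  assume m: "0 < m"
  have "moll_ind \<phi> y m x = real m * (\<integral>u. indicat_real {..real m * (x - y)} (0 + real m * u) * \<phi> (0 + real m * u) \<partial>lborel)"
    unfolding moll_ind_def set_lebesgue_integral_def mollifier_def
    by (subst integral_mult_right_zero[symmetric], rule Bochner_Integration.integral_cong)
      (use m in \<open>auto simp: indicator_def\<close>)
  also have "\<dots> = bump_cdf \<phi> (real m * (x - y))"
    unfolding bump_cdf_def set_lebesgue_integral_def
    by (subst lborel_integral_real_affine[where c="real m" and t=0]) (use m in auto)
  finally show ?thesis .
qed

lemma moll_ind_Cb:
  assumes m: "0 < m"
  shows "Cb (moll_ind \<phi> y m)"
    and "(deriv ^^ k) (moll_ind \<phi> y m) x = real m ^ k * (deriv ^^ k) (bump_cdf \<phi>) (real m * (x - y))"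
proof -
  have e: "moll_ind \<phi> y m = (\<lambda>x. (\<lambda>z. bump_cdf \<phi> (real m * z)) (x + - y))"
    using moll_ind_eq[OF m] by auto
  show "Cb (moll_ind \<phi> y m)" unfolding e by (intro Cb_shift Cb_scale Cb_bump_cdf)
  show "(deriv ^^ k) (moll_ind \<phi> y m) x = real m ^ k * (deriv ^^ k) (bump_cdf \<phi>) (real m * (x - y))"
    unfolding e Cb_shift(2)[OF Cb_scale(1)[OF Cb_bump_cdf(1)]] Cb_scale(2)[OF Cb_bump_cdf(1)] by simp
qed

lemma deriv_bump_cdf_0:
  "z < -1 \<Longrightarrow> (deriv ^^ k) (bump_cdf \<phi>) z = 0" "1 < \<bar>z\<bar> \<Longrightarrow> (deriv ^^ Suc k) (bump_cdf \<phi>) z = 0"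
proof -
  have *: "1 < \<bar>z\<bar> \<Longrightarrow> (deriv ^^ Suc k) (bump_cdf \<phi>) z = 0" for z k
    unfolding Cb_bump_cdf(2) by (rule smooth_compact_Cb(2)[where r=1]) (use phi bump_facts(2) in \<open>auto simp: bump_def\<close>)
  show "1 < \<bar>z\<bar> \<Longrightarrow> (deriv ^^ Suc k) (bump_cdf \<phi>) z = 0" by (rule *)
  show "z < -1 \<Longrightarrow> (deriv ^^ k) (bump_cdf \<phi>) z = 0"
    using *[of z "k - 1"] bump_cdf_bounds(3)[of z] by (cases k) auto
qed

lemma moll_limit_neq:
  "x \<noteq> y \<Longrightarrow> (\<lambda>m. moll_ind \<phi> y (Suc m) x) \<longlonglongrightarrow> of_bool (y \<le> x)"
proof -
  assume "x \<noteq> y"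
  then have "0 < \<bar>x - y\<bar>" by simp
  then obtain M :: nat where M: "1 / \<bar>x - y\<bar> < real M" using reals_Archimedean2 by blast
  have "moll_ind \<phi> y (Suc m) x = of_bool (y \<le> x)" if "M \<le> m" for m
  proof -
    have "1 / \<bar>x - y\<bar> < real (Suc m)" using M that by linarith
    then have "1 < real (Suc m) * \<bar>x - y\<bar>" using \<open>0 < \<bar>x - y\<bar>\<close> by (simp add: divide_less_eq)
    then show ?thesis
      using moll_ind_eq[OF zero_less_Suc, of y m x] bump_cdf_bounds(3,4)[of "real (Suc m) * (x - y)"] \<open>x \<noteq> y\<close>
      by (cases "y < x") (auto simp: algebra_simps)
  qed
  then show ?thesis by (intro tendsto_eventually) (auto simp: eventually_sequentially intro!: exI[of _ M])
qed

lemma moll_bound: "\<bar>moll_ind \<phi> y (Suc m) x\<bar> \<le> 1"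
  using moll_ind_eq[OF zero_less_Suc, of y m x] bump_cdf_bounds(1,2)[of "real (Suc m) * (x - y)"] by simp

end

section \<open>Regularity away from the origin\<close>

definition bounded_off_0 :: "(real \<Rightarrow> real) \<Rightarrow> bool" where
  "bounded_off_0 F \<longleftrightarrow> (\<forall>\<delta>>0. \<exists>B. \<forall>x. \<delta> < \<bar>x\<bar> \<longrightarrow> \<bar>F x\<bar> \<le> B)"

text \<open>The recursion on \<open>deriv\<close> makes closure under products a plain induction on
  the order that avoids Leibniz' formula; \<open>smooth_off_0_iff\<close> unfolds it.\<close>

primrec smooth_off_0 :: "nat \<Rightarrow> (real \<Rightarrow> real) \<Rightarrow> bool" where
  "smooth_off_0 0 F \<longleftrightarrow> bounded_off_0 F"
| "smooth_off_0 (Suc N) F \<longleftrightarrow> bounded_off_0 F \<and> (\<forall>x. x \<noteq> 0 \<longrightarrow> F field_differentiable at x) \<and> smooth_off_0 N (deriv F)"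

lemma smooth_off_0_iff:
  "smooth_off_0 N F \<longleftrightarrow> (\<forall>k\<le>N. bounded_off_0 ((deriv ^^ k) F)) \<and> (\<forall>k<N. \<forall>x. x \<noteq> 0 \<longrightarrow> (deriv ^^ k) F field_differentiable at x)"
proof (induction N arbitrary: F)
  case (Suc N)
  have a: "(\<forall>k\<le>Suc N. P k) \<longleftrightarrow> P 0 \<and> (\<forall>k\<le>N. P (Suc k))" "(\<forall>k<Suc N. P k) \<longleftrightarrow> P 0 \<and> (\<forall>k<N. P (Suc k))" for P
    by (metis Suc_le_mono le0 not0_implies_Suc) (metis Suc_less_eq zero_less_Suc not0_implies_Suc)
  show ?case unfolding smooth_off_0.simps Suc a by (auto simp del: funpow.simps simp: funpow_Suc_right)
qed simp

text \<open>The complement of 0 is open, so derivatives off 0 see only values off 0. The rules for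
  derivatives of sums and products are available only there.\<close>

lemma smooth_off_0_cong:
  assumes "\<And>x. x \<noteq> 0 \<Longrightarrow> F x = G x"
  shows "smooth_off_0 N F \<longleftrightarrow> smooth_off_0 N G"
  using assms
proof (induction N arbitrary: F G)
  case 0
  have "\<delta> > 0 \<Longrightarrow> \<delta> < \<bar>x\<bar> \<Longrightarrow> F x = G x" for \<delta> x using 0 by auto
  then show ?case by (auto simp: bounded_off_0_def)
next
  case (Suc N)
  have b: "bounded_off_0 F \<longleftrightarrow> bounded_off_0 G"
  proof -
    have "\<delta> > 0 \<Longrightarrow> \<delta> < \<bar>x\<bar> \<Longrightarrow> F x = G x" for \<delta> x using Suc.prems by auto
    then show ?thesis by (auto simp: bounded_off_0_def)
  qed
  have D: "(F has_real_derivative d) (at x) \<longleftrightarrow> (G has_real_derivative d) (at x)" if "x \<noteq> 0" for x d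
    using has_field_derivative_transform_within_open[of F d x "-{0}" G] has_field_derivative_transform_within_open[of G d x "-{0}" F]
      Suc.prems that by auto
  have "deriv F x = deriv G x" if "x \<noteq> 0" for x unfolding deriv_def using D[OF that] by simp
  from Suc.IH[OF this] show ?case using b D by (auto simp: field_differentiable_def)
qed

lemma smooth_off_0_mono: "smooth_off_0 (Suc N) F \<Longrightarrow> smooth_off_0 N F"
  by (auto simp: smooth_off_0_iff)

lemma bounded_off_0_add: "bounded_off_0 F \<Longrightarrow> bounded_off_0 G \<Longrightarrow> bounded_off_0 (\<lambda>x. F x + G x)"
  unfolding bounded_off_0_def by (meson abs_triangle_ineq add_mono order_trans)

lemma bounded_off_0_mult: assumes "bounded_off_0 F" "bounded_off_0 G" shows "bounded_off_0 (\<lambda>x. F x * G x)"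
  unfolding bounded_off_0_def
proof (intro allI impI)
  fix \<delta> :: real assume "0 < \<delta>"
  then obtain B C where "\<And>x. \<delta> < \<bar>x\<bar> \<Longrightarrow> \<bar>F x\<bar> \<le> B" "\<And>x. \<delta> < \<bar>x\<bar> \<Longrightarrow> \<bar>G x\<bar> \<le> C"
    using assms unfolding bounded_off_0_def by meson
  then have "\<bar>F x * G x\<bar> \<le> B * C" if "\<delta> < \<bar>x\<bar>" for x
    unfolding abs_mult using that by (intro mult_mono') auto
  then show "\<exists>B. \<forall>x. \<delta> < \<bar>x\<bar> \<longrightarrow> \<bar>F x * G x\<bar> \<le> B" by blast
qed

lemma smooth_off_0_add: "smooth_off_0 N F \<Longrightarrow> smooth_off_0 N G \<Longrightarrow> smooth_off_0 N (\<lambda>x. F x + G x)"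
proof (induction N arbitrary: F G)
  case (Suc N)
  have d: "((\<lambda>x. F x + G x) has_real_derivative (deriv F x + deriv G x)) (at x)" if "x \<noteq> 0" for x
    using Suc.prems that by (auto intro!: DERIV_add simp: DERIV_deriv_iff_field_differentiable)
  have "smooth_off_0 N (\<lambda>x. deriv F x + deriv G x)" using Suc by auto
  moreover have "deriv (\<lambda>x. F x + G x) x = deriv F x + deriv G x" if "x \<noteq> 0" for x using d[OF that] by (rule DERIV_imp_deriv)
  ultimately have "smooth_off_0 N (deriv (\<lambda>x. F x + G x))" by (subst smooth_off_0_cong)
  then show ?case using Suc.prems d by (auto intro: bounded_off_0_add simp: field_differentiable_def)
qed (simp add: bounded_off_0_add)

lemma smooth_off_0_mult: "smooth_off_0 N F \<Longrightarrow> smooth_off_0 N G \<Longrightarrow> smooth_off_0 N (\<lambda>x. F x * G x)"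
proof (induction N arbitrary: F G)
  case (Suc N)
  have d: "((\<lambda>x. F x * G x) has_real_derivative (F x * deriv G x + deriv F x * G x)) (at x)" if "x \<noteq> 0" for x
    using Suc.prems that by (auto intro!: DERIV_mult' simp: DERIV_deriv_iff_field_differentiable)
  have "smooth_off_0 N (\<lambda>x. F x * deriv G x + deriv F x * G x)"
    using Suc.prems smooth_off_0_mono[of N F] smooth_off_0_mono[of N G] by (intro smooth_off_0_add Suc.IH) auto
  moreover have "deriv (\<lambda>x. F x * G x) x = F x * deriv G x + deriv F x * G x" if "x \<noteq> 0" for x using d[OF that] by (rule DERIV_imp_deriv)
  ultimately have "smooth_off_0 N (deriv (\<lambda>x. F x * G x))" by (subst smooth_off_0_cong)
  then show ?case using Suc.prems d by (auto intro: bounded_off_0_mult simp: field_differentiable_def)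
qed (simp add: bounded_off_0_mult)

lemma Cb_smooth_off_0: "Cb g \<Longrightarrow> smooth_off_0 N g"
  unfolding smooth_off_0_iff Cb_def bounded_off_0_def by blast

locale dens_levy = trunc_levy +
  fixes s :: "real \<Rightarrow> real" and n :: nat
  assumes sm[measurable]: "s \<in> borel_measurable borel" and s0: "\<And>x. x \<noteq> 0 \<Longrightarrow> 0 \<le> s x"
    and \<nu>s: "\<nu> = density lborel (\<lambda>x. ennreal (s x))"
    and sreg: "smooth_off_0 (2 * n + 1) s"
begin

text \<open>The density of the big jumps, see \<open>U_density\<close>. As 1 - c vanishes near 0, S
  is regular on the whole line although s is controlled only away from 0.\<close>

definition S :: "real \<Rightarrow> real" where "S x = (1 - c x) * s x"

lemma S_measurable[measurable]: "S \<in> borel_measurable borel"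
  unfolding S_def by measurable

lemma S_near_0: "\<bar>x\<bar> < \<epsilon> / 2 \<Longrightarrow> (deriv ^^ k) S x = 0"
proof (induction k arbitrary: x)
  case (Suc k)
  have O: "open {x::real. \<bar>x\<bar> < \<epsilon> / 2}" by (intro open_Collect_less continuous_intros)
  show ?case unfolding funpow.simps comp_def
    by (rule deriv_const_on_open[OF O, where k=0]) (use Suc in auto)
qed (simp add: S_def c_bounds)

lemma S_smooth_off_0: "smooth_off_0 (2 * n + 1) S"
proof -
  have "Cb (\<lambda>x. 1 + (-1) * c x)" using Cb_cos(1)[of 0 0] by (intro Cb_add Cb_cmult Cb_c) simp
  then have "Cb (\<lambda>x. 1 - c x)" by simp
  then show ?thesis unfolding S_def[abs_def] by (intro smooth_off_0_mult sreg Cb_smooth_off_0)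
qed

lemma S_DERIV: "k \<le> 2 * n \<Longrightarrow> ((deriv ^^ k) S has_real_derivative (deriv ^^ Suc k) S x) (at x)"
proof -
  assume k: "k \<le> 2 * n"
  have "(deriv ^^ k) S field_differentiable at x"
  proof (cases "x = 0")
    case False
    then show ?thesis using S_smooth_off_0 k by (auto simp: smooth_off_0_iff)
  next
    case True
    have "((\<lambda>_. 0) has_real_derivative 0) (at x)" by simp
    then have "((deriv ^^ k) S has_real_derivative 0) (at x)"
      by (rule has_field_derivative_transform_within_open[of _ _ _ "{-\<epsilon>/2<..<\<epsilon>/2}"]) (use True \<epsilon> S_near_0 in auto)
    then show ?thesis by (auto simp: field_differentiable_def)
  qed
  then show ?thesis by (simp add: DERIV_deriv_iff_field_differentiable)
qed

lemma S_bound: assumes "k \<le> 2 * n + 1" obtains B where "0 \<le> B" "\<And>x. \<bar>(deriv ^^ k) S x\<bar> \<le> B"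
proof -
  have "bounded_off_0 ((deriv ^^ k) S)" using S_smooth_off_0 assms by (auto simp: smooth_off_0_iff)
  \<comment> \<open>The radius \<epsilon> / 4 lies inside the zone of radius \<epsilon> / 2 where S
    vanishes, so the two estimates overlap.\<close>
  then obtain B where B: "\<And>x. \<epsilon> / 4 < \<bar>x\<bar> \<Longrightarrow> \<bar>(deriv ^^ k) S x\<bar> \<le> B"
    using \<epsilon> unfolding bounded_off_0_def by (meson divide_pos_pos zero_less_numeral)
  have "\<bar>(deriv ^^ k) S x\<bar> \<le> max B 0" for x
  proof (cases "\<epsilon> / 4 < \<bar>x\<bar>")
    case False
    then have "\<bar>x\<bar> < \<epsilon> / 2" using \<epsilon> by auto
    then show ?thesis by (simp add: S_near_0)
  qed (use B in \<open>simp add: le_max_iff_disj\<close>)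
  then show thesis using that[of "max B 0"] by simp
qed

lemma S_isCont: "k \<le> 2 * n \<Longrightarrow> isCont ((deriv ^^ k) S) x"
  using S_DERIV DERIV_isCont by blast

lemma S_nonneg: "0 \<le> S x"
  using s0[of x] c_bounds(2)[of x] c_bounds(3)[of 0] \<epsilon> by (cases "x = 0") (auto simp: S_def)

lemma U_density: "U = density lborel (\<lambda>u. ennreal (S u))"
proof -
  have "ennreal (s u) * ennreal (1 - c u) = ennreal (S u)" for u
  proof (cases "u = 0")
    case True
    then show ?thesis using c_bounds(3)[of 0] \<epsilon> by (simp add: S_def)
  next
    case False
    then show ?thesis using s0 c_bounds(2)[of u] by (simp add: S_def ennreal_mult[symmetric] mult.commute)
  qed
  then show ?thesis unfolding big_meas_def by (subst \<nu>s, subst density_density_eq) auto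
qed

lemma avg_U: "g \<in> borel_measurable borel \<Longrightarrow> avg U g x = (\<integral>u. S u * g (x + u) \<partial>lborel)"
  unfolding avg_def U_density by (subst integral_real_density) (auto simp: S_nonneg)

lemma S_integrable: "integrable lborel S"
proof -
  have "emeasure U UNIV < \<infinity>"
    using fin_borelD[OF fin_U] by (metis finite_measure.emeasure_finite less_top top.not_eq_extremum infinity_ennreal_def)
  moreover have "emeasure U UNIV = (\<integral>\<^sup>+u. ennreal (S u) \<partial>lborel)"
    unfolding U_density by (subst emeasure_density) auto
  ultimately show ?thesis by (intro integrableI_nonneg) (auto simp: S_nonneg)
qed

section \<open>Moving derivatives to the density of a big jump\<close>

context
  fixes \<phi> :: "real \<Rightarrow> real" and y :: real
  assumes phi: "bump \<phi>"
begin

text \<open>One derivative always stays on the mollified indicator. It keeps that factor compactly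
  supported, hence no boundary terms appear; each of the d others changes the sign once.\<close>

lemma moll_by_parts:
  assumes m: "0 < m" and k: "d + k \<le> 2 * n"
  shows "(\<integral>u. (deriv ^^ k) S u * (deriv ^^ Suc d) (moll_ind \<phi> y m) (r + u) \<partial>lborel) =
    (-1) ^ d * (\<integral>u. (deriv ^^ (k + d)) S u * (deriv ^^ Suc 0) (moll_ind \<phi> y m) (r + u) \<partial>lborel)"
  using k
proof (induction d arbitrary: k)
  case (Suc d)
  let ?f = "\<lambda>i x. (deriv ^^ i) (moll_ind \<phi> y m) (r + x)"
  \<comment> \<open>The derivatives of the mollified indicator live within 1 / m \<le> 1 of the
    point y - r; the margin 2 puts a and the right end b outside the support.\<close>
  define a where "a = y - r - 2"
  define b where "b = y - r + 2"
  note C = moll_ind_Cb(1)[OF phi m, of y]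
  have z: "?f (Suc i) u = 0" if "1 < \<bar>u + r - y\<bar>" for i u
  proof -
    have "1 * \<bar>u + r - y\<bar> \<le> real m * \<bar>u + r - y\<bar>" using m by (intro mult_right_mono) auto
    then have "1 < \<bar>real m * (r + u - y)\<bar>" using that by (simp add: abs_mult add.commute)
    then have "(deriv ^^ Suc i) (bump_cdf \<phi>) (real m * (r + u - y)) = 0" by (rule deriv_bump_cdf_0(2)[OF phi])
    then show ?thesis using moll_ind_Cb(2)[OF phi m, of "Suc i" y "r + u"] by simp
  qed
  have D: "(?f i has_real_derivative ?f (Suc i) x) (at x)" for i x
    using Cb_DERIV[OF C, of i "x + r"] by (simp only: DERIV_shift add.commute[of r])
  have cont: "isCont (?f i) x" for i x using D[of i x] by (rule DERIV_isCont)
  have ind: "(\<integral>u. (deriv ^^ j) S u * ?f (Suc i) u \<partial>lborel) = (\<integral>u. (deriv ^^ j) S u * ?f (Suc i) u * indicator {a..b} u \<partial>lborel)" for i j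
  proof (rule Bochner_Integration.integral_cong[OF refl])
    fix u
    show "(deriv ^^ j) S u * ?f (Suc i) u = (deriv ^^ j) S u * ?f (Suc i) u * indicator {a..b} u"
    proof (cases "u \<in> {a..b}")
      case False
      then have "1 < \<bar>u + r - y\<bar>" by (auto simp: a_def b_def)
      then show ?thesis using False by (simp only: z)
    qed simp
  qed
  have "(\<integral>u. (deriv ^^ k) S u * ?f (Suc (Suc d)) u * indicator {a..b} u \<partial>lborel) =
    (deriv ^^ k) S b * ?f (Suc d) b - (deriv ^^ k) S a * ?f (Suc d) a - (\<integral>u. (deriv ^^ Suc k) S u * ?f (Suc d) u * indicator {a..b} u \<partial>lborel)"
    by (rule integral_by_parts) (use Suc.prems S_DERIV[of k] D cont S_isCont[of "Suc k"] in \<open>auto simp: a_def b_def simp del: funpow.simps\<close>)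
  also have "?f (Suc d) b = 0" by (rule z) (simp add: b_def)
  also have "?f (Suc d) a = 0" by (rule z) (simp add: a_def)
  finally have "(\<integral>u. (deriv ^^ k) S u * ?f (Suc (Suc d)) u \<partial>lborel) = - (\<integral>u. (deriv ^^ Suc k) S u * ?f (Suc d) u \<partial>lborel)"
    unfolding ind by simp
  also have "(\<integral>u. (deriv ^^ Suc k) S u * ?f (Suc d) u \<partial>lborel) = (-1) ^ d * (\<integral>u. (deriv ^^ (Suc k + d)) S u * ?f (Suc 0) u \<partial>lborel)"
    by (rule Suc.IH) (use Suc.prems in simp)
  finally show ?case by (simp del: funpow.simps)
qed simp

text \<open>The substitution u = y - r + v / m turns the remaining first derivative into
  \<open>m * \<phi> v\<close>, and the Jacobian cancels the factor m.\<close>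

lemma avg_U_moll:
  assumes m: "0 < m" and d: "d \<le> 2 * n"
  shows "avg U ((deriv ^^ Suc d) (moll_ind \<phi> y m)) r = (-1) ^ d * (\<integral>v. \<phi> v * (deriv ^^ d) S (y - r + v / m) \<partial>lborel)"
proof -
  note C = moll_ind_Cb(1)[OF phi m, of y]
  have "avg U ((deriv ^^ Suc d) (moll_ind \<phi> y m)) r = (\<integral>u. S u * (deriv ^^ Suc d) (moll_ind \<phi> y m) (r + u) \<partial>lborel)"
    by (rule avg_U[OF Cb_measurable[OF Cb_derivs[OF C]]])
  also have "\<dots> = (-1) ^ d * (\<integral>u. (deriv ^^ d) S u * (deriv ^^ Suc 0) (moll_ind \<phi> y m) (r + u) \<partial>lborel)"
    using moll_by_parts[OF m, of d 0 r] d by (simp del: funpow.simps add: funpow_0)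
  also have "(\<integral>u. (deriv ^^ d) S u * (deriv ^^ Suc 0) (moll_ind \<phi> y m) (r + u) \<partial>lborel) =
     \<bar>1 / real m\<bar> *\<^sub>R (\<integral>v. (deriv ^^ d) S ((y - r) + (1 / real m) * v) * (deriv ^^ Suc 0) (moll_ind \<phi> y m) (r + ((y - r) + (1 / real m) * v)) \<partial>lborel)"
    by (rule lborel_integral_real_affine) (use m in simp)
  also have "\<dots> = (\<integral>v. (1 / real m) * ((deriv ^^ d) S ((y - r) + (1 / real m) * v) * (deriv ^^ Suc 0) (moll_ind \<phi> y m) (r + ((y - r) + (1 / real m) * v))) \<partial>lborel)"
    by (simp del: funpow.simps)
  also have "\<dots> = (\<integral>v. \<phi> v * (deriv ^^ d) S (y - r + v / m) \<partial>lborel)"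
  proof (rule Bochner_Integration.integral_cong[OF refl])
    fix v
    have "(deriv ^^ Suc 0) (moll_ind \<phi> y m) (r + ((y - r) + (1 / real m) * v)) = real m * \<phi> v"
      unfolding moll_ind_Cb(2)[OF phi m] Cb_bump_cdf(2)[OF phi] using m by simp
    then show "(1 / real m) * ((deriv ^^ d) S ((y - r) + (1 / real m) * v) * (deriv ^^ Suc 0) (moll_ind \<phi> y m) (r + ((y - r) + (1 / real m) * v))) = \<phi> v * (deriv ^^ d) S (y - r + v / m)"
      using m by (simp del: funpow.simps)
  qed
  finally show ?thesis .
qed

text \<open>\<phi> acts as an approximate identity on a continuous derivative of S. The bound is
  uniform in m and r, as the dominated convergence over the remaining jumps requires.\<close>

lemma avg_U_moll_limit:
  assumes d: "d \<le> 2 * n"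
  shows "(\<lambda>m. avg U ((deriv ^^ Suc d) (moll_ind \<phi> y (Suc m))) r) \<longlonglongrightarrow> (-1) ^ d * (deriv ^^ d) S (y - r)"
    and "\<exists>K. \<forall>m r. \<bar>avg U ((deriv ^^ Suc d) (moll_ind \<phi> y (Suc m))) r\<bar> \<le> K"
proof -
  let ?T = "(deriv ^^ d) S"
  obtain B where B: "0 \<le> B" "\<And>x. \<bar>?T x\<bar> \<le> B" using S_bound[of d] d by auto
  have Tm[measurable]: "?T \<in> borel_measurable borel"
    using S_isCont[OF d] by (intro borel_measurable_continuous_onI continuous_at_imp_continuous_on) auto
  note [measurable] = bump_facts(4)[OF phi]
  have bd: "\<bar>\<phi> v * ?T z\<bar> \<le> \<phi> v * B" for v z
    using B bump_facts(1)[OF phi, of v] by (simp add: abs_mult mult_left_mono)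
  have iB: "integrable lborel (\<lambda>v. \<phi> v * B)" using bump_facts(5)[OF phi] by simp
  have "(\<lambda>m. \<integral>v. \<phi> v * ?T (y - r + v / Suc m) \<partial>lborel) \<longlonglongrightarrow> (\<integral>v. \<phi> v * ?T (y - r) \<partial>lborel)"
  proof (rule integral_dominated_convergence[where w="\<lambda>v. \<phi> v * B"])
    show "AE v in lborel. (\<lambda>m. \<phi> v * ?T (y - r + v / Suc m)) \<longlonglongrightarrow> \<phi> v * ?T (y - r)"
    proof (rule AE_I2)
      fix v
      have "(\<lambda>m. y - r + v * inverse (real (Suc m))) \<longlonglongrightarrow> y - r + v * 0"
        by (intro tendsto_intros LIMSEQ_inverse_real_of_nat)
      then have "(\<lambda>m. y - r + v / Suc m) \<longlonglongrightarrow> y - r" by (simp add: divide_inverse)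
      from isCont_tendsto_compose[OF S_isCont[OF d] this]
      show "(\<lambda>m. \<phi> v * ?T (y - r + v / Suc m)) \<longlonglongrightarrow> \<phi> v * ?T (y - r)" by (intro tendsto_intros)
    qed
  qed (use iB bd in auto)
  then have "(\<lambda>m. (-1) ^ d * (\<integral>v. \<phi> v * ?T (y - r + v / Suc m) \<partial>lborel)) \<longlonglongrightarrow> (-1) ^ d * (\<integral>v. \<phi> v * ?T (y - r) \<partial>lborel)"
    by (intro tendsto_intros)
  then show "(\<lambda>m. avg U ((deriv ^^ Suc d) (moll_ind \<phi> y (Suc m))) r) \<longlonglongrightarrow> (-1) ^ d * ?T (y - r)"
    unfolding avg_U_moll[OF zero_less_Suc d] using bump_facts(6)[OF phi] by simp
  have "\<bar>avg U ((deriv ^^ Suc d) (moll_ind \<phi> y (Suc m))) r\<bar> \<le> B" for m r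
  proof -
    have "\<bar>\<integral>v. \<phi> v * ?T (y - r + v / Suc m) \<partial>lborel\<bar> \<le> (\<integral>v. \<phi> v * B \<partial>lborel)"
    proof (rule integral_abs_bound_integral[OF _ iB])
      show "integrable lborel (\<lambda>v. \<phi> v * ?T (y - r + v / Suc m))"
        by (rule Bochner_Integration.integrable_bound[OF iB]) (use bd B bump_facts(1)[OF phi] in auto)
    qed (use bd in auto)
    then show ?thesis unfolding avg_U_moll[OF zero_less_Suc d] using bump_facts(6)[OF phi] by (simp add: abs_mult power_abs)
  qed
  then show "\<exists>K. \<forall>m r. \<bar>avg U ((deriv ^^ Suc d) (moll_ind \<phi> y (Suc m))) r\<bar> \<le> K" by blast
qed

text \<open>Pointwise convergence of the mollified indicators can fail only at the jump u = y - r, a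
  null set for a measure with a density.\<close>

lemma avg_U_moll_limit0:
  "(\<lambda>m. avg U (moll_ind \<phi> y (Suc m)) r) \<longlonglongrightarrow> avg U (\<lambda>x. of_bool (y \<le> x)) r"
proof -
  note C = Cb_measurable[OF moll_ind_Cb(1)[OF phi zero_less_Suc, of y]]
  note [measurable] = C
  have "(\<lambda>m. \<integral>u. S u * moll_ind \<phi> y (Suc m) (r + u) \<partial>lborel) \<longlonglongrightarrow> (\<integral>u. S u * of_bool (y \<le> r + u) \<partial>lborel)"
  proof (rule integral_dominated_convergence[where w=S])
    have "AE u in lborel. u \<noteq> y - r" by (rule AE_lborel_singleton)
    then show "AE u in lborel. (\<lambda>m. S u * moll_ind \<phi> y (Suc m) (r + u)) \<longlonglongrightarrow> S u * of_bool (y \<le> r + u)"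
    proof eventually_elim
      case (elim u)
      then have "r + u \<noteq> y" by auto
      from moll_limit_neq[OF phi this] show ?case by (intro tendsto_intros)
    qed
    show "AE u in lborel. norm (S u * moll_ind \<phi> y (Suc m) (r + u)) \<le> S u" for m
      using moll_bound[OF phi, of y m] S_nonneg by (auto simp: abs_mult intro!: mult_left_le)
  qed (use S_integrable in auto)
  then show ?thesis by (simp add: avg_U C)
qed

end

end

section \<open>The limits of the powers of the generator\<close>

context trunc_levy
begin

lemma levy_gen_power: "Cb f \<Longrightarrow> (levy_gen \<sigma> b \<nu> ^^ k) f = (Lop (b0 c \<nu>) (b1 c b \<nu>) (b2 \<sigma>) U V ^^ k) f"
proof (induction k)
  case (Suc k)
  have "Cb ((Lop (b0 c \<nu>) (b1 c b \<nu>) (b2 \<sigma>) U V ^^ k) f)"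
    using Suc.prems by (induction k) (auto intro: Cb_Lop fin_U fin_V)
  then show ?case using Suc by (simp add: levy_gen_Lop)
qed simp

text \<open>A shift under V is \<beta> w with \<beta> in [0, 1] and w in the support of c, so it
  moves a point by at most \<epsilon>.\<close>

lemma avg_V_vanish:
  assumes F: "Cb F" and z: "\<And>x. \<bar>x\<bar> \<le> R \<Longrightarrow> F x = 0" and x: "\<bar>x\<bar> + \<epsilon> \<le> R"
  shows "avg V F x = 0"
proof -
  obtain K where K: "\<And>x. \<bar>F x\<bar> \<le> K" using Cb_bound0[OF F] by blast
  note [measurable] = Cb_measurable[OF F]
  have "avg V F x = (\<integral>w. (c w * w\<^sup>2) * (\<integral>\<beta>. F (x + \<beta> * w) \<partial>taylor_meas) \<partial>\<nu>)"
    unfolding avg_def by (rule integral_V(1)[of "\<lambda>v. F (x + v)"]) (use K in auto)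
  also have "\<dots> = (\<integral>w. 0 \<partial>\<nu>)"
  proof (rule Bochner_Integration.integral_cong[OF refl])
    fix w
    show "(c w * w\<^sup>2) * (\<integral>\<beta>. F (x + \<beta> * w) \<partial>taylor_meas) = 0"
    proof (cases "\<epsilon> < \<bar>w\<bar>")
      case False
      have "(\<integral>\<beta>. F (x + \<beta> * w) \<partial>taylor_meas) = (LINT \<beta> : {0..1} | lborel. (1 - \<beta>) * F (x + \<beta> * w))"
        by (rule integral_taylor_meas) measurable
      also have "\<dots> = (LINT \<beta> : {0..1::real} | lborel. 0)"
      proof (rule set_lebesgue_integral_cong)
        show "\<forall>\<beta>. \<beta> \<in> {0..1} \<longrightarrow> (1 - \<beta>) * F (x + \<beta> * w) = 0"
        proof (intro allI impI)
          fix \<beta> :: real assume "\<beta> \<in> {0..1}"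
          then have "\<bar>\<beta> * w\<bar> \<le> 1 * \<epsilon>" unfolding abs_mult using False by (intro mult_mono) auto
          then have "\<bar>x + \<beta> * w\<bar> \<le> R" using x by linarith
          then show "(1 - \<beta>) * F (x + \<beta> * w) = 0" by (simp add: z)
        qed
      qed simp
      finally show ?thesis by (simp add: set_lebesgue_integral_def)
    qed (simp add: c_bounds)
  qed
  finally show ?thesis by simp
qed

text \<open>Every factor of the convolution power shrinks the interval on which the average vanishes
  by \<epsilon> at each end.\<close>

lemma avg_conv_pow_vanish:
  assumes F: "Cb F" and z: "\<And>x. \<bar>x\<bar> \<le> R \<Longrightarrow> F x = 0"
  shows "\<bar>x\<bar> + k * \<epsilon> \<le> R \<Longrightarrow> avg (conv_pow V k) F x = 0"
proof (induction k arbitrary: x)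
  case 0
  have "avg (conv_pow V 0) F x = F x"
    unfolding avg_def using Cb_measurable[OF F] by (simp add: integral_return)
  then show ?case using z[of x] 0 by simp
next
  case (Suc k)
  have P: "fin_borel (conv_pow V k)" by (rule fin_borel_conv_pow[OF fin_V])
  obtain K where K: "\<And>x. \<bar>F x\<bar> \<le> K" using Cb_bound0[OF F] by blast
  have "avg (conv_pow V (Suc k)) F x = avg V (avg (conv_pow V k) F) x"
    unfolding conv_pow.simps by (rule avg_convolution[OF fin_V P Cb_measurable[OF F] K])
  also have "\<dots> = 0"
  proof (rule avg_V_vanish[OF Cb_avg(1)[OF P F], where R="R - k * \<epsilon>"])
    show "avg (conv_pow V k) F x = 0" if "\<bar>x\<bar> \<le> R - k * \<epsilon>" for x by (rule Suc.IH) (use that in simp)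
    show "\<bar>x\<bar> + \<epsilon> \<le> R - k * \<epsilon>" using Suc.prems by (simp add: algebra_simps)
  qed
  finally show ?case .
qed

end

context dens_levy
begin

context
  fixes \<phi> :: "real \<Rightarrow> real" and y :: real
  assumes phi: "bump \<phi>" and y: "0 < y" "(real n + 1) * \<epsilon> < y"
begin

text \<open>Commutativity puts one big jump next to F. It smooths the singular function before the
  other averages are taken.\<close>

lemma avg_mix_Suc:
  assumes F: "F \<in> borel_measurable borel" "\<And>x. \<bar>F x\<bar> \<le> K"
  shows "avg (conv_mix U V (Suc k) l) F 0 = avg (conv_mix U V k l) (avg U F) 0"
proof -
  note P = fin_conv_mix[OF fin_U fin_V, of k l]
  have "conv_mix U V (Suc k) l = (U \<star> conv_mix U V k l)"
    by (rule conv_mix_Suc1[OF fin_U fin_V, symmetric])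
  also have "\<dots> = (conv_mix U V k l \<star> U)" by (rule conv_commute[OF fin_U P])
  finally show ?thesis using avg_convolution[OF P fin_U F] by simp
qed

lemma Lterm_limit_k3_0:
  assumes "k1 + 2 * k2 + 2 * k4 = l" "k4 \<le> n + 1"
  shows "(\<lambda>m. avg (conv_mix U V 0 k4) ((deriv ^^ l) (moll_ind \<phi> y (Suc m))) 0) \<longlonglongrightarrow> 0"
proof (rule tendsto_eventually)
  define R where "R = (real n + 1) * \<epsilon>"
  \<comment> \<open>The transition from 0 to 1 takes place within 1 / m of y, so from this index on
    it stays clear of [-R, R].\<close>
  obtain M :: nat where M: "1 / (y - R) < real M" using reals_Archimedean2 by blast
  have "avg (conv_mix U V 0 k4) ((deriv ^^ l) (moll_ind \<phi> y (Suc m))) 0 = 0" if m: "M \<le> m" for m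
  proof -
    let ?F = "(deriv ^^ l) (moll_ind \<phi> y (Suc m))"
    have C: "Cb ?F" by (rule Cb_derivs[OF moll_ind_Cb(1)[OF phi]]) simp
    have P: "fin_borel (conv_pow V k4)" by (rule fin_borel_conv_pow[OF fin_V])
    obtain K where K: "\<And>x. \<bar>?F x\<bar> \<le> K" using Cb_bound0[OF C] by blast
    have z: "?F x = 0" if x: "\<bar>x\<bar> \<le> R" for x
    proof -
      have "y - R > 0" using y by (simp add: R_def)
      moreover have "1 / (y - R) < real (Suc m)" using M m by linarith
      ultimately have "1 < real (Suc m) * (y - R)" by (simp add: divide_less_eq)
      also have "\<dots> \<le> real (Suc m) * (y - x)" using x by (intro mult_left_mono) auto
      finally have "real (Suc m) * (x - y) < -1" by (simp add: algebra_simps)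
      then show ?thesis unfolding moll_ind_Cb(2)[OF phi zero_less_Suc] by (simp add: deriv_bump_cdf_0(1)[OF phi])
    qed
    have "avg (conv_mix U V 0 k4) ?F 0 = avg (return borel 0) (avg (conv_pow V k4) ?F) 0"
      unfolding conv_mix_def conv_pow.simps(1) by (rule avg_convolution[OF fin_borel_return P Cb_measurable[OF C] K])
    also have "\<dots> = avg (conv_pow V k4) ?F 0"
      unfolding avg_def[of "return borel 0"] using Cb_measurable[OF Cb_avg(1)[OF P C]] by (simp add: integral_return)
    also have "\<dots> = 0"
    proof (rule avg_conv_pow_vanish[OF C z])
      have "real k4 * \<epsilon> \<le> R" unfolding R_def using assms(2) \<epsilon> by (intro mult_right_mono) auto
      then show "\<bar>0\<bar> + real k4 * \<epsilon> \<le> R" by simp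
    qed auto
    finally show ?thesis .
  qed
  then show "\<forall>\<^sub>F m in sequentially. avg (conv_mix U V 0 k4) ((deriv ^^ l) (moll_ind \<phi> y (Suc m))) 0 = 0"
    by (auto simp: eventually_sequentially intro!: exI[of _ M])
qed

lemma avg_mix_DC:
  assumes lim: "\<And>r. (\<lambda>m. G m r) \<longlonglongrightarrow> H r" and b: "\<And>m r. \<bar>G m r\<bar> \<le> K"
    and m[measurable]: "\<And>m::nat. G m \<in> borel_measurable borel"
  shows "(\<lambda>m. avg (conv_mix U V k l) (G m) 0) \<longlonglongrightarrow> avg (conv_mix U V k l) H 0"
proof -
  note P = fin_conv_mix[OF fin_U fin_V, of k l]
  have K: "0 \<le> K" using b[of 0 0] by linarith
  have Hm: "H \<in> borel_measurable borel" by (rule borel_measurable_LIMSEQ_metric[OF m lim])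
  show ?thesis unfolding avg_def
  proof (rule integral_dominated_convergence[where w="\<lambda>_. K"])
    show "integrable (conv_mix U V k l) (\<lambda>_. K)" by (rule fin_borel_integrable[OF P, where B=K]) (use K in auto)
    show "(\<lambda>v. H (0 + v)) \<in> borel_measurable (conv_mix U V k l)" "(\<lambda>v. G i (0 + v)) \<in> borel_measurable (conv_mix U V k l)" for i
      using Hm m by (auto intro: fin_borelD(4)[OF P])
  qed (use lim b in auto)
qed

text \<open>Of the \<open>Suc d\<close> derivatives, one turns the indicator into an approximate
  point mass at y and the other d end up on the density of one big jump; hence the order
  \<open>ell - 1\<close> in the coefficients.\<close>

lemma Lterm_limit_ell_pos:
  assumes d: "d \<le> 2 * n"
  shows "(\<lambda>m. avg (conv_mix U V (Suc k) l) ((deriv ^^ Suc d) (moll_ind \<phi> y (Suc m))) 0)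
    \<longlonglongrightarrow> (-1) ^ d * (\<integral>v. (deriv ^^ d) S (y - v) \<partial>conv_mix U V k l)"
proof -
  let ?F = "\<lambda>m. (deriv ^^ Suc d) (moll_ind \<phi> y (Suc m))"
  have C: "Cb (?F m)" for m by (rule Cb_derivs[OF moll_ind_Cb(1)[OF phi]]) simp
  have eq: "avg (conv_mix U V (Suc k) l) (?F m) 0 = avg (conv_mix U V k l) (avg U (?F m)) 0" for m
  proof -
    obtain K where K: "\<And>x. \<bar>?F m x\<bar> \<le> K" using Cb_bound0[OF C] by blast
    show ?thesis by (rule avg_mix_Suc[OF Cb_measurable[OF C] K])
  qed
  obtain K where K: "\<And>m r. \<bar>avg U (?F m) r\<bar> \<le> K" using avg_U_moll_limit(2)[OF phi d, of y] by blast
  have "(\<lambda>m. avg (conv_mix U V k l) (avg U (?F m)) 0) \<longlonglongrightarrow> avg (conv_mix U V k l) (\<lambda>r. (-1) ^ d * (deriv ^^ d) S (y - r)) 0"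
    by (rule avg_mix_DC[OF avg_U_moll_limit(1)[OF phi d] K Cb_measurable[OF Cb_avg(1)[OF fin_U C]]])
  then show ?thesis unfolding eq by (simp add: avg_def)
qed

lemma Lterm_limit_ell_0:
  "(\<lambda>m. avg (conv_mix U V (Suc k) l) (moll_ind \<phi> y (Suc m)) 0) \<longlonglongrightarrow> (\<integral>v. of_bool (y \<le> v) \<partial>conv_mix U V (Suc k) l)"
proof -
  let ?F = "\<lambda>m. moll_ind \<phi> y (Suc m)"
  have C: "Cb (?F m)" for m by (rule moll_ind_Cb(1)[OF phi]) simp
  have eq: "avg (conv_mix U V (Suc k) l) (?F m) 0 = avg (conv_mix U V k l) (avg U (?F m)) 0" for m
    by (rule avg_mix_Suc[OF Cb_measurable[OF C] moll_bound[OF phi]])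
  have "(\<lambda>m. avg (conv_mix U V k l) (avg U (?F m)) 0) \<longlonglongrightarrow> avg (conv_mix U V k l) (avg U (\<lambda>x. of_bool (y \<le> x))) 0"
    by (rule avg_mix_DC[OF avg_U_moll_limit0[OF phi] avg_bound[OF fin_U moll_bound[OF phi] Cb_measurable[OF C]] Cb_measurable[OF Cb_avg(1)[OF fin_U C]]])
  also have "avg (conv_mix U V k l) (avg U (\<lambda>x. of_bool (y \<le> x))) 0 = avg (conv_mix U V (Suc k) l) (\<lambda>x. of_bool (y \<le> x)) 0"
    by (rule avg_mix_Suc[symmetric, where K=1]) auto
  finally show ?thesis unfolding eq by (simp add: avg_def)
qed

lemma Lterm_limit:
  assumes kk: "kk \<in> multis k" and k: "k \<le> n + 1"
  shows "(\<lambda>m. Lterm (b0 c \<nu>) (b1 c b \<nu>) (b2 \<sigma>) U V (moll_ind \<phi> y (Suc m)) kk 0) \<longlonglongrightarrow> c_hat c \<sigma> b \<nu> kk * a_coeff c s \<nu> y kk"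
proof -
  obtain k0 k1 k2 k3 k4 where kk': "kk = (k0, k1, k2, k3, k4)" by (cases kk rule: prod_cases5)
  have sum: "k0 + k1 + k2 + k3 + k4 = k" using kk by (simp add: kk' multis_def)
  define l where "l = k1 + 2 * k2 + 2 * k4"
  define C where "C = b0 c \<nu> ^ k0 * b1 c b \<nu> ^ k1 * b2 \<sigma> ^ k2"
  have L: "Lterm (b0 c \<nu>) (b1 c b \<nu>) (b2 \<sigma>) U V f kk 0 = C * avg (conv_mix U V k3 k4) ((deriv ^^ l) f) 0" for f
    by (simp add: kk' C_def l_def)
  have ch: "c_hat c \<sigma> b \<nu> kk = C * (-1) powi ((int k1 - 1) * of_bool (l > 0))"
    by (simp add: kk' C_def l_def)
  consider "k3 = 0" | "k3 > 0" "l > 0" | "k3 > 0" "l = 0" by blast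
  then show ?thesis
  proof cases
    case 1
    have "(\<lambda>m. C * avg (conv_mix U V 0 k4) ((deriv ^^ l) (moll_ind \<phi> y (Suc m))) 0) \<longlonglongrightarrow> C * 0"
      by (intro tendsto_mult tendsto_const Lterm_limit_k3_0[of k1 k2]) (use sum k l_def in auto)
    moreover have "a_coeff c s \<nu> y kk = 0" by (simp add: kk' 1)
    ultimately show ?thesis unfolding L using 1 by simp
  next
    case 2
    obtain k' where k': "k3 = Suc k'" using 2 by (cases k3) auto
    obtain d where d: "l = Suc d" using 2 by (cases l) auto
    \<comment> \<open>The big jump takes one of at most n + 1 factors, and each of the remaining n
      contributes at most two derivatives.\<close>
    have dn: "d \<le> 2 * n" using sum k k' d by (simp add: l_def)
    have f: "finite {2..k3}" "finite {1..k4}" by auto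
    have cards: "card {2..k3} = k'" "card {1..k4} = k4" using k' by auto
    have "continuous_on UNIV ((deriv ^^ d) S)" using S_isCont[OF dn] by (intro continuous_at_imp_continuous_on) auto
    then have Tm[measurable]: "(deriv ^^ d) S \<in> borel_measurable borel" by (rule borel_measurable_continuous_onI)
    have "a_coeff c s \<nu> y kk = (\<integral>(u, w, \<beta>). (deriv ^^ d) S (y - (\<Sum>i=2..k3. u i) - (\<Sum>j=1..k4. \<beta> j * w j)) \<partial>coord_measure c \<nu> {2..k3} {1..k4})"
      using 2 d by (simp add: kk' l_def S_def[abs_def])
    also have "\<dots> = (\<integral>p. (deriv ^^ d) S (y - (case p of (u, w, \<beta>) \<Rightarrow> (\<Sum>i=2..k3. u i) + (\<Sum>j=1..k4. \<beta> j * w j))) \<partial>coord_measure c \<nu> {2..k3} {1..k4})"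
      by (rule Bochner_Integration.integral_cong) (auto simp: algebra_simps)
    also have "\<dots> = (\<integral>v. (deriv ^^ d) S (y - v) \<partial>distr (coord_measure c \<nu> {2..k3} {1..k4}) borel (\<lambda>(u, w, \<beta>). (\<Sum>i=2..k3. u i) + (\<Sum>j=1..k4. \<beta> j * w j)))"
      by (rule integral_distr[symmetric, OF distr_coord(2)[OF f]]) measurable
    also have "\<dots> = (\<integral>v. (deriv ^^ d) S (y - v) \<partial>conv_mix U V k' k4)"
      unfolding distr_coord(1)[OF f] cards ..
    finally have ac: "a_coeff c s \<nu> y kk = (\<integral>v. (deriv ^^ d) S (y - v) \<partial>conv_mix U V k' k4)" .
    \<comment> \<open>\<open>l\<close> has the parity of \<open>k1\<close>, so
      \<open>d = l - 1\<close> has that of \<open>k1 - 1\<close>. For \<open>k1 = 0\<close> the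
      exponent is -1, which is why it is an integer power.\<close>
    have sgn: "(-1::real) powi ((int k1 - 1) * of_bool (l > 0)) = (-1) ^ d"
    proof (cases k1)
      case 0
      then have "odd d" using d by (auto simp: l_def) presburger
      then show ?thesis using 0 2 by (simp add: power_int_minus)
    next
      case (Suc j)
      then have "d = j + 2 * (k2 + k4)" using d by (simp add: l_def)
      then show ?thesis using Suc 2 by (simp add: power_add power_mult)
    qed
    show ?thesis unfolding L ch sgn ac mult.assoc unfolding k' d
      by (intro tendsto_mult tendsto_const Lterm_limit_ell_pos dn)
  next
    case 3
    obtain k' where k': "k3 = Suc k'" using 3 by (cases k3) auto
    have z: "k1 = 0" "k2 = 0" "k4 = 0" using 3 by (auto simp: l_def)
    have f: "finite {1..k3}" "finite {1..k4}" by auto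
    have "a_coeff c s \<nu> y kk = (\<integral>(u, w, \<beta>). of_bool ((\<Sum>i=1..k3. u i) \<ge> y) \<partial>coord_measure c \<nu> {1..k3} {1..k4})"
      using 3 by (simp add: kk' z)
    also have "\<dots> = (\<integral>p. of_bool (y \<le> (case p of (u, w, \<beta>) \<Rightarrow> (\<Sum>i=1..k3. u i) + (\<Sum>j=1..k4. \<beta> j * w j))) \<partial>coord_measure c \<nu> {1..k3} {1..k4})"
      by (rule Bochner_Integration.integral_cong) (auto simp: z)
    also have "\<dots> = (\<integral>v. of_bool (y \<le> v) \<partial>distr (coord_measure c \<nu> {1..k3} {1..k4}) borel (\<lambda>(u, w, \<beta>). (\<Sum>i=1..k3. u i) + (\<Sum>j=1..k4. \<beta> j * w j)))"
      by (rule integral_distr[symmetric, OF distr_coord(2)[OF f]]) measurable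
    also have "\<dots> = (\<integral>v. of_bool (y \<le> v) \<partial>conv_mix U V k3 k4)"
      unfolding distr_coord(1)[OF f] by simp
    finally have ac: "a_coeff c s \<nu> y kk = (\<integral>v. of_bool (y \<le> v) \<partial>conv_mix U V k3 k4)" .
    have "(\<lambda>m. C * avg (conv_mix U V k3 k4) (moll_ind \<phi> y (Suc m)) 0) \<longlonglongrightarrow> C * (\<integral>v. of_bool (y \<le> v) \<partial>conv_mix U V k3 k4)"
      unfolding k' by (intro tendsto_mult tendsto_const Lterm_limit_ell_0)
    then show ?thesis unfolding L ch ac using 3 by simp
  qed
qed

lemma levy_gen_power_limit:
  assumes k: "k \<le> n + 1"
  shows "gen_seq \<phi> \<sigma> b \<nu> k y \<longlonglongrightarrow> (\<Sum>kk\<in>multis k. c_hat c \<sigma> b \<nu> kk * multinom kk * a_coeff c s \<nu> y kk)"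
proof -
  have "(\<lambda>m. \<Sum>kk\<in>multis k. multinom kk * Lterm (b0 c \<nu>) (b1 c b \<nu>) (b2 \<sigma>) U V (moll_ind \<phi> y (Suc m)) kk 0)
    \<longlonglongrightarrow> (\<Sum>kk\<in>multis k. multinom kk * (c_hat c \<sigma> b \<nu> kk * a_coeff c s \<nu> y kk))"
    by (intro tendsto_sum tendsto_mult tendsto_const Lterm_limit[OF _ k])
  also have "(\<lambda>m. \<Sum>kk\<in>multis k. multinom kk * Lterm (b0 c \<nu>) (b1 c b \<nu>) (b2 \<sigma>) U V (moll_ind \<phi> y (Suc m)) kk 0)
     = (\<lambda>m. gen_seq \<phi> \<sigma> b \<nu> k y (Suc m))"
  proof
    fix m
    have C: "Cb (moll_ind \<phi> y (Suc m))" by (rule moll_ind_Cb(1)[OF phi]) simp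
    show "(\<Sum>kk\<in>multis k. multinom kk * Lterm (b0 c \<nu>) (b1 c b \<nu>) (b2 \<sigma>) U V (moll_ind \<phi> y (Suc m)) kk 0) = gen_seq \<phi> \<sigma> b \<nu> k y (Suc m)"
      unfolding gen_seq_def levy_gen_power[OF C] Lop_power[OF fin_U fin_V C] ..
  qed
  finally have "gen_seq \<phi> \<sigma> b \<nu> k y \<longlonglongrightarrow> (\<Sum>kk\<in>multis k. multinom kk * (c_hat c \<sigma> b \<nu> kk * a_coeff c s \<nu> y kk))"
    by (simp only: filterlim_sequentially_Suc)
  then show ?thesis by (simp add: mult_ac)
qed

end

end

section \<open>Absence of atoms\<close>

lemma cesaro_null:
  fixes a :: "nat \<Rightarrow> complex"
  assumes lim: "a \<longlonglongrightarrow> 0"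
  shows "(\<lambda>N. (\<Sum>k<N. a k) / of_nat N) \<longlonglongrightarrow> 0"
proof (rule LIMSEQ_I)
  fix e :: real assume e: "0 < e"
  obtain K where K: "\<And>k. K \<le> k \<Longrightarrow> norm (a k) < e / 2"
    using LIMSEQ_D[OF lim, of "e / 2"] e by auto
  define C where "C = (\<Sum>k<K. norm (a k))"
  have C: "0 \<le> C" unfolding C_def by (rule sum_nonneg) auto
  obtain N0 :: nat where N0: "2 * C / e < N0" using reals_Archimedean2 by blast
  have "norm ((\<Sum>k<N. a k) / of_nat N - 0) < e" if N: "max K (Suc N0) \<le> N" for N
  proof -
    have "norm (\<Sum>k<N. a k) \<le> (\<Sum>k<N. norm (a k))" by (rule norm_sum)
    also have "\<dots> = C + (\<Sum>k\<in>{K..<N}. norm (a k))"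
      unfolding C_def using N by (subst sum.union_disjoint[symmetric]) (auto intro!: sum.cong)
    also have "(\<Sum>k\<in>{K..<N}. norm (a k)) \<le> (\<Sum>k\<in>{K..<N}. e / 2)"
      using K by (intro sum_mono) (auto intro: less_imp_le)
    also have "\<dots> \<le> real N * (e / 2)" using e by (simp add: mult_right_mono)
    finally have 1: "norm (\<Sum>k<N. a k) \<le> C + real N * (e / 2)" by simp
    have "2 * C / e < real N" using N0 N by linarith
    then have "C < real N * (e / 2)" using e by (simp add: divide_less_eq algebra_simps)
    with 1 have "norm (\<Sum>k<N. a k) < real N * e" by simp
    moreover have "0 < N" using N by simp
    ultimately show ?thesis by (simp add: norm_divide divide_less_eq mult.commute)
  qed
  then show "\<exists>no. \<forall>N\<ge>no. norm ((\<Sum>k<N. a k) / of_nat N - 0) < e" by blast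
qed

text \<open>For z \<noteq> 1 the geometric sums stay bounded by 2 / |z - 1|, so their averages
  vanish.\<close>

lemma cesaro_geometric:
  fixes z :: complex
  assumes "cmod z = 1"
  shows "(\<lambda>N. (\<Sum>k<N. z ^ k) / of_nat N) \<longlonglongrightarrow> (if z = 1 then 1 else 0)"
proof (cases "z = 1")
  case True
  have "\<forall>\<^sub>F N in sequentially. (\<Sum>k<N. z ^ k) / of_nat N = 1"
    using eventually_gt_at_top[of 0] by eventually_elim (simp add: True)
  then show ?thesis using True by (simp add: tendsto_eventually)
next
  case False
  have "(\<lambda>N. 2 / cmod (z - 1) * inverse (real N)) \<longlonglongrightarrow> 2 / cmod (z - 1) * 0"
    by (intro tendsto_intros lim_inverse_n)
  then have 0: "(\<lambda>N. 2 / cmod (z - 1) * inverse (real N)) \<longlonglongrightarrow> 0" by simp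
  have "norm ((\<Sum>k<N. z ^ k) / of_nat N) \<le> 2 / cmod (z - 1) * inverse (real N)" for N
  proof -
    have "cmod (z ^ N - 1) \<le> cmod (z ^ N) + cmod 1" by (rule norm_triangle_ineq4)
    then have "cmod (z ^ N - 1) \<le> 2" using assms by (simp add: norm_power)
    moreover have "(\<Sum>k<N. z ^ k) = (z ^ N - 1) / (z - 1)" using False by (simp add: sum_gp_strict field_simps)
    ultimately have "norm ((\<Sum>k<N. z ^ k) / of_nat N) = cmod (z ^ N - 1) / cmod (z - 1) / real N"
      by (simp add: norm_divide norm_mult)
    also have "\<dots> \<le> 2 / cmod (z - 1) / real N"
      using \<open>cmod (z ^ N - 1) \<le> 2\<close> by (intro divide_right_mono) auto
    finally show ?thesis by (simp only: divide_inverse)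
  qed
  then have "(\<lambda>N. (\<Sum>k<N. z ^ k) / of_nat N) \<longlonglongrightarrow> 0"
    by (intro Lim_null_comparison[OF _ 0]) auto
  then show ?thesis using False by simp
qed

text \<open>The averages of \<open>iexp (- k \<eta> y) * char \<rho> (k \<eta>)\<close> over \<open>k\<close> tend to the mass of the coset of
  \<open>(2 \<pi> / \<eta>) \<int>\<close> that contains \<open>y\<close>.\<close>

lemma no_atom:
  assumes "real_distribution \<rho>"
    and lim: "(\<lambda>k. char \<rho> (real k * \<eta>) - C * iexp (real k * \<eta> * a)) \<longlonglongrightarrow> 0"
    and ne: "iexp (\<eta> * (a - y)) \<noteq> 1"
  shows "measure \<rho> {y} = 0"
proof -
  interpret real_distribution \<rho> by fact
  define w where "w x = iexp (\<eta> * (x - y))" for x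
  have w: "cmod (w x) = 1" for x by (simp add: w_def)
  have wp: "w x ^ k = iexp (- (real k * \<eta> * y)) * iexp (real k * \<eta> * x)" for k x
    by (simp add: w_def exp_of_nat_mult[symmetric] exp_add[symmetric] algebra_simps)
  have wm[measurable]: "w \<in> borel_measurable borel" unfolding w_def[abs_def] by measurable
  define A where "A N = (\<Sum>k<N. iexp (- (real k * \<eta> * y)) * char \<rho> (real k * \<eta>)) / of_nat N" for N
  have A_eq: "A N = (\<integral>x. (\<Sum>k<N. w x ^ k) / of_nat N \<partial>\<rho>)" for N
  proof -
    have i: "complex_integrable \<rho> (\<lambda>x. w x ^ k)" for k
      by (rule integrable_const_bound[of _ 1]) (auto simp: norm_power w)
    have "iexp (- (real k * \<eta> * y)) * char \<rho> (real k * \<eta>) = (\<integral>x. w x ^ k \<partial>\<rho>)" for k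
      unfolding char_def wp by (subst integral_mult_right_zero) simp
    then show ?thesis unfolding A_def by (simp add: Bochner_Integration.integral_sum i)
  qed
  have "(\<lambda>N. \<integral>x. (\<Sum>k<N. w x ^ k) / of_nat N \<partial>\<rho>) \<longlonglongrightarrow> (\<integral>x. (if w x = 1 then 1 else 0) \<partial>\<rho>)"
  proof (rule integral_dominated_convergence[where w="\<lambda>_. 1"])
    show "AE x in \<rho>. norm ((\<Sum>k<N. w x ^ k) / of_nat N) \<le> 1" for N
    proof (rule AE_I2)
      fix x
      have "cmod (\<Sum>k<N. w x ^ k) \<le> (\<Sum>k<N. cmod (w x ^ k))" by (rule norm_sum)
      then have "cmod (\<Sum>k<N. w x ^ k) \<le> real N" by (simp add: norm_power w)
      then show "norm ((\<Sum>k<N. w x ^ k) / of_nat N) \<le> 1" by (simp add: norm_divide divide_le_eq)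
    qed
    show "AE x in \<rho>. (\<lambda>N. (\<Sum>k<N. w x ^ k) / of_nat N) \<longlonglongrightarrow> (if w x = 1 then 1 else 0)"
      using cesaro_geometric[OF w] by simp
  qed auto
  then have lim1: "A \<longlonglongrightarrow> (\<integral>x. (if w x = 1 then 1 else 0) \<partial>\<rho>)" unfolding A_eq[abs_def] .
  \<comment> \<open>The wave allowed in the hypothesis averages out: its contribution is a multiple
    of the mean of the powers of \<open>w a\<close>, a unit number different from 1.\<close>
  have "A \<longlonglongrightarrow> 0"
  proof -
    let ?b = "\<lambda>k. iexp (- (real k * \<eta> * y)) * (char \<rho> (real k * \<eta>) - C * iexp (real k * \<eta> * a))"
    have "(\<lambda>k. norm (?b k)) \<longlonglongrightarrow> 0" using tendsto_norm_zero[OF lim] by (simp add: norm_mult)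
    then have "?b \<longlonglongrightarrow> 0" by (rule tendsto_norm_zero_cancel)
    from cesaro_null[OF this]
    have "(\<lambda>N. (\<Sum>k<N. ?b k) / of_nat N + C * ((\<Sum>k<N. w a ^ k) / of_nat N)) \<longlonglongrightarrow> 0 + C * 0"
      using cesaro_geometric[OF w, of a] ne by (intro tendsto_intros) (auto simp: w_def)
    moreover have "(\<Sum>k<N. ?b k) / of_nat N + C * ((\<Sum>k<N. w a ^ k) / of_nat N) = A N" for N
    proof -
      have "?b k = iexp (- (real k * \<eta> * y)) * char \<rho> (real k * \<eta>) - C * w a ^ k" for k
        unfolding wp by (simp add: algebra_simps)
      then show ?thesis unfolding A_def by (simp add: sum_subtractf sum_distrib_left[symmetric] diff_divide_distrib)
    qed
    ultimately show ?thesis by simp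
  qed
  then have "(\<integral>x. (if w x = 1 then 1 else 0 :: complex) \<partial>\<rho>) = 0" using lim1 LIMSEQ_unique by blast
  moreover have "(\<integral>x. (if w x = 1 then 1 else 0 :: complex) \<partial>\<rho>) = of_real (measure \<rho> {x. w x = 1})"
  proof -
    have "(\<integral>x. (if w x = 1 then 1 else 0 :: complex) \<partial>\<rho>) = (\<integral>x. of_real (indicat_real {x. w x = 1} x) \<partial>\<rho>)"
      by (rule Bochner_Integration.integral_cong) (auto simp: indicator_def)
    also have "\<dots> = of_real (measure \<rho> {x. w x = 1})" by simp
    finally show ?thesis .
  qed
  ultimately have "measure \<rho> {x. w x = 1} = 0" by simp
  moreover have "measure \<rho> {y} \<le> measure \<rho> {x. w x = 1}"
    by (rule finite_measure_mono) (auto simp: w_def)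
  ultimately show ?thesis using measure_nonneg[of \<rho> "{y}"] by linarith
qed

section \<open>Decay of the characteristic function\<close>

context dens_levy
begin

text \<open>By parts on [-R, R], where the antiderivative of the wave gains a factor 1 / |\<xi>|;
  outside, S has little mass. The phase covers the sine transform as well.\<close>

lemma riemann_lebesgue:
  assumes n: "1 \<le> n" and \<xi>: "filterlim (\<lambda>k::nat. \<bar>\<xi> k\<bar>) at_top sequentially"
  shows "(\<lambda>k. avg U (\<lambda>x. cos (\<xi> k * x + \<theta>)) 0) \<longlonglongrightarrow> 0"
proof (rule LIMSEQ_I)
  fix e :: real assume e: "0 < e"
  obtain B where B: "0 \<le> B" "\<And>x. \<bar>(deriv ^^ 0) S x\<bar> \<le> B" using S_bound[of 0] by auto
  obtain B' where B': "0 \<le> B'" "\<And>x. \<bar>(deriv ^^ 1) S x\<bar> \<le> B'" using S_bound[of 1] n by auto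
  have "(\<lambda>R. \<integral>u. S u * indicat_real {- real R..real R} u \<partial>lborel) \<longlonglongrightarrow> (\<integral>u. S u \<partial>lborel)"
  proof (rule integral_dominated_convergence[where w=S])
    show "AE u in lborel. (\<lambda>R. S u * indicat_real {- real R..real R} u) \<longlonglongrightarrow> S u"
    proof (rule AE_I2)
      fix u
      obtain N :: nat where N: "\<bar>u\<bar> < real N" using reals_Archimedean2[of "\<bar>u\<bar>"] by (elim exE)
      have "S u * indicat_real {- real R..real R} u = S u" if "N \<le> R" for R
      proof -
        have "real N \<le> real R" using that by simp
        then have "u \<in> {- real R..real R}" using N by auto
        then show ?thesis by simp
      qed
      then show "(\<lambda>R. S u * indicat_real {- real R..real R} u) \<longlonglongrightarrow> S u"
        by (intro tendsto_eventually) (auto simp: eventually_sequentially intro!: exI[of _ N])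
    qed
  qed (use S_integrable S_nonneg in \<open>auto simp: indicator_def\<close>)
  from LIMSEQ_D[OF this, of "e / 2"] e obtain R :: nat
    where "norm ((\<integral>u. S u * indicat_real {- real R..real R} u \<partial>lborel) - (\<integral>u. S u \<partial>lborel)) < e / 2" by auto
  then have R: "(\<integral>u. S u \<partial>lborel) - (\<integral>u. S u * indicat_real {- real R..real R} u \<partial>lborel) < e / 2" by (simp add: abs_if split: if_splits)
  have iS: "integrable lborel (\<lambda>u. S u * indicat_real {- real R..real R} u)"
    by (rule Bochner_Integration.integrable_bound[OF S_integrable]) (auto simp: indicator_def)
  \<comment> \<open>Two boundary terms of size at most B, and an integral of the derivative, bounded
    by \<open>B'\<close>, over length 2 R.\<close>
  define K where "K = 2 * B + B' * (2 * real R)"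
  have K: "0 \<le> K" unfolding K_def using B B' by simp
  have main: "\<bar>avg U (\<lambda>x. cos (x0 * x + \<theta>)) 0\<bar> \<le> K / \<bar>x0\<bar> + e / 2" if x0: "x0 \<noteq> 0" for x0
  proof -
    let ?I = "indicat_real {- real R..real R}"
    let ?c = "\<lambda>u. cos (x0 * u + \<theta>)" and ?s = "\<lambda>u. sin (x0 * u + \<theta>) / x0"
    have iC: "integrable lborel (\<lambda>u. S u * ?c u)"
      by (rule Bochner_Integration.integrable_bound[OF S_integrable]) (auto simp: abs_mult intro!: mult_left_le)
    have iCI: "integrable lborel (\<lambda>u. S u * ?c u * ?I u)"
      by (rule Bochner_Integration.integrable_bound[OF S_integrable]) (auto simp: abs_mult indicator_def intro!: mult_left_le)
    have Dc: "(?s has_real_derivative ?c x) (at x)" for x using x0 by (auto intro!: derivative_eq_intros)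
    have sb: "\<bar>?s x\<bar> \<le> 1 / \<bar>x0\<bar>" for x by (simp add: abs_divide divide_right_mono)
    have S1c: "isCont (deriv S) x" for x using S_isCont[of 1 x] n by simp
    have DS: "(S has_real_derivative deriv S x) (at x)" for x using S_DERIV[of 0 x] by simp
    have "(\<integral>u. (S u * ?c u) * ?I u \<partial>lborel) = S R * ?s R - S (- real R) * ?s (- real R) - (\<integral>u. (deriv S u * ?s u) * ?I u \<partial>lborel)"
      by (rule integral_by_parts[OF _ S1c _ DS Dc]) (auto intro!: continuous_intros)
    moreover have "\<bar>S R * ?s R\<bar> \<le> B * (1 / \<bar>x0\<bar>)" "\<bar>S (- real R) * ?s (- real R)\<bar> \<le> B * (1 / \<bar>x0\<bar>)"
      unfolding abs_mult by (intro mult_mono B(2)[simplified] sb abs_ge_zero B(1))+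
    moreover have "\<bar>\<integral>u. (deriv S u * ?s u) * ?I u \<partial>lborel\<bar> \<le> (\<integral>u. B' * (1 / \<bar>x0\<bar>) * ?I u \<partial>lborel)"
    proof (rule integral_abs_bound_integral)
      have "continuous_on {- real R..real R} (\<lambda>u. deriv S u * ?s u)"
        using x0 by (intro continuous_intros continuous_at_imp_continuous_on ballI S1c) auto
      then have "set_integrable lborel {- real R..real R} (\<lambda>u. deriv S u * ?s u)" by (rule borel_integrable_atLeastAtMost')
      then show "integrable lborel (\<lambda>u. (deriv S u * ?s u) * ?I u)" by (simp add: set_integrable_def mult.commute)
      fix u
      have "\<bar>deriv S u * ?s u\<bar> \<le> B' * (1 / \<bar>x0\<bar>)"
        unfolding abs_mult using B' sb[of u] by (intro mult_mono) auto
      then show "\<bar>deriv S u * ?s u * ?I u\<bar> \<le> B' * (1 / \<bar>x0\<bar>) * ?I u" by (auto simp: indicator_def)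
    qed auto
    moreover have "(\<integral>u. B' * (1 / \<bar>x0\<bar>) * ?I u \<partial>lborel) = B' * (1 / \<bar>x0\<bar>) * (2 * real R)" by simp
    moreover have "K / \<bar>x0\<bar> = B * (1 / \<bar>x0\<bar>) + B * (1 / \<bar>x0\<bar>) + B' * (1 / \<bar>x0\<bar>) * (2 * real R)"
      by (simp add: K_def add_divide_distrib)
    ultimately have 1: "\<bar>\<integral>u. (S u * ?c u) * ?I u \<partial>lborel\<bar> \<le> K / \<bar>x0\<bar>"
      by linarith
    have "\<bar>(\<integral>u. S u * ?c u \<partial>lborel) - (\<integral>u. (S u * ?c u) * ?I u \<partial>lborel)\<bar> = \<bar>\<integral>u. S u * ?c u - (S u * ?c u) * ?I u \<partial>lborel\<bar>"
      using iC iCI by simp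
    also have "\<dots> \<le> (\<integral>u. S u - S u * ?I u \<partial>lborel)"
      by (rule integral_abs_bound_integral) (use iC iCI S_integrable iS S_nonneg in \<open>auto simp: indicator_def abs_mult intro!: mult_left_le\<close>)
    also have "\<dots> < e / 2" using R S_integrable iS by simp
    finally have 2: "\<bar>(\<integral>u. S u * ?c u \<partial>lborel) - (\<integral>u. (S u * ?c u) * ?I u \<partial>lborel)\<bar> < e / 2" .
    have "avg U (\<lambda>x. cos (x0 * x + \<theta>)) 0 = (\<integral>u. S u * ?c u \<partial>lborel)" by (subst avg_U) auto
    then show ?thesis using 1 2 by linarith
  qed
  have "eventually (\<lambda>k. max 1 (2 * K / e + 1) \<le> \<bar>\<xi> k\<bar>) sequentially"
    using \<xi> unfolding filterlim_at_top by blast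
  then obtain N where N: "\<And>k. N \<le> k \<Longrightarrow> max 1 (2 * K / e + 1) \<le> \<bar>\<xi> k\<bar>" by (auto simp: eventually_sequentially)
  have "norm (avg U (\<lambda>x. cos (\<xi> k * x + \<theta>)) 0 - 0) < e" if "N \<le> k" for k
  proof -
    have x: "1 \<le> \<bar>\<xi> k\<bar>" "2 * K / e < \<bar>\<xi> k\<bar>" using N[OF that] by auto
    then have "K / \<bar>\<xi> k\<bar> < e / 2" using e by (simp add: divide_less_eq mult.commute)
    moreover have "\<xi> k \<noteq> 0" using x by auto
    ultimately have "\<bar>avg U (\<lambda>x. cos (\<xi> k * x + \<theta>)) 0\<bar> < e" using main[of "\<xi> k"] by linarith
    then show ?thesis by simp
  qed
  then show "\<exists>no. \<forall>k\<ge>no. norm (avg U (\<lambda>x. cos (\<xi> k * x + \<theta>)) 0 - 0) < e" by blast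
qed

end

context dens_levy
begin

text \<open>Since cos - 1 \<le> 0, dropping the part weighted by c only increases the integral; the
  big jumps leave their cosine transform minus their mass.\<close>

lemma Re_psi_le:
  "Re (psi \<sigma> b \<nu> \<xi>) \<le> - (\<sigma>\<^sup>2 * \<xi>\<^sup>2 / 2) - (measure U UNIV - avg U (\<lambda>x. cos (\<xi> * x + 0)) 0)"
proof -
  note [measurable_cong] = sn
  interpret UF: finite_measure U using fin_borelD(1)[OF fin_U] .
  have pi: "integrable \<nu> (psi_fun \<xi>)"
    by (rule levy_measure_integrable[OF \<nu> _ psi_fun_bound]) measurable
  have "Re (\<integral>u. psi_fun \<xi> u \<partial>\<nu>) = (\<integral>u. Re (psi_fun \<xi> u) \<partial>\<nu>)" by (rule integral_Re[symmetric, OF pi])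
  also have "\<dots> \<le> (\<integral>u. (1 - c u) * (cos (\<xi> * u) - 1) \<partial>\<nu>)"
  proof (rule integral_mono)
    show "integrable \<nu> (\<lambda>u. Re (psi_fun \<xi> u))" by (rule integrable_Re[OF pi])
    show "integrable \<nu> (\<lambda>u. (1 - c u) * (cos (\<xi> * u) - 1))"
    proof (rule Bochner_Integration.integrable_bound[OF integrable_mult_left[OF big_integrable, of 2]])
      have "\<bar>cos (\<xi> * u) - 1\<bar> \<le> 2" for u using cos_le_one[of "\<xi> * u"] cos_ge_minus_one[of "\<xi> * u"] by linarith
      then have "\<bar>1 - c u\<bar> * \<bar>cos (\<xi> * u) - 1\<bar> \<le> \<bar>1 - c u\<bar> * 2" for u by (intro mult_left_mono) auto
      then show "AE u in \<nu>. norm ((1 - c u) * (cos (\<xi> * u) - 1)) \<le> norm ((1 - c u) * 2)"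
        unfolding real_norm_def abs_mult by simp
    qed measurable
    fix u
    have "c u * (cos (\<xi> * u) - 1) \<le> 0" using c_bounds(1)[of u] by (intro mult_nonneg_nonpos) auto
    then show "Re (psi_fun \<xi> u) \<le> (1 - c u) * (cos (\<xi> * u) - 1)"
      by (simp add: psi_fun_def Re_exp algebra_simps)
  qed
  also have "\<dots> = (\<integral>u. (cos (\<xi> * u) - 1) \<partial>U)"
    unfolding big_meas_def by (subst integral_real_density) (auto simp: c_bounds)
  also have "\<dots> = (\<integral>u. cos (\<xi> * u) \<partial>U) - (\<integral>u. 1 \<partial>U)"
  proof (rule Bochner_Integration.integral_diff)
    show "integrable U (\<lambda>u. cos (\<xi> * u))" by (rule fin_borel_integrable[OF fin_U, where B=1]) auto
  qed simp
  also have "\<dots> = avg U (\<lambda>x. cos (\<xi> * x + 0)) 0 - measure U UNIV"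
    using fin_borelD(3)[OF fin_U] by (simp add: avg_def)
  finally show ?thesis by (simp add: psi_def)
qed

text \<open>Replacing \<open>c\<close> by \<open>c (j x)\<close> with large \<open>j\<close> makes the big jumps exhaust \<open>\<nu>\<close>.\<close>

lemma rescale:
  assumes j: "0 < j"
  shows "dens_levy \<nu> (\<lambda>x. c (real j * x)) (\<epsilon> / real j) s n"
proof -
  have C: "Cb (\<lambda>x. c (real j * x))" by (rule Cb_scale(1)[OF Cb_c])
  have "smooth (\<lambda>x. c (real j * x))"
    using C unfolding smooth_def times_differentiable_on_def Cb_def by blast
  moreover have "indicator {-(\<epsilon> / real j)/2..(\<epsilon> / real j)/2} x \<le> c (real j * x) \<and> c (real j * x) \<le> indicator {-(\<epsilon> / real j)..(\<epsilon> / real j)} x" for x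
  proof -
    have 1: "c (real j * x) = 1" if "x \<in> {-(\<epsilon> / real j)/2..(\<epsilon> / real j)/2}"
    proof (rule c_bounds(3))
      have "\<bar>x\<bar> \<le> \<epsilon> / (2 * real j)" using that by (auto simp: abs_le_iff)
      then show "\<bar>real j * x\<bar> \<le> \<epsilon> / 2" using j by (simp add: abs_mult field_simps)
    qed
    have 2: "c (real j * x) = 0" if "x \<notin> {-(\<epsilon> / real j)..(\<epsilon> / real j)}"
    proof (rule c_bounds(4))
      have "\<epsilon> / real j < \<bar>x\<bar>" using that by auto
      then show "\<epsilon> < \<bar>real j * x\<bar>" using j by (simp add: abs_mult divide_less_eq mult.commute)
    qed
    show ?thesis using 1 2 c_bounds(1,2) by (auto simp: indicator_def)
  qed
  ultimately have tr': "truncation (\<epsilon> / real j) (\<lambda>x. c (real j * x))" by (simp add: truncation_def)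
  have e1: "\<epsilon> / real j < 1" using \<epsilon> j by (simp add: divide_less_eq)
  have e0: "0 < \<epsilon> / real j" using \<epsilon> j by simp
  show ?thesis
    by (intro dens_levy.intro trunc_levy.intro dens_levy_axioms.intro; (rule \<nu> sf tr' e0 e1 sm \<nu>s sreg | erule s0))
qed

lemma nu_AE_nonzero: "AE u in \<nu>. u \<noteq> 0"
  using levy_measureD(1,4)[OF \<nu>] by (intro AE_I'[of "{0}"]) (auto simp: null_sets_def)

lemma c_scaled_limit: "u \<noteq> 0 \<Longrightarrow> \<exists>N. \<forall>j\<ge>N. c (real (Suc j) * u) = 0"
proof -
  assume u: "u \<noteq> 0"
  obtain N :: nat where N: "\<epsilon> / \<bar>u\<bar> < real N" using reals_Archimedean2 by blast
  have "c (real (Suc j) * u) = 0" if "N \<le> j" for j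
  proof (rule c_bounds(4))
    have "\<epsilon> / \<bar>u\<bar> < real (Suc j)" using N that by linarith
    then show "\<epsilon> < \<bar>real (Suc j) * u\<bar>" using u by (simp add: abs_mult divide_less_eq)
  qed
  then show ?thesis by blast
qed

text \<open>The weights 1 - c (j u) tend to 1 off the origin, so by Fatou's lemma a common bound for
  the masses would bound \<nu> itself.\<close>

lemma infinite_activity:
  assumes inf: "emeasure \<nu> UNIV = \<infinity>"
  shows "\<exists>j. K < measure (big_meas (\<lambda>x. c (real (Suc j) * x)) \<nu>) UNIV"
proof (rule ccontr)
  assume "\<not> ?thesis"
  then have le: "measure (big_meas (\<lambda>x. c (real (Suc j) * x)) \<nu>) UNIV \<le> K" for j by (simp add: not_less)
  note [measurable_cong] = sn
  have b: "(\<integral>\<^sup>+u. ennreal (1 - c (real (Suc j) * u)) \<partial>\<nu>) \<le> ennreal K" for j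
  proof -
    interpret j: dens_levy \<nu> "\<lambda>x. c (real (Suc j) * x)" "\<epsilon> / real (Suc j)" s n by (rule rescale) simp
    interpret F: finite_measure "big_meas (\<lambda>x. c (real (Suc j) * x)) \<nu>" using fin_borelD(1)[OF j.fin_U] .
    have "(\<integral>\<^sup>+u. ennreal (1 - c (real (Suc j) * u)) \<partial>\<nu>) = emeasure (big_meas (\<lambda>x. c (real (Suc j) * x)) \<nu>) UNIV"
      unfolding big_meas_def using levy_measureD(1,2)[OF \<nu>] by (subst emeasure_density) (auto intro!: nn_integral_cong)
    also have "\<dots> \<le> ennreal K" unfolding F.emeasure_eq_measure using le by (rule ennreal_leI)
    finally show ?thesis .
  qed
  have "emeasure \<nu> UNIV = (\<integral>\<^sup>+u. 1 \<partial>\<nu>)" using levy_measureD(2)[OF \<nu>] by simp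
  also have "\<dots> = (\<integral>\<^sup>+u. liminf (\<lambda>j. ennreal (1 - c (real (Suc j) * u))) \<partial>\<nu>)"
  proof (rule nn_integral_cong_AE)
    show "AE u in \<nu>. 1 = liminf (\<lambda>j. ennreal (1 - c (real (Suc j) * u)))"
      using nu_AE_nonzero
    proof eventually_elim
      case (elim u)
      from c_scaled_limit[OF this] have "\<forall>\<^sub>F j in sequentially. ennreal (1 - c (real (Suc j) * u)) = 1"
        unfolding eventually_sequentially by (metis diff_zero ennreal_1)
      then have "(\<lambda>j. ennreal (1 - c (real (Suc j) * u))) \<longlonglongrightarrow> 1" by (rule tendsto_eventually)
      then show ?case by (intro lim_imp_Liminf[symmetric]) auto
    qed
  qed
  also have "\<dots> \<le> liminf (\<lambda>j. \<integral>\<^sup>+u. ennreal (1 - c (real (Suc j) * u)) \<partial>\<nu>)"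
    by (rule nn_integral_liminf) measurable
  also have "\<dots> \<le> liminf (\<lambda>j. ennreal K)" by (intro Liminf_mono always_eventually allI b)
  also have "\<dots> = ennreal K" by (simp add: Liminf_const)
  finally show False using inf by (simp add: top_unique)
qed

lemma abs_freq_at_top: "\<eta> \<noteq> 0 \<Longrightarrow> filterlim (\<lambda>k. \<bar>real k * \<eta>\<bar>) at_top sequentially"
proof -
  assume "\<eta> \<noteq> 0"
  then have "filterlim (\<lambda>k. \<bar>\<eta>\<bar> * real k) at_top sequentially"
    by (intro filterlim_tendsto_pos_mult_at_top[OF tendsto_const] filterlim_real_sequentially) auto
  then show ?thesis by (simp add: abs_mult mult.commute)
qed

text \<open>A Gaussian part gives quadratic decay. Otherwise the big jumps for a fine truncation
  have arbitrarily large mass, while their cosine transform tends to 0 along the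
  frequencies.\<close>

lemma Re_psi_at_bot:
  assumes n: "1 \<le> n" and \<eta>: "\<eta> \<noteq> 0" and A: "\<sigma> \<noteq> 0 \<or> emeasure \<nu> UNIV = \<infinity>"
  shows "filterlim (\<lambda>k. Re (psi \<sigma> b \<nu> (real k * \<eta>))) at_bot sequentially"
  unfolding filterlim_at_bot
proof
  fix K :: real
  show "\<forall>\<^sub>F k in sequentially. Re (psi \<sigma> b \<nu> (real k * \<eta>)) \<le> K"
  proof (cases "\<sigma> = 0")
    case False
    have ab: "\<bar>avg U (\<lambda>x. cos (\<xi> * x + 0)) 0\<bar> \<le> measure U UNIV * 1" for \<xi>
      by (rule avg_bound[OF fin_U]) auto
    have "filterlim (\<lambda>k. (\<sigma>\<^sup>2 / 2) * (\<bar>real k * \<eta>\<bar> * \<bar>real k * \<eta>\<bar>)) at_top sequentially"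
      using False by (intro filterlim_tendsto_pos_mult_at_top[OF tendsto_const] filterlim_at_top_mult_at_top abs_freq_at_top \<eta>) auto
    then have "\<forall>\<^sub>F k in sequentially. - K \<le> (\<sigma>\<^sup>2 / 2) * (\<bar>real k * \<eta>\<bar> * \<bar>real k * \<eta>\<bar>)"
      unfolding filterlim_at_top by blast
    then show ?thesis
    proof eventually_elim
      case (elim k)
      have "(\<sigma>\<^sup>2 / 2) * (\<bar>real k * \<eta>\<bar> * \<bar>real k * \<eta>\<bar>) = \<sigma>\<^sup>2 * (real k * \<eta>)\<^sup>2 / 2"
        by (simp add: power2_eq_square[of "real k * \<eta>"])
      then show ?case using elim Re_psi_le[of \<sigma> b "real k * \<eta>"] ab[of "real k * \<eta>"] by linarith
    qed
  next
    case True
    \<comment> \<open>The additional 1 absorbs the cosine transform, which is eventually smaller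
      than 1.\<close>
    then obtain j where j: "1 - K < measure (big_meas (\<lambda>x. c (real (Suc j) * x)) \<nu>) UNIV"
      using A infinite_activity[of "1 - K"] by auto
    interpret j: dens_levy \<nu> "\<lambda>x. c (real (Suc j) * x)" "\<epsilon> / real (Suc j)" s n by (rule rescale) simp
    have "(\<lambda>k. avg j.U (\<lambda>x. cos (real k * \<eta> * x + 0)) 0) \<longlonglongrightarrow> 0"
      by (rule j.riemann_lebesgue[OF n abs_freq_at_top[OF \<eta>]])
    then have "\<forall>\<^sub>F k in sequentially. avg j.U (\<lambda>x. cos (real k * \<eta> * x + 0)) 0 < 1"
      by (rule order_tendstoD) simp
    then show ?thesis
    proof eventually_elim
      case (elim k)
      then show ?case using j j.Re_psi_le[of \<sigma> b "real k * \<eta>"] True by simp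
    qed
  qed
qed

text \<open>The density is regular only away from 0, so the Riemann-Lebesgue lemma is applied to the
  big jumps for a fine truncation. The thirds of e go to the real part, the imaginary part and the
  mass left near 0.\<close>

lemma finite_activity_fourier_null:
  assumes n: "1 \<le> n" and \<eta>: "\<eta> \<noteq> 0" and fin: "emeasure \<nu> UNIV < \<infinity>"
  shows "(\<lambda>k. \<integral>u. iexp (real k * \<eta> * u) \<partial>\<nu>) \<longlonglongrightarrow> 0"
proof (rule LIMSEQ_I)
  fix e :: real assume e: "0 < e"
  note [measurable_cong] = sn
  have F: "fin_borel \<nu>" using fin levy_measureD[OF \<nu>] by (auto simp: fin_borel_def intro!: finite_measureI)
  have "(\<lambda>j. \<integral>u. c (real (Suc j) * u) \<partial>\<nu>) \<longlonglongrightarrow> (\<integral>u. 0 \<partial>\<nu>)"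
  proof (rule integral_dominated_convergence[where w="\<lambda>_. 1"])
    show "AE u in \<nu>. (\<lambda>j. c (real (Suc j) * u)) \<longlonglongrightarrow> 0"
      using nu_AE_nonzero
    proof eventually_elim
      case (elim u)
      from c_scaled_limit[OF this] show ?case by (intro tendsto_eventually) (auto simp: eventually_sequentially)
    qed
    show "integrable \<nu> (\<lambda>_. 1 :: real)" by (rule fin_borel_integrable[OF F, where B=1]) auto
  qed (auto simp: c_bounds)
  then have "(\<lambda>j. \<integral>u. c (real (Suc j) * u) \<partial>\<nu>) \<longlonglongrightarrow> 0" by simp
  then have "\<forall>\<^sub>F j in sequentially. (\<integral>u. c (real (Suc j) * u) \<partial>\<nu>) < e / 3"
    by (rule order_tendstoD) (use e in simp)
  then obtain j where j: "(\<integral>u. c (real (Suc j) * u) \<partial>\<nu>) < e / 3" by (auto simp: eventually_sequentially)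
  let ?c = "\<lambda>u. c (real (Suc j) * u)"
  interpret j: dens_levy \<nu> ?c "\<epsilon> / real (Suc j)" s n by (rule rescale) simp
  note RL = j.riemann_lebesgue[OF n abs_freq_at_top[OF \<eta>]]
  obtain N1 where N1: "\<And>k. N1 \<le> k \<Longrightarrow> \<bar>avg j.U (\<lambda>x. cos (real k * \<eta> * x + 0)) 0\<bar> < e / 3"
    using LIMSEQ_D[OF RL[of 0], of "e / 3"] e by auto
  obtain N2 where N2: "\<And>k. N2 \<le> k \<Longrightarrow> \<bar>avg j.U (\<lambda>x. cos (real k * \<eta> * x + - (pi / 2))) 0\<bar> < e / 3"
    using LIMSEQ_D[OF RL[of "- (pi / 2)"], of "e / 3"] e by auto
  have "norm ((\<integral>u. iexp (real k * \<eta> * u) \<partial>\<nu>) - 0) < e" if k: "max N1 N2 \<le> k" for k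
  proof -
    let ?x = "real k * \<eta>"
    have i1: "complex_integrable \<nu> (\<lambda>u. (1 - ?c u) *\<^sub>R iexp (?x * u))" and i2: "complex_integrable \<nu> (\<lambda>u. ?c u *\<^sub>R iexp (?x * u))"
      by (rule fin_borel_integrable[OF F, where B=1]; auto simp: c_bounds)+
    have iU: "complex_integrable j.U (\<lambda>u. iexp (?x * u))"
      by (rule fin_borel_integrable[OF j.fin_U, where B=1]) auto
    have "(\<integral>u. iexp (?x * u) \<partial>\<nu>) = (\<integral>u. (1 - ?c u) *\<^sub>R iexp (?x * u) + ?c u *\<^sub>R iexp (?x * u) \<partial>\<nu>)"
      by (simp only: scaleR_add_left[symmetric]) simp
    also have "\<dots> = (\<integral>u. (1 - ?c u) *\<^sub>R iexp (?x * u) \<partial>\<nu>) + (\<integral>u. ?c u *\<^sub>R iexp (?x * u) \<partial>\<nu>)"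
      by (rule Bochner_Integration.integral_add[OF i1 i2])
    also have "(\<integral>u. (1 - ?c u) *\<^sub>R iexp (?x * u) \<partial>\<nu>) = (\<integral>u. iexp (?x * u) \<partial>j.U)"
      unfolding big_meas_def by (subst integral_density) (auto simp: c_bounds)
    also have "(\<integral>u. iexp (?x * u) \<partial>j.U) = Complex (avg j.U (\<lambda>x. cos (?x * x + 0)) 0) (avg j.U (\<lambda>x. cos (?x * x + - (pi / 2))) 0)"
    proof (rule complex_eqI)
      show "Re (\<integral>u. iexp (?x * u) \<partial>j.U) = Re (Complex (avg j.U (\<lambda>x. cos (?x * x + 0)) 0) (avg j.U (\<lambda>x. cos (?x * x + - (pi / 2))) 0))"
        by (subst integral_Re[symmetric, OF iU]) (simp add: avg_def Re_exp)
      show "Im (\<integral>u. iexp (?x * u) \<partial>j.U) = Im (Complex (avg j.U (\<lambda>x. cos (?x * x + 0)) 0) (avg j.U (\<lambda>x. cos (?x * x + - (pi / 2))) 0))"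
        by (subst integral_Im[symmetric, OF iU]) (simp add: avg_def Im_exp cos_diff)
    qed
    finally have "norm (\<integral>u. iexp (?x * u) \<partial>\<nu>) \<le>
      norm (Complex (avg j.U (\<lambda>x. cos (?x * x + 0)) 0) (avg j.U (\<lambda>x. cos (?x * x + - (pi / 2))) 0)) + norm (\<integral>u. ?c u *\<^sub>R iexp (?x * u) \<partial>\<nu>)"
      by (simp only: norm_triangle_ineq)
    moreover have "norm (Complex (avg j.U (\<lambda>x. cos (?x * x + 0)) 0) (avg j.U (\<lambda>x. cos (?x * x + - (pi / 2))) 0)) < e / 3 + e / 3"
    proof -
      let ?z = "Complex (avg j.U (\<lambda>x. cos (?x * x + 0)) 0) (avg j.U (\<lambda>x. cos (?x * x + - (pi / 2))) 0)"
      have "norm ?z \<le> \<bar>Re ?z\<bar> + \<bar>Im ?z\<bar>" by (rule cmod_le)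
      moreover have "\<bar>Re ?z\<bar> < e / 3" "\<bar>Im ?z\<bar> < e / 3" unfolding complex.sel using N1[of k] N2[of k] k by simp_all
      ultimately show ?thesis by linarith
    qed
    moreover have "norm (\<integral>u. ?c u *\<^sub>R iexp (?x * u) \<partial>\<nu>) \<le> (\<integral>u. ?c u \<partial>\<nu>)"
    proof -
      have "norm (\<integral>u. ?c u *\<^sub>R iexp (?x * u) \<partial>\<nu>) \<le> (\<integral>u. norm (?c u *\<^sub>R iexp (?x * u)) \<partial>\<nu>)" by (rule integral_norm_bound)
      then show ?thesis by (simp add: c_bounds)
    qed
    ultimately show ?thesis using j by simp
  qed
  then show "\<exists>no. \<forall>k\<ge>no. norm ((\<integral>u. iexp (real k * \<eta> * u) \<partial>\<nu>) - 0) < e" by blast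
qed

text \<open>With a Gaussian part or infinite activity the characteristic function vanishes along the
  frequencies. Otherwise it is asymptotic to that of the mass \<open>exp (- (t * \<Lambda>))\<close>
  at the drift point a, the event of no jump, and y differs from a.\<close>

lemma no_atom_levy:
  assumes n: "1 \<le> n" and \<rho>: "real_distribution \<rho>" and ch: "\<And>\<xi>. char \<rho> \<xi> = exp (t * psi \<sigma> b \<nu> \<xi>)"
    and t: "0 < t" and nd: "\<not> drift_atom \<sigma> b \<nu> t y"
  shows "measure \<rho> {y} = 0"
proof (cases "\<sigma> \<noteq> 0 \<or> emeasure \<nu> UNIV = \<infinity>")
  case True
  have "filterlim (\<lambda>k. t * Re (psi \<sigma> b \<nu> (real k * pi))) at_bot sequentially"
    by (rule filterlim_tendsto_pos_mult_at_bot[OF tendsto_const t Re_psi_at_bot[OF n _ True]]) simp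
  then have "(\<lambda>k. exp (t * Re (psi \<sigma> b \<nu> (real k * pi)))) \<longlonglongrightarrow> 0"
    by (rule filterlim_compose[OF exp_at_bot])
  then have "(\<lambda>k. norm (char \<rho> (real k * pi))) \<longlonglongrightarrow> 0" by (simp add: ch)
  then have "(\<lambda>k. char \<rho> (real k * pi)) \<longlonglongrightarrow> 0" by (rule tendsto_norm_zero_cancel)
  \<comment> \<open>With C = 0 any a is admissible; \<open>y + 1\<close> together with the frequency
    step \<pi> gives the value -1 in the condition on a.\<close>
  then show ?thesis
    by (intro no_atom[OF \<rho>, where \<eta>=pi and C=0 and a="y + 1"]) auto
next
  case False
  then have \<sigma>: "\<sigma> = 0" and fin: "emeasure \<nu> UNIV < \<infinity>" by (auto simp: less_top)
  note [measurable_cong] = sn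
  have F: "fin_borel \<nu>" using fin levy_measureD[OF \<nu>] by (auto simp: fin_borel_def intro!: finite_measureI)
  define m where "m = (LINT u : {-1..1} | \<nu>. u)"
  define a where "a = t * (b - m)"
  define \<Lambda> where "\<Lambda> = measure \<nu> UNIV"
  have ay: "a \<noteq> y" using nd \<sigma> fin by (auto simp: drift_atom_def a_def m_def)
  \<comment> \<open>Makes \<open>iexp (\<eta> * (a - y))\<close> equal to -1, so that a is not in
    the coset of y.\<close>
  define \<eta> where "\<eta> = pi / (a - y)"
  have \<eta>: "\<eta> \<noteq> 0" using ay by (simp add: \<eta>_def)
  have ne: "iexp (\<eta> * (a - y)) \<noteq> 1" using ay by (simp add: \<eta>_def)
  define Nf where "Nf \<xi> = (\<integral>u. iexp (\<xi> * u) \<partial>\<nu>)" for \<xi>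
  have psi: "psi \<sigma> b \<nu> \<xi> = \<i> * (\<xi> * (b - m)) - \<Lambda> + Nf \<xi>" for \<xi>
  proof -
    have i1: "complex_integrable \<nu> (\<lambda>u. iexp (\<xi> * u))" by (rule fin_borel_integrable[OF F, where B=1]) auto
    have i2: "complex_integrable \<nu> (\<lambda>u. 1)" by (rule fin_borel_integrable[OF F, where B=1]) auto
    have i3: "integrable \<nu> (\<lambda>u. indicat_real {-1..1} u *\<^sub>R u)"
      by (rule fin_borel_integrable[OF F, where B=1]) (auto simp: indicator_def)
    have "(\<integral>u. psi_fun \<xi> u \<partial>\<nu>) = (\<integral>u. iexp (\<xi> * u) - 1 - \<i> * \<xi> * of_real (indicat_real {-1..1} u *\<^sub>R u) \<partial>\<nu>)"
      by (rule Bochner_Integration.integral_cong) (auto simp: psi_fun_def mult_ac)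
    also have "\<dots> = Nf \<xi> - (\<integral>u. 1 \<partial>\<nu>) - \<i> * \<xi> * of_real m"
    proof -
      have i4: "complex_integrable \<nu> (\<lambda>u. \<i> * \<xi> * of_real (indicat_real {-1..1} u *\<^sub>R u))"
        by (intro integrable_mult_right integrable_of_real i3)
      have "(\<integral>u. \<i> * \<xi> * of_real (indicat_real {-1..1} u *\<^sub>R u) \<partial>\<nu>) = \<i> * \<xi> * of_real m"
        unfolding m_def set_lebesgue_integral_def by (simp only: integral_mult_right_zero integral_complex_of_real)
      then show ?thesis unfolding Nf_def
        by (simp only: Bochner_Integration.integral_diff[OF Bochner_Integration.integrable_diff[OF i1 i2] i4] Bochner_Integration.integral_diff[OF i1 i2])
    qed
    also have "(\<integral>u. 1 \<partial>\<nu>) = complex_of_real \<Lambda>" using levy_measureD(2)[OF \<nu>] by (simp add: \<Lambda>_def scaleR_conv_of_real)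
    finally show ?thesis by (simp add: psi_def \<sigma> algebra_simps)
  qed
  let ?C = "exp (- (t * \<Lambda>))"
  have eq: "char \<rho> \<xi> - of_real ?C * iexp (\<xi> * a) = of_real ?C * iexp (\<xi> * a) * (exp (t * Nf \<xi>) - 1)" for \<xi>
  proof -
    have "char \<rho> \<xi> = of_real ?C * iexp (\<xi> * a) * exp (t * Nf \<xi>)"
      unfolding ch psi a_def exp_of_real[symmetric] exp_add[symmetric] by (simp add: algebra_simps)
    then show ?thesis by (simp add: algebra_simps)
  qed
  have "(\<lambda>k. exp (t * Nf (real k * \<eta>)) - 1) \<longlonglongrightarrow> exp (complex_of_real t * 0) - 1"
    unfolding Nf_def by (intro tendsto_intros finite_activity_fourier_null[OF n \<eta> fin])
  then have "(\<lambda>k. norm (of_real ?C * iexp (real k * \<eta> * a) * (exp (t * Nf (real k * \<eta>)) - 1))) \<longlonglongrightarrow> 0"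
    by (simp add: norm_mult tendsto_norm_zero_iff tendsto_mult_right_zero)
  then have "(\<lambda>k. char \<rho> (real k * \<eta>) - of_real ?C * iexp (real k * \<eta> * a)) \<longlonglongrightarrow> 0"
    unfolding eq by (rule tendsto_norm_zero_cancel)
  then show ?thesis by (rule no_atom[OF \<rho> _ ne])
qed

end

section \<open>Passage to the limit in the Taylor expansion\<close>

theorem proposition4p2:
  fixes M :: "'a measure" and X :: "real \<Rightarrow> 'a \<Rightarrow> real"
    and \<sigma> b y \<epsilon> :: real and \<nu> :: "real measure"
    and s \<phi> c :: "real \<Rightarrow> real" and n :: nat
  assumes y: "y > 0" and n: "n \<ge> 1"
    and eps: "0 < \<epsilon>" "\<epsilon> < min (y / (real n + 1)) 1"
    and X: "levy_triplet M X \<sigma> b \<nu>"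
    and s_dens: "s \<in> borel_measurable borel" "\<And>x. x \<noteq> 0 \<Longrightarrow> 0 \<le> s x"
      "\<nu> = density lborel (\<lambda>x. ennreal (s x))"
    and s_diff: "times_differentiable_on (2 * n + 1) s (- {0})"
    and s_bdd: "\<And>k \<delta>. k \<le> 2 * n + 1 \<Longrightarrow> \<delta> > 0 \<Longrightarrow>
      bdd_above ((\<lambda>x. \<bar>(deriv ^^ k) s x\<bar>) ` {x. \<bar>x\<bar> > \<delta>})"
    and phi: "bump \<phi>"
    and c: "truncation \<epsilon> c"
  shows "(\<forall>k\<in>{1..n}.
            convergent (gen_seq \<phi> \<sigma> b \<nu> k y) \<and>
            d_hat \<phi> \<sigma> b \<nu> k y =
              (\<Sum>kk\<in>multis k. c_hat c \<sigma> b \<nu> kk * multinom kk * a_coeff c s \<nu> y kk)) \<and>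
         (\<forall>t\<ge>0.
            convergent (rem_seq M X \<phi> \<sigma> b \<nu> n t y) \<and>
            (\<not> drift_atom \<sigma> b \<nu> t y \<longrightarrow>
              measure M {\<omega> \<in> space M. X t \<omega> \<ge> y} =
                (\<Sum>k=1..n. d_hat \<phi> \<sigma> b \<nu> k y * t ^ k / fact k)
                + t ^ (n + 1) / fact n * remainder M X \<phi> \<sigma> b \<nu> n t y))"
proof -
  have \<nu>: "levy_measure \<nu>" and lp: "levy_process M X" using X by (auto simp: levy_triplet_def)
  interpret prob_space M using lp by (simp add: levy_process_def)
  have Xm: "X t \<in> borel_measurable M" if "0 \<le> t" for t using lp that by (auto simp: levy_process_def)
  have X0: "AE \<omega> in M. X 0 \<omega> = 0" using lp by (simp add: levy_process_def)
  have sf: "sigma_finite_measure \<nu>"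
    unfolding s_dens(3) using s_dens(1) by (subst sigma_finite_measure.sigma_finite_iff_density_finite[OF lborel.sigma_finite_measure_axioms]) auto
  have e1: "\<epsilon> < 1" and e2: "(real n + 1) * \<epsilon> < y" using eps(2) by (simp_all add: less_divide_eq mult.commute)
  have sreg: "smooth_off_0 (2 * n + 1) s"
    unfolding smooth_off_0_iff
  proof (intro conjI allI impI)
    fix k assume k: "k \<le> 2 * n + 1"
    show "bounded_off_0 ((deriv ^^ k) s)"
      unfolding bounded_off_0_def
    proof (intro allI impI)
      fix \<delta> :: real assume "0 < \<delta>"
      from s_bdd[OF k this] obtain B where "\<And>z. z \<in> (\<lambda>x. \<bar>(deriv ^^ k) s x\<bar>) ` {x. \<bar>x\<bar> > \<delta>} \<Longrightarrow> z \<le> B"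
        unfolding bdd_above_def by blast
      then show "\<exists>B. \<forall>x. \<delta> < \<bar>x\<bar> \<longrightarrow> \<bar>(deriv ^^ k) s x\<bar> \<le> B" by blast
    qed
  next
    fix k and x :: real assume "k < 2 * n + 1" "x \<noteq> 0"
    then show "(deriv ^^ k) s field_differentiable at x"
      using s_diff by (simp add: times_differentiable_on_def)
  qed
  interpret D: dens_levy \<nu> c \<epsilon> s n
    by (intro dens_levy.intro trunc_levy.intro dens_levy_axioms.intro; (rule \<nu> sf c eps(1) e1 s_dens(1,3) sreg | erule s_dens(2)))
  define \<rho> where "\<rho> t = distr M borel (X t)" for t
  have \<rho>_char: "char (\<rho> t) \<xi> = exp (t * psi \<sigma> b \<nu> \<xi>)" if "0 \<le> t" for t \<xi>
    unfolding \<rho>_def by (rule levy_char[OF X sf that])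
  have \<rho>_rd: "real_distribution (\<rho> t)" if "0 \<le> t" for t
    unfolding \<rho>_def by (rule real_distribution_distr[OF Xm[OF that]])
  interpret F: levy_family \<rho> "psi \<sigma> b \<nu>" "b0 c \<nu>" "b1 c b \<nu>" "b2 \<sigma>" D.U D.V
  proof (rule levy_family.intro)
    show "Lop (b0 c \<nu>) (b1 c b \<nu>) (b2 \<sigma>) D.U D.V (\<lambda>x. cos (\<xi> * x + \<theta>)) x = Re (psi \<sigma> b \<nu> \<xi> * iexp (\<xi> * x + \<theta>))" for \<xi> \<theta> x
      unfolding D.levy_gen_Lop[OF Cb_cos(1), symmetric] by (rule D.levy_gen_cos)
  qed (rule D.fin_U D.fin_V | erule \<rho>_char \<rho>_rd)+
  \<comment> \<open>The truncation function itself serves as the cutoff: it is 1 up to \<epsilon> /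
    2 and 0 beyond \<epsilon> < 1.\<close>
  have dy: "F.dynkin g" if "Cb g" for g
    by (rule F.dynkin_Cb[where a="\<epsilon> / 2" and d=\<epsilon>, OF D.Cb_c _ D.c_bounds(3) e1 D.c_bounds(4) that]) (use eps in simp_all)
  let ?f = "\<lambda>m. moll_ind \<phi> y (Suc m)"
  have fC: "Cb (?f m)" for m by (rule moll_ind_Cb(1)[OF phi]) simp
  have gen: "(levy_gen \<sigma> b \<nu> ^^ k) (?f m) = (F.L ^^ k) (?f m)" for k m by (rule D.levy_gen_power[OF fC])
  have lim_gen: "gen_seq \<phi> \<sigma> b \<nu> k y \<longlonglongrightarrow> (\<Sum>kk\<in>multis k. c_hat c \<sigma> b \<nu> kk * multinom kk * a_coeff c s \<nu> y kk)"
    if "k \<le> n + 1" for k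
    by (rule D.levy_gen_power_limit[OF phi y e2 that])
  have d_hat: "gen_seq \<phi> \<sigma> b \<nu> k y \<longlonglongrightarrow> d_hat \<phi> \<sigma> b \<nu> k y" if "k \<le> n + 1" for k
    unfolding d_hat_def using lim_gen[OF that] by (metis limI)
  define Q where "Q t m = (LINT \<alpha> : {0..1} | lborel. (1 - \<alpha>) ^ n * (\<integral>x. (F.L ^^ (n + 1)) (?f m) x \<partial>\<rho> (\<alpha> * t)))" for t m
  have Q: "rem_seq M X \<phi> \<sigma> b \<nu> n t y (Suc m) = Q t m" if t: "0 \<le> t" for t m
    unfolding rem_seq_def Q_def gen
  proof (rule set_lebesgue_integral_cong)
    show "\<forall>\<alpha>. \<alpha> \<in> {0..1} \<longrightarrow> (1 - \<alpha>) ^ n * (\<integral>\<omega>. (F.L ^^ (n + 1)) (?f m) (X (\<alpha> * t) \<omega>) \<partial>M) =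
        (1 - \<alpha>) ^ n * (\<integral>x. (F.L ^^ (n + 1)) (?f m) x \<partial>\<rho> (\<alpha> * t))"
    proof (intro allI impI)
      fix \<alpha> :: real assume "\<alpha> \<in> {0..1}"
      then have "0 \<le> \<alpha> * t" using t by simp
      then show "(1 - \<alpha>) ^ n * (\<integral>\<omega>. (F.L ^^ (n + 1)) (?f m) (X (\<alpha> * t) \<omega>) \<partial>M) =
        (1 - \<alpha>) ^ n * (\<integral>x. (F.L ^^ (n + 1)) (?f m) x \<partial>\<rho> (\<alpha> * t))"
        unfolding \<rho>_def by (subst integral_distr[OF Xm Cb_measurable[OF F.CbLk[OF fC]]]) auto
    qed
  qed simp
  have taylor: "(\<integral>x. ?f m x \<partial>\<rho> t) = (\<Sum>k\<le>n. t ^ k / fact k * gen_seq \<phi> \<sigma> b \<nu> k y (Suc m)) + t ^ (n + 1) / fact n * Q t m"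
    if "0 \<le> t" for t m
    using F.taylor_expansion[OF dy fC that, where n=n] unfolding gen_seq_def gen Q_def .
  \<comment> \<open>The term of order 0 is the mollified indicator at 0, which tends to 0 as 0 < y;
    hence the expansion starts at k = 1.\<close>
  have d0: "gen_seq \<phi> \<sigma> b \<nu> 0 y \<longlonglongrightarrow> 0"
  proof -
    have "(\<lambda>m. gen_seq \<phi> \<sigma> b \<nu> 0 y (Suc m)) \<longlonglongrightarrow> 0"
      using moll_limit_neq[OF phi, of 0 y] y by (simp add: gen_seq_def)
    then show ?thesis by (simp only: filterlim_sequentially_Suc)
  qed
  have sum_lim: "(\<lambda>m. \<Sum>k\<le>n. t ^ k / fact k * gen_seq \<phi> \<sigma> b \<nu> k y (Suc m)) \<longlonglongrightarrow> (\<Sum>k=1..n. d_hat \<phi> \<sigma> b \<nu> k y * t ^ k / fact k)" for t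
  proof -
    have "(\<lambda>m. \<Sum>k\<le>n. t ^ k / fact k * gen_seq \<phi> \<sigma> b \<nu> k y (Suc m)) \<longlonglongrightarrow> (\<Sum>k\<le>n. t ^ k / fact k * (if k = 0 then 0 else d_hat \<phi> \<sigma> b \<nu> k y))"
    proof (intro tendsto_sum tendsto_mult tendsto_const)
      fix k assume "k \<in> {..n}"
      then show "(\<lambda>m. gen_seq \<phi> \<sigma> b \<nu> k y (Suc m)) \<longlonglongrightarrow> (if k = 0 then 0 else d_hat \<phi> \<sigma> b \<nu> k y)"
        using d0 d_hat[of k] by (auto simp: filterlim_sequentially_Suc)
    qed
    also have "(\<Sum>k\<le>n. t ^ k / fact k * (if k = 0 then 0 else d_hat \<phi> \<sigma> b \<nu> k y)) = (\<Sum>k=1..n. d_hat \<phi> \<sigma> b \<nu> k y * t ^ k / fact k)"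
      by (rule sum.mono_neutral_cong_right) auto
    finally show ?thesis .
  qed
  \<comment> \<open>The pointwise limit of the mollified indicators. At y they all equal
    \<open>bump_cdf \<phi> 0\<close>, so the expectations converge in the presence of an atom
    too.\<close>
  define h where "h x = (if x = y then bump_cdf \<phi> 0 else of_bool (y \<le> x))" for x
  have E_lim: "(\<lambda>m. \<integral>x. ?f m x \<partial>\<rho> t) \<longlonglongrightarrow> (\<integral>x. h x \<partial>\<rho> t)" if t: "0 \<le> t" for t
  proof -
    interpret R: real_distribution "\<rho> t" by (rule \<rho>_rd[OF t])
    have "(\<lambda>m. ?f m x) \<longlonglongrightarrow> h x" for x
      using moll_limit_neq[OF phi, of x y] moll_ind_eq[OF phi zero_less_Suc, of y _ x] by (auto simp: h_def)
    then show ?thesis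
      using moll_bound[OF phi, of y] Cb_measurable[OF fC]
      by (intro integral_dominated_convergence[where w="\<lambda>_. 1"]) (auto simp: h_def)
  qed
  have X_eq: "measure M {\<omega> \<in> space M. X t \<omega> \<ge> y} = measure (\<rho> t) {y..}" if t: "0 \<le> t" for t
  proof -
    have "X t -` {y..} \<inter> space M = {\<omega> \<in> space M. X t \<omega> \<ge> y}" by auto
    then show ?thesis unfolding \<rho>_def by (subst measure_distr[OF Xm[OF t]]) auto
  qed
  have part1: "\<forall>k\<in>{1..n}. convergent (gen_seq \<phi> \<sigma> b \<nu> k y) \<and> d_hat \<phi> \<sigma> b \<nu> k y =
        (\<Sum>kk\<in>multis k. c_hat c \<sigma> b \<nu> kk * multinom kk * a_coeff c s \<nu> y kk)"
  proof
    fix k assume "k \<in> {1..n}"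
    then have "k \<le> n + 1" by simp
    from lim_gen[OF this] show "convergent (gen_seq \<phi> \<sigma> b \<nu> k y) \<and> d_hat \<phi> \<sigma> b \<nu> k y =
        (\<Sum>kk\<in>multis k. c_hat c \<sigma> b \<nu> kk * multinom kk * a_coeff c s \<nu> y kk)"
      unfolding d_hat_def by (auto simp: convergent_def limI)
  qed
  have part2: "convergent (rem_seq M X \<phi> \<sigma> b \<nu> n t y) \<and>
      (\<not> drift_atom \<sigma> b \<nu> t y \<longrightarrow> measure M {\<omega> \<in> space M. X t \<omega> \<ge> y} =
        (\<Sum>k=1..n. d_hat \<phi> \<sigma> b \<nu> k y * t ^ k / fact k) + t ^ (n + 1) / fact n * remainder M X \<phi> \<sigma> b \<nu> n t y)"
    if t: "0 \<le> t" for t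
  proof (cases "t = 0")
    case True
    \<comment> \<open>At t = 0 every law involved is the unit mass at 0, so the inner expectation is
      the iterate of order n + 1 at 0, whose limit is known.\<close>
    have "Q 0 m = (LINT \<alpha> : {0..1} | lborel. (1 - \<alpha>) ^ n) * gen_seq \<phi> \<sigma> b \<nu> (n + 1) y (Suc m)" for m
      unfolding Q_def gen_seq_def gen using F.rho0[OF F.CbLk[OF fC]] by (simp del: funpow.simps)
    then have "(\<lambda>m. Q 0 m) \<longlonglongrightarrow> (LINT \<alpha> : {0..1} | lborel. (1 - \<alpha>) ^ n) * d_hat \<phi> \<sigma> b \<nu> (n + 1) y"
      using d_hat[of "n + 1"] by (auto simp: filterlim_sequentially_Suc intro!: tendsto_intros)
    then have "(\<lambda>m. rem_seq M X \<phi> \<sigma> b \<nu> n 0 y (Suc m)) \<longlonglongrightarrow> (LINT \<alpha> : {0..1} | lborel. (1 - \<alpha>) ^ n) * d_hat \<phi> \<sigma> b \<nu> (n + 1) y"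
      by (simp add: Q)
    then have "convergent (rem_seq M X \<phi> \<sigma> b \<nu> n 0 y)"
      unfolding filterlim_sequentially_Suc by (auto simp: convergent_def)
    moreover have "measure M {\<omega> \<in> space M. X 0 \<omega> \<ge> y} = 0"
    proof -
      have [measurable]: "X 0 \<in> borel_measurable M" by (rule Xm) simp
      have "measure M {\<omega> \<in> space M. X 0 \<omega> \<ge> y} = measure M {}"
        by (rule finite_measure_eq_AE) (use X0 y in \<open>auto elim: eventually_mono\<close>)
      then show ?thesis by simp
    qed
    moreover have "(\<Sum>k=1..n. d_hat \<phi> \<sigma> b \<nu> k y * 0 ^ k / fact k) = 0"
      by (rule sum.neutral) auto
    ultimately show ?thesis using True by simp
  next
    case False
    then have t': "0 < t" using t by simp
    define \<Sigma> where "\<Sigma> = (\<Sum>k=1..n. d_hat \<phi> \<sigma> b \<nu> k y * t ^ k / fact k)"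
    \<comment> \<open>The Taylor identity solved for the remainder, which t > 0 permits: its
      convergence follows from that of the expectations and of the finite sum.\<close>
    have "(\<lambda>m. ((\<integral>x. ?f m x \<partial>\<rho> t) - (\<Sum>k\<le>n. t ^ k / fact k * gen_seq \<phi> \<sigma> b \<nu> k y (Suc m))) * (fact n / t ^ (n + 1)))
      \<longlonglongrightarrow> ((\<integral>x. h x \<partial>\<rho> t) - \<Sigma>) * (fact n / t ^ (n + 1))"
      unfolding \<Sigma>_def by (intro tendsto_intros E_lim[OF t] sum_lim)
    also have "(\<lambda>m. ((\<integral>x. ?f m x \<partial>\<rho> t) - (\<Sum>k\<le>n. t ^ k / fact k * gen_seq \<phi> \<sigma> b \<nu> k y (Suc m))) * (fact n / t ^ (n + 1)))
      = (\<lambda>m. rem_seq M X \<phi> \<sigma> b \<nu> n t y (Suc m))"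
      unfolding taylor[OF t] Q[OF t] using t' by (auto simp: fun_eq_iff)
    finally have R: "rem_seq M X \<phi> \<sigma> b \<nu> n t y \<longlonglongrightarrow> ((\<integral>x. h x \<partial>\<rho> t) - \<Sigma>) * (fact n / t ^ (n + 1))"
      by (simp only: filterlim_sequentially_Suc)
    then have rem: "remainder M X \<phi> \<sigma> b \<nu> n t y = ((\<integral>x. h x \<partial>\<rho> t) - \<Sigma>) * (fact n / t ^ (n + 1))"
      unfolding remainder_def by (rule limI)
    have "measure M {\<omega> \<in> space M. X t \<omega> \<ge> y} = \<Sigma> + t ^ (n + 1) / fact n * remainder M X \<phi> \<sigma> b \<nu> n t y"
      if nd: "\<not> drift_atom \<sigma> b \<nu> t y"
    proof -
      interpret R: real_distribution "\<rho> t" by (rule \<rho>_rd[OF t])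
      have "measure (\<rho> t) {y} = 0" by (rule D.no_atom_levy[OF n \<rho>_rd[OF t] \<rho>_char[OF t] t' nd])
      \<comment> \<open>Without mass at y the exceptional value of h there is invisible, and h may
        be replaced by the indicator of the half-line.\<close>
      then have "AE x in \<rho> t. x \<noteq> y"
        using R.prob_eq_0[of "{y}"] by simp
      then have ae: "AE x in \<rho> t. h x = indicat_real {y..} x"
        by eventually_elim (simp add: h_def indicator_def)
      have "h \<in> borel_measurable (\<rho> t)" unfolding h_def[abs_def] by measurable
      then have "(\<integral>x. h x \<partial>\<rho> t) = (\<integral>x. indicat_real {y..} x \<partial>\<rho> t)"
        by (intro integral_cong_AE ae) auto
      also have "\<dots> = measure (\<rho> t) {y..}" by simp
      finally have "measure M {\<omega> \<in> space M. X t \<omega> \<ge> y} = (\<integral>x. h x \<partial>\<rho> t)" using X_eq[OF t] by simp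
      then show ?thesis unfolding rem using t' by simp
    qed
    then show ?thesis using R unfolding \<Sigma>_def by (auto simp: convergent_def)
  qed
  show ?thesis using part1 part2 by blast
qed

end
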